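(* Let $K$ be a field of characteristic zero, let $S=K[x_1,\dots,x_n]$ be the standard graded polynomial ring with $n\ge 1$, let $\mathfrak{m}=(x_1,\dots,x_n)$, and let $M$ be a graded $S$-module which is a (graded) submodule of a finitely generated graded free $S$-module. Let $c_M$ denote the smallest integer $k\ge 0$ such that $\mathfrak{m}^kM$ is componentwise linear. Then the following hold. (a) For any $k\ge c_M+1$, all non-zero strands of $\mathfrak{m}^kM$ are full; that is, if the $\ell$th strand of $\mathfrak{m}^kM$ is non-zero, then $\beta_{i,i+\ell}(\mathfrak{m}^kM)\neq 0$ for all $i=0,\dots,n-1$. (b) For any $k\ge c_M$ and any integer $\ell$, the $\ell$th strand of $\mathfrak{m}^kM$ is non-zero if and only if the $(\ell+1)$th strand of $\mathfrak{m}^{k+1}M$ is non-zero. (c) For all $k\ge c_M+1$, the Betti diagrams of the modules $\mathfrak{m}^kM$ have the same shape. (d) Suppose that $M$ is minimally generated in degrees $d_1,\dots,d_m$. For any $k\ge c_M$, if the $\ell$th strand of $\mathfrak{m}^kM$ is non-zero, then $\ell-k=d_i$ for some $1\le i\le m$. If in addition $\operatorname{depth}\operatorname{gr}_{\mathfrak{m}}(M)>0$, then for any $k\ge c_M$ the $\ell$th strand of $\mathfrak{m}^kM$ is non-zero if and only if $\ell-k=d_i$ for some $1\le i\le m$.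
   Context: $S$ has the standard grading $\deg x_i=1$. For a finitely generated graded $S$-module $N=\bigoplus_{j\in\mathbb{Z}}N_j$: - The graded Betti numbers are $\beta_{i,j}(N)=\dim_K \operatorname{Tor}_i^S(K,N)_j$, where $K=S/\mathfrak{m}$. The Betti table (Betti diagram) of $N$ is the table of the numbers $\beta_{i,i+\ell}(N)$, with $i$ indexing columns and $\ell$ indexing rows. - For $\ell\in\mathbb{Z}$, the $\ell$th strand of $N$ is the $\ell$th row $(\beta_{i,i+\ell}(N))_{i\ge 0}$ of the Betti table; it is non-zero if $\beta_{i,i+\ell}(N)\ne 0$ for some $i\ge 0$. - $N_{\langle d\rangle}$ denotes the graded submodule of $N$ generated by the $K$-vector space $N_d$. The module $N$ is componentwise linear if for every $d$ the module $N_{\langle d\rangle}$ has a linear resolution, i.e. $\beta_{i,i+j}(N_{\langle d\rangle})=0$ for all $i$ and all $j\neq d$ (the zero module is regarded as having a linear resolution). - It is known that for every finitely generated graded $S$-module $M$ the module $\mathfrak{m}^kM$ is componentwise linear for all $k\gg 0$, so $c_M$ is well defined; moreover $\mathfrak{m}^kM$ is componentwise linear for all $k\ge c_M$. Here $\mathfrak{m}^0M=M$. - The Betti diagrams of the modules $\mathfrak{m}^kM$ for all $k\ge k_0$ have the same shape if their patterns of non-zero entries agree up to the shift of rows by one from $k$ to $k+1$: for all $k\ge k_0$, all $i\ge 0$ and all $\ell\in\mathbb{Z}$, $\beta_{i,i+\ell}(\mathfrak{m}^kM)\neq 0$ if and only if $\beta_{i,i+\ell+1}(\mathfrak{m}^{k+1}M)\ne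 0$. - "$M$ is minimally generated in degrees $d_1,\dots,d_m$" means that $\{d_1,\dots,d_m\}$ is the set of degrees of the elements of a minimal homogeneous generating set of $M$, i.e. the set of $j$ with $\beta_{0,j}(M)\ne 0$. - $\operatorname{gr}_{\mathfrak{m}}(M)=\bigoplus_{k\ge 0}\mathfrak{m}^kM/\mathfrak{m}^{k+1}M$ is the associated graded module, regarded as a graded module over $\operatorname{gr}_{\mathfrak{m}}(S)\cong S$; its depth is taken with respect to the graded maximal ideal. *)

theory Defs
  imports Complex_Main "HOL-Library.Poly_Mapping" "HOL-Library.Function_Algebras"
    "HOL-Library.Extended_Nat" "HOL-Library.Cardinality"
begin

section \<open>The standard graded polynomial ring\<close>

text \<open>
  The polynomial ring over \<open>'k\<close> with one variable for each element of the finite type \<open>'x\<close>.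
  Types are inhabited, so the number \<open>CARD('x)\<close> of variables is an arbitrary integer \<open>n \<ge> 1\<close>.
\<close>

type_synonym ('x, 'k) mpoly = "('x \<Rightarrow>\<^sub>0 nat) \<Rightarrow>\<^sub>0 'k"

definition Var :: "'x \<Rightarrow> ('x, 'k::field) mpoly" where
  "Var x = Poly_Mapping.single (Poly_Mapping.single x 1) 1"

definition mdeg :: "('x::finite \<Rightarrow>\<^sub>0 nat) \<Rightarrow> int" where
  "mdeg t = (\<Sum>x\<in>UNIV. int (Poly_Mapping.lookup t x))"

definition homogeneous :: "int \<Rightarrow> ('x::finite, 'k::field) mpoly \<Rightarrow> bool" where
  "homogeneous d p \<longleftrightarrow> (\<forall>t\<in>Poly_Mapping.keys p. mdeg t = d)"

definition hcomp :: "int \<Rightarrow> ('x::finite, 'k::field) mpoly \<Rightarrow> ('x, 'k) mpoly" where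
  "hcomp d p = (\<Sum>t\<in>{t \<in> Poly_Mapping.keys p. mdeg t = d}.
                  Poly_Mapping.single t (Poly_Mapping.lookup p t))"

definition ideal_mult ::
    "(('x, 'k) mpoly \<Rightarrow> 'v \<Rightarrow> 'v) \<Rightarrow> ('x, 'k::field) mpoly set \<Rightarrow> 'v set \<Rightarrow> 'v::ab_group_add set" where
  "ideal_mult scale I N = module.span scale {scale a v | a v. a \<in> I \<and> v \<in> N}"

definition max_ideal :: "('x, 'k::field) mpoly set" where
  "max_ideal = module.span (*) (range Var)"

definition max_ideal_power :: "nat \<Rightarrow> ('x, 'k::field) mpoly set" where
  "max_ideal_power k = (ideal_mult (*) max_ideal ^^ k) UNIV"


section \<open>Graded submodules of graded free modules\<close>

text \<open>
  The free module with basis \<open>'f\<close> is the function type \<open>'f \<Rightarrow> ('x, 'k) mpoly\<close>; a map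
  \<open>e :: 'f \<Rightarrow> int\<close> assigns degrees to the basis elements, i.e.\ it fixes the grading of
  the direct sum of the shifted modules \<open>S(- e b)\<close>.
\<close>

definition fscale :: "('x, 'k::field) mpoly \<Rightarrow> ('f \<Rightarrow> ('x, 'k) mpoly) \<Rightarrow> ('f \<Rightarrow> ('x, 'k) mpoly)" where
  "fscale p v = (\<lambda>b. p * v b)"

definition free_part :: "('f \<Rightarrow> int) \<Rightarrow> int \<Rightarrow> ('f \<Rightarrow> ('x::finite, 'k::field) mpoly) set" where
  "free_part e d = {v. \<forall>b. homogeneous (d - e b) (v b)}"

definition graded_submodule :: "('f \<Rightarrow> int) \<Rightarrow> ('f \<Rightarrow> ('x::finite, 'k::field) mpoly) set \<Rightarrow> bool" where
  "graded_submodule e M \<longleftrightarrow> module.subspace fscale M \<and>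
     (\<forall>v\<in>M. \<forall>d. (\<lambda>b. hcomp (d - e b) (v b)) \<in> M)"

definition power_mult :: "nat \<Rightarrow> ('f \<Rightarrow> ('x, 'k::field) mpoly) set \<Rightarrow> ('f \<Rightarrow> ('x, 'k) mpoly) set" where
  "power_mult k M = ideal_mult fscale (max_ideal_power k) M"

definition degree_generated ::
    "('f \<Rightarrow> int) \<Rightarrow> int \<Rightarrow> ('f \<Rightarrow> ('x::finite, 'k::field) mpoly) set \<Rightarrow> ('f \<Rightarrow> ('x, 'k) mpoly) set" where
  "degree_generated e d N = module.span fscale (N \<inter> free_part e d)"


section \<open>Graded Tor and Betti numbers\<close>

text \<open>
  A graded free complex \<open>\<dots> \<rightarrow> P\<^sub>1 \<rightarrow> P\<^sub>0 \<rightarrow> S/I\<close> with finitely generated terms, given by bases and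
  matrices: \<open>P\<^sub>i\<close> has basis \<open>{..<rnk P i}\<close>, its \<open>q\<close>-th basis element has degree \<open>shft P i q\<close> and is
  mapped to the \<open>q\<close>-th column of the matrix \<open>dmat P i\<close> (where \<open>dmat P i\<close> describes the map from
  \<open>P\<^bsub>i+1\<^esub>\<close> to \<open>P\<^sub>i\<close>), and the augmentation maps the \<open>q\<close>-th basis element of \<open>P\<^sub>0\<close> to the residue
  class of \<open>aug P q\<close>.
\<close>

record (overloaded) ('x, 'k) free_complex =
  rnk :: "nat \<Rightarrow> nat"
  shft :: "nat \<Rightarrow> nat \<Rightarrow> int"
  dmat :: "nat \<Rightarrow> nat \<Rightarrow> nat \<Rightarrow> ('x, 'k) mpoly"
  aug :: "nat \<Rightarrow> ('x, 'k) mpoly"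

text \<open>
  For a module with scalar multiplication \<open>scale\<close> and a submodule \<open>N\<close>, the tensor product of \<open>P\<^sub>i\<close>
  with \<open>N\<close> is the direct sum of \<open>rnk P i\<close> copies of \<open>N\<close>. The case \<open>scale = (*)\<close>, \<open>N = UNIV\<close> is
  \<open>P\<^sub>i\<close> itself.
\<close>

definition tensor_term ::
    "('x, 'k::field) free_complex \<Rightarrow> nat \<Rightarrow> 'v::ab_group_add set \<Rightarrow> (nat \<Rightarrow> 'v) set" where
  "tensor_term P i N = {w. (\<forall>q<rnk P i. w q \<in> N) \<and> (\<forall>q\<ge>rnk P i. w q = 0)}"

definition tensor_diff ::
    "(('x, 'k) mpoly \<Rightarrow> 'v \<Rightarrow> 'v) \<Rightarrow> ('x, 'k::field) free_complex \<Rightarrow> nat \<Rightarrow>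
      (nat \<Rightarrow> 'v::ab_group_add) \<Rightarrow> (nat \<Rightarrow> 'v)" where
  "tensor_diff scale P i w =
     (\<lambda>p. if p < rnk P i then \<Sum>q<rnk P (Suc i). scale (dmat P i p q) (w q) else 0)"

definition free_resolution ::
    "('x::finite, 'k::field) mpoly set \<Rightarrow> ('x, 'k) free_complex \<Rightarrow> bool" where
  "free_resolution I P \<longleftrightarrow>
     (\<forall>q<rnk P 0. homogeneous (shft P 0 q) (aug P q)) \<and>
     (\<forall>i. \<forall>p<rnk P i. \<forall>q<rnk P (Suc i).
        homogeneous (shft P (Suc i) q - shft P i p) (dmat P i p q)) \<and>
     (\<forall>s. \<exists>v\<in>tensor_term P 0 UNIV. s - (\<Sum>q<rnk P 0. aug P q * v q) \<in> I) \<and>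
     {v \<in> tensor_term P 0 UNIV. (\<Sum>q<rnk P 0. aug P q * v q) \<in> I}
        = tensor_diff (*) P 0 ` tensor_term P 1 UNIV \<and>
     (\<forall>i. {v \<in> tensor_term P (Suc i) UNIV. tensor_diff (*) P i v = 0}
        = tensor_diff (*) P (Suc i) ` tensor_term P (Suc (Suc i)) UNIV)"

definition tensor_part ::
    "('f \<Rightarrow> int) \<Rightarrow> ('x::finite, 'k::field) free_complex \<Rightarrow> nat \<Rightarrow> int \<Rightarrow>
      ('f \<Rightarrow> ('x, 'k) mpoly) set \<Rightarrow> (nat \<Rightarrow> 'f \<Rightarrow> ('x, 'k) mpoly) set" where
  "tensor_part e P i j N =
     {w \<in> tensor_term P i N. \<forall>q<rnk P i. w q \<in> free_part e (j - shft P i q)}"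

definition tensor_cycles ::
    "('f \<Rightarrow> int) \<Rightarrow> ('x::finite, 'k::field) free_complex \<Rightarrow> nat \<Rightarrow> int \<Rightarrow>
      ('f \<Rightarrow> ('x, 'k) mpoly) set \<Rightarrow> (nat \<Rightarrow> 'f \<Rightarrow> ('x, 'k) mpoly) set" where
  "tensor_cycles e P i j N =
     {w \<in> tensor_part e P i j N. case i of 0 \<Rightarrow> True | Suc i' \<Rightarrow> tensor_diff fscale P i' w = 0}"

definition tensor_boundaries ::
    "('f \<Rightarrow> int) \<Rightarrow> ('x::finite, 'k::field) free_complex \<Rightarrow> nat \<Rightarrow> int \<Rightarrow>
      ('f \<Rightarrow> ('x, 'k) mpoly) set \<Rightarrow> (nat \<Rightarrow> 'f \<Rightarrow> ('x, 'k) mpoly) set" where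
  "tensor_boundaries e P i j N = tensor_diff fscale P i ` tensor_part e P (Suc i) j N"

definition kscale ::
    "'k::field \<Rightarrow> (nat \<Rightarrow> 'f \<Rightarrow> ('x, 'k) mpoly) \<Rightarrow> (nat \<Rightarrow> 'f \<Rightarrow> ('x, 'k) mpoly)" where
  "kscale c w = (\<lambda>q b. Poly_Mapping.single 0 c * w q b)"

text \<open>
  \<open>dim\<^sub>K Tor\<^sub>i(S/I, N)\<^sub>j\<close>, where \<open>Tor\<^sub>i(_, N)\<close> is the \<open>i\<close>-th left derived functor of \<open>_ \<otimes> N\<close>: it is
  the homology of \<open>P \<otimes> N\<close> for a chosen graded free resolution \<open>P\<close> of \<open>S/I\<close>. The homogeneous
  parts of \<open>P\<^sub>i \<otimes> N\<close> are finite-dimensional when the basis \<open>'f\<close> is finite, so that the dimension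
  of the quotient of cycles by boundaries is the difference of the dimensions.
\<close>

definition tor_dim ::
    "('x::finite, 'k::field) mpoly set \<Rightarrow> ('f \<Rightarrow> int) \<Rightarrow> nat \<Rightarrow> int \<Rightarrow>
      ('f::finite \<Rightarrow> ('x, 'k) mpoly) set \<Rightarrow> nat" where
  "tor_dim I e i j N =
     (let P = (SOME P. free_resolution I P) in
        vector_space.dim kscale (tensor_cycles e P i j N)
      - vector_space.dim kscale (tensor_boundaries e P i j N))"

definition betti ::
    "('f \<Rightarrow> int) \<Rightarrow> nat \<Rightarrow> int \<Rightarrow> ('f::finite \<Rightarrow> ('x::finite, 'k::field) mpoly) set \<Rightarrow> nat" where
  "betti e i j N = tor_dim max_ideal e i j N"

definition strand_nonzero ::
    "('f \<Rightarrow> int) \<Rightarrow> int \<Rightarrow> ('f::finite \<Rightarrow> ('x::finite, 'k::field) mpoly) set \<Rightarrow> bool" where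
  "strand_nonzero e l N \<longleftrightarrow> (\<exists>i. betti e i (int i + l) N \<noteq> 0)"

definition linear_resolution ::
    "('f \<Rightarrow> int) \<Rightarrow> int \<Rightarrow> ('f::finite \<Rightarrow> ('x::finite, 'k::field) mpoly) set \<Rightarrow> bool" where
  "linear_resolution e d N \<longleftrightarrow> (\<forall>i j. j \<noteq> d \<longrightarrow> betti e i (int i + j) N = 0)"

definition componentwise_linear ::
    "('f \<Rightarrow> int) \<Rightarrow> ('f::finite \<Rightarrow> ('x::finite, 'k::field) mpoly) set \<Rightarrow> bool" where
  "componentwise_linear e N \<longleftrightarrow> (\<forall>d. linear_resolution e d (degree_generated e d N))"

definition cl_index ::
    "('f \<Rightarrow> int) \<Rightarrow> ('f::finite \<Rightarrow> ('x::finite, 'k::field) mpoly) set \<Rightarrow> nat" where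
  "cl_index e M = (LEAST k. componentwise_linear e (power_mult k M))"

definition same_shape_from ::
    "('f \<Rightarrow> int) \<Rightarrow> nat \<Rightarrow> ('f::finite \<Rightarrow> ('x::finite, 'k::field) mpoly) set \<Rightarrow> bool" where
  "same_shape_from e k0 M \<longleftrightarrow>
     (\<forall>k\<ge>k0. \<forall>i l. betti e i (int i + l) (power_mult k M) \<noteq> 0 \<longleftrightarrow>
                   betti e i (int i + l + 1) (power_mult (Suc k) M) \<noteq> 0)"

definition generator_degrees ::
    "('f \<Rightarrow> int) \<Rightarrow> ('f::finite \<Rightarrow> ('x::finite, 'k::field) mpoly) set \<Rightarrow> int set" where
  "generator_degrees e M = {j. betti e 0 j M \<noteq> 0}"


section \<open>Depth and the associated graded module\<close>

text \<open>
  Depth of a quotient module \<open>U/V\<close> with respect to an ideal \<open>I\<close>, as the supremum of the lengths of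
  \<open>U/V\<close>-regular sequences in \<open>I\<close>, with the convention that the zero module has infinite depth.
  \<open>seq_submodule scale fs U V\<close> is the preimage in \<open>U\<close> of the submodule \<open>(fs) (U/V)\<close>.
\<close>

definition seq_submodule ::
    "('r::comm_ring_1 \<Rightarrow> 'v::ab_group_add \<Rightarrow> 'v) \<Rightarrow> 'r list \<Rightarrow> 'v set \<Rightarrow> 'v set \<Rightarrow> 'v set" where
  "seq_submodule scale fs U V =
     module.span scale (V \<union> {scale a u | a u. a \<in> set fs \<and> u \<in> U})"

definition regular_sequence ::
    "('r::comm_ring_1 \<Rightarrow> 'v::ab_group_add \<Rightarrow> 'v) \<Rightarrow> 'v set \<Rightarrow> 'v set \<Rightarrow> 'r list \<Rightarrow> bool" where
  "regular_sequence scale U V fs \<longleftrightarrow>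
     (\<forall>i<length fs. \<forall>u\<in>U. scale (fs ! i) u \<in> seq_submodule scale (take i fs) U V \<longrightarrow>
        u \<in> seq_submodule scale (take i fs) U V) \<and>
     seq_submodule scale fs U V \<noteq> U"

definition quotient_depth ::
    "('r::comm_ring_1 \<Rightarrow> 'v::ab_group_add \<Rightarrow> 'v) \<Rightarrow> 'r set \<Rightarrow> 'v set \<Rightarrow> 'v set \<Rightarrow> enat" where
  "quotient_depth scale I U V =
     (if U = V then \<infinity>
      else Sup {enat (length fs) | fs. set fs \<subseteq> I \<and> regular_sequence scale U V fs})"

text \<open>
  The associated graded module of \<open>M\<close> is the quotient \<open>U/V\<close> of \<open>U = gr_num M\<close>, the direct sum of the
  modules \<open>\<mm>\<^sup>kM\<close>, by \<open>V = gr_den M\<close>, the direct sum of the modules \<open>\<mm>\<^bsup>k+1\<^esup>M\<close>. Elements of the direct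
  sum are finitely supported sequences. A form \<open>a\<close> of degree \<open>i\<close> in \<open>S \<cong> gr\<^sub>\<mm>(S)\<close> acts as its class
  in \<open>\<mm>\<^sup>i/\<mm>\<^bsup>i+1\<^esup>\<close>, that is, it sends the class of \<open>u \<in> \<mm>\<^sup>kM\<close> in the \<open>k\<close>-th summand to the class
  of \<open>a u\<close> in the \<open>(k+i)\<close>-th summand.
\<close>

definition gr_scale ::
    "('x::finite, 'k::field) mpoly \<Rightarrow> (nat \<Rightarrow> 'f \<Rightarrow> ('x, 'k) mpoly) \<Rightarrow> (nat \<Rightarrow> 'f \<Rightarrow> ('x, 'k) mpoly)" where
  "gr_scale a u = (\<lambda>k. \<Sum>i\<le>k. fscale (hcomp (int i) a) (u (k - i)))"

definition gr_num :: "('f \<Rightarrow> ('x, 'k::field) mpoly) set \<Rightarrow> (nat \<Rightarrow> 'f \<Rightarrow> ('x, 'k) mpoly) set" where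
  "gr_num M = {u. finite {k. u k \<noteq> 0} \<and> (\<forall>k. u k \<in> power_mult k M)}"

definition gr_den :: "('f \<Rightarrow> ('x, 'k::field) mpoly) set \<Rightarrow> (nat \<Rightarrow> 'f \<Rightarrow> ('x, 'k) mpoly) set" where
  "gr_den M = {u. finite {k. u k \<noteq> 0} \<and> (\<forall>k. u k \<in> power_mult (Suc k) M)}"

definition gr_depth :: "('f \<Rightarrow> ('x::finite, 'k::field) mpoly) set \<Rightarrow> enat" where
  "gr_depth M = quotient_depth gr_scale max_ideal (gr_num M) (gr_den M)"


section \<open>The scalar multiplications satisfy the module axioms\<close>

lemma module_fscale: "module (fscale :: ('x, 'k::field) mpoly \<Rightarrow> ('f \<Rightarrow> ('x, 'k) mpoly) \<Rightarrow> _)"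
  by unfold_locales (auto simp: fscale_def fun_eq_iff algebra_simps)

lemma vector_space_kscale:
  "vector_space (kscale :: 'k::field \<Rightarrow> (nat \<Rightarrow> 'f \<Rightarrow> ('x, 'k) mpoly) \<Rightarrow> _)"
  by unfold_locales
     (auto simp: kscale_def fun_eq_iff algebra_simps single_add mult_single simp flip: mult.assoc)

lemma lookup_hcomp:
  "Poly_Mapping.lookup (hcomp d p) t = (Poly_Mapping.lookup p t when mdeg t = d)"
proof -
  have "Poly_Mapping.lookup (hcomp d p) t =
      (\<Sum>s\<in>{s \<in> Poly_Mapping.keys p. mdeg s = d}. if s = t then Poly_Mapping.lookup p s else 0)"
    unfolding hcomp_def lookup_sum by (intro sum.cong) (auto simp: lookup_single when_def)
  also have "\<dots> = (Poly_Mapping.lookup p t when mdeg t = d)"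
    by (auto simp: when_def in_keys_iff sum.delta)
  finally show ?thesis .
qed

lemma hcomp_add: "hcomp d (p + q) = hcomp d p + hcomp d q"
  by (rule poly_mapping_eqI) (simp add: lookup_hcomp lookup_add when_def)

lemma hcomp_sum: "hcomp d (sum f A) = (\<Sum>a\<in>A. hcomp d (f a))"
proof (induction A rule: infinite_finite_induct)
  case (insert x F) then show ?case by (simp add: hcomp_add)
qed (simp_all add: hcomp_def)

lemma mdeg_add: "mdeg (s + t) = mdeg s + mdeg t"
  by (simp add: mdeg_def lookup_add sum.distrib)

lemma mdeg_nonneg: "mdeg t \<ge> 0"
  by (simp add: mdeg_def sum_nonneg)

lemma hcomp_single: "hcomp d (Poly_Mapping.single t c) = (Poly_Mapping.single t c when mdeg t = d)"
  by (rule poly_mapping_eqI) (auto simp: lookup_hcomp lookup_single when_def)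

lemma hcomp_mult:
  "hcomp (int n) (p * q) = (\<Sum>i\<le>n. hcomp (int i) p * hcomp (int (n - i)) q)"
proof -
  have p: "p = (\<Sum>s\<in>Poly_Mapping.keys p. Poly_Mapping.single s (Poly_Mapping.lookup p s))" for p :: "('a, 'b) mpoly"
    by (rule poly_mapping_eqI)
       (auto simp: lookup_sum lookup_single when_def in_keys_iff sum.delta)
  have single: "hcomp (int n) (Poly_Mapping.single s a * Poly_Mapping.single t b) =
      (\<Sum>i\<le>n. hcomp (int i) (Poly_Mapping.single s a) * hcomp (int (n - i)) (Poly_Mapping.single t b))"
    for s t :: "'a \<Rightarrow>\<^sub>0 nat" and a b :: 'b
  proof -
    obtain k l where k: "mdeg s = int k" and l: "mdeg t = int l"
      using mdeg_nonneg[of s] mdeg_nonneg[of t] nonneg_int_cases by metis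
    have "(\<Sum>i\<le>n. hcomp (int i) (Poly_Mapping.single s a) * hcomp (int (n - i)) (Poly_Mapping.single t b))
        = (\<Sum>i\<le>n. if i = k then (if l = n - k then Poly_Mapping.single (s + t) (a * b) else 0) else 0)"
      by (intro sum.cong) (auto simp: hcomp_single k l when_def mult_single)
    also have "\<dots> = (if k + l = n then Poly_Mapping.single (s + t) (a * b) else 0)"
      by (auto simp: sum.delta)
    also have "\<dots> = hcomp (int n) (Poly_Mapping.single s a * Poly_Mapping.single t b)"
      by (auto simp: mult_single hcomp_single mdeg_add k l when_def)
    finally show ?thesis by simp
  qed
  define P where "P = (\<lambda>s. Poly_Mapping.single s (Poly_Mapping.lookup p s))"
  define Q where "Q = (\<lambda>s. Poly_Mapping.single s (Poly_Mapping.lookup q s))"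
  have pP: "p = sum P (Poly_Mapping.keys p)" and qQ: "q = sum Q (Poly_Mapping.keys q)"
    unfolding P_def Q_def by (fact p)+
  have "hcomp (int n) (p * q) =
      (\<Sum>s\<in>Poly_Mapping.keys p. \<Sum>t\<in>Poly_Mapping.keys q. hcomp (int n) (P s * Q t))"
    by (subst pP, subst qQ) (simp add: sum_product hcomp_sum)
  also have "\<dots> = (\<Sum>s\<in>Poly_Mapping.keys p. \<Sum>t\<in>Poly_Mapping.keys q. \<Sum>i\<le>n.
      hcomp (int i) (P s) * hcomp (int (n - i)) (Q t))"
    unfolding P_def Q_def by (simp only: single)
  also have "\<dots> = (\<Sum>s\<in>Poly_Mapping.keys p. \<Sum>i\<le>n. \<Sum>t\<in>Poly_Mapping.keys q.
      hcomp (int i) (P s) * hcomp (int (n - i)) (Q t))"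
    by (intro sum.cong refl sum.swap)
  also have "\<dots> = (\<Sum>i\<le>n. \<Sum>s\<in>Poly_Mapping.keys p. \<Sum>t\<in>Poly_Mapping.keys q.
      hcomp (int i) (P s) * hcomp (int (n - i)) (Q t))"
    by (rule sum.swap)
  also have "\<dots> = (\<Sum>i\<le>n. hcomp (int i) (sum P (Poly_Mapping.keys p)) * hcomp (int (n - i)) (sum Q (Poly_Mapping.keys q)))"
    by (simp add: hcomp_sum sum_product)
  finally show ?thesis by (simp flip: pP qQ)
qed

lemma hcomp_one: "hcomp (int i) (1 :: ('x::finite, 'k::field) mpoly) = (if i = 0 then 1 else 0)"
proof -
  have "mdeg (0 :: 'x \<Rightarrow>\<^sub>0 nat) = 0" by (simp add: mdeg_def)
  then show ?thesis
    using hcomp_single[of "int i" "0 :: 'x \<Rightarrow>\<^sub>0 nat" "1 :: 'k"] by (cases "i = 0") (auto simp: when_def)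
qed

lemma fscale_sum_right: "fscale p (sum f A) = (\<Sum>a\<in>A. fscale p (f a))"
  using module.scale_sum_right[OF module_fscale] .

lemma fscale_sum_left: "fscale (sum f A) v = (\<Sum>a\<in>A. fscale (f a) v)"
  using module.scale_sum_left[OF module_fscale] .

lemma module_gr_scale:
  "module (gr_scale :: ('x::finite, 'k::field) mpoly \<Rightarrow> (nat \<Rightarrow> 'f \<Rightarrow> ('x, 'k) mpoly) \<Rightarrow> _)"
proof
  fix a b :: "('x, 'k) mpoly" and u v :: "nat \<Rightarrow> 'f \<Rightarrow> ('x, 'k) mpoly"
  show "gr_scale a (u + v) = gr_scale a u + gr_scale a v"
    by (rule ext) (simp add: gr_scale_def module.scale_right_distrib[OF module_fscale] sum.distrib)
  show "gr_scale (a + b) u = gr_scale a u + gr_scale b u"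
    by (rule ext)
       (simp add: gr_scale_def hcomp_add module.scale_left_distrib[OF module_fscale] sum.distrib)
  show "gr_scale 1 u = u"
  proof
    fix k
    have "gr_scale 1 u k = (\<Sum>i\<le>k. if i = 0 then u k else 0)"
      unfolding gr_scale_def by (intro sum.cong) (auto simp: hcomp_one fscale_def fun_eq_iff)
    then show "gr_scale 1 u k = u k" by (simp add: sum.delta)
  qed
  show "gr_scale a (gr_scale b u) = gr_scale (a * b) u"
  proof
    fix k
    define g where "g = (\<lambda>i j. fscale (hcomp (int i) a * hcomp (int j) b) (u (k - (i + j))))"
    have "gr_scale a (gr_scale b u) k = (\<Sum>i\<le>k. \<Sum>j\<le>k - i. g i j)"
      unfolding gr_scale_def g_def
      by (simp add: fscale_sum_right module.scale_scale[OF module_fscale] diff_diff_eq)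
    also have "\<dots> = (\<Sum>(i, j)\<in>{(i, j). i + j \<le> k}. g i j)"
      unfolding sum.Sigma[OF finite_atMost ballI[OF finite_atMost]]
      by (intro sum.cong) auto
    also have "\<dots> = (\<Sum>n\<le>k. \<Sum>i\<le>n. g i (n - i))"
      by (rule sum.triangle_reindex_eq)
    also have "\<dots> = gr_scale (a * b) u k"
      unfolding gr_scale_def g_def by (intro sum.cong refl) (simp add: hcomp_mult fscale_sum_left)
    finally show "gr_scale a (gr_scale b u) k = gr_scale (a * b) u k" .
  qed
qed

end

theory Submission
  imports Defs
begin

text \<open>
Everything is read off from the Koszul complex. Write \<open>N\<^sub>l\<close> for the piece of degree \<open>l\<close> of a graded
submodule \<open>N\<close> of the free module, and \<open>S\<^sub>1A\<close> for the set \<open>vars_mult A\<close> of sums \<open>\<Sum>\<^sub>x x a\<^sub>x\<close> with all \<open>a\<^sub>x\<close>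
in \<open>A\<close>. Since \<open>Tor\<close> can be computed from any graded free resolution of the residue field, and the
Koszul complex is one, \<open>\<beta>\<^bsub>i,i+l\<^esub>(N) = 0\<close> says that every Koszul cycle in \<open>\<Lambda>\<^sup>i \<otimes> N\<^sub>l\<close> is the boundary of
an element of \<open>\<Lambda>\<^bsup>i+1\<^esup> \<otimes> N\<^bsub>l-1\<^esub>\<close> (\<open>betti_eq_0_iff\<close>). The degree \<open>l\<close> piece of \<open>\<mm>\<^sup>kM\<close> is \<open>S\<^sub>1\<^sup>k M\<^bsub>l-k\<^esub>\<close>, and
\<open>N\<close> is componentwise linear iff, for every \<open>d\<close> and \<open>r\<close>, every cycle with coefficients in
\<open>S\<^sub>1\<^bsup>r+1\<^esup>N\<^sub>d\<close> is the boundary of an element with coefficients in \<open>S\<^sub>1\<^sup>rN\<^sub>d\<close> (\<open>componentwise_linear_iff\<close>). All claims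
thereby become statements about the operator \<open>S\<^sub>1\<close>.

If \<open>N\<close> is componentwise linear, its \<open>l\<close>th strand is non-zero iff \<open>N\<^sub>l\<close> differs from \<open>S\<^sub>1N\<^bsub>l-1\<^esub>\<close>: in the
case of equality, linearity of the module generated by \<open>N\<^bsub>l-1\<^esub>\<close> kills the whole strand.

Part (b) then asserts that \<open>S\<^sub>1N\<^sub>l = S\<^sub>1(S\<^sub>1N\<^bsub>l-1\<^esub>)\<close> forces \<open>N\<^sub>l = S\<^sub>1N\<^bsub>l-1\<^esub>\<close>. For \<open>u\<close> in \<open>N\<^sub>l\<close>, the boundary of
the top form \<open>e\<^sub>1 \<and> \<dots> \<and> e\<^sub>n \<otimes> u\<close> is a cycle with coefficients in \<open>S\<^sub>1\<^sup>2N\<^bsub>l-1\<^esub>\<close>, hence by linearity also the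
boundary of some \<open>e\<^sub>1 \<and> \<dots> \<and> e\<^sub>n \<otimes> a\<close> with \<open>a\<close> in \<open>S\<^sub>1N\<^bsub>l-1\<^esub>\<close>. The last Koszul differential is injective on
a torsion-free module, so \<open>u = a\<close> (\<open>vars_mult_cancel\<close>).

For part (a) let \<open>N = \<mm>N'\<close>, and suppose that \<open>\<beta>\<^bsub>i,i+l\<^esub>(N) = 0\<close> with \<open>i < n\<close>. For \<open>u\<close> in \<open>N'\<^bsub>l-1\<^esub>\<close> and a set
\<open>T\<close> of \<open>i + 1\<close> variables containing \<open>x\<close>, the boundary of \<open>e\<^sub>T \<otimes> u\<close> has coefficients in \<open>N\<^sub>l\<close>, so it is
also the boundary of a form with coefficients in \<open>N\<^bsub>l-1\<^esub>\<close>. Comparing the coefficients at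
\<open>T - {x}\<close> gives \<open>x u \<in> S\<^sub>1N\<^bsub>l-1\<^esub>\<close>. Hence \<open>N\<^sub>l = S\<^sub>1N'\<^bsub>l-1\<^esub> = S\<^sub>1N\<^bsub>l-1\<^esub>\<close>, and the \<open>l\<close>th strand
of the componentwise linear module \<open>N\<close> is zero (\<open>vars_mult_subset_of_exact\<close>).

Part (c) combines (a) and (b) with the vanishing of \<open>\<beta>\<^sub>i\<close> for \<open>i \<ge> n\<close>.

In part (d), the equation \<open>M\<^sub>d = S\<^sub>1M\<^bsub>d-1\<^esub>\<close> is preserved by \<open>S\<^sub>1\<^sup>k\<close>, which gives the first half. Conversely,
let \<open>f \<in> \<mm>\<close> be regular on the associated graded module and \<open>S\<^sub>1\<^sup>kM\<^sub>d = S\<^sub>1\<^bsup>k+1\<^esup>M\<^bsub>d-1\<^esub>\<close>. For \<open>u\<close> in \<open>M\<^sub>d\<close>, the class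
of \<open>u\<close> in \<open>M/\<mm>M\<close> is annihilated by \<open>f\<^sup>k\<close>, because the forms that occur in \<open>f\<^sup>k\<close> have degree at
least \<open>k\<close>; so \<open>u\<close> lies in \<open>\<mm>M\<close> (\<open>no_generators_descend\<close>).

It remains to see that the index \<open>c\<^sub>M\<close> has its defining property, and that componentwise linearity
persists from there on. Persistence is immediate from the criterion above. For existence, the Koszul
cycles of homological degree \<open>i\<close> with coefficients in \<open>N\<close> form a graded submodule of a free module,
which is generated in bounded degree (leading monomials and Dickson's lemma). As each variable
kills the Koszul homology, a cycle of larger degree is a boundary. Applied to the modules generated
by the pieces \<open>M\<^sub>d\<close>, of which only finitely many are essentially different, this gives the required \<open>k\<close>.
\<close>

section \<open>Homogeneous components and partial derivatives\<close>

abbreviation "lookup \<equiv> Poly_Mapping.lookup"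
abbreviation "single \<equiv> Poly_Mapping.single"
abbreviation "keys \<equiv> Poly_Mapping.keys"

lemma homogeneous_0 [simp]: "homogeneous d 0"
  by (simp add: homogeneous_def)

lemma homogeneous_iff: "homogeneous d p \<longleftrightarrow> (\<forall>t. lookup p t \<noteq> 0 \<longrightarrow> mdeg t = d)"
  by (auto simp: homogeneous_def in_keys_iff)

lemma homogeneous_add: "homogeneous d p \<Longrightarrow> homogeneous d q \<Longrightarrow> homogeneous d (p + q)"
  unfolding homogeneous_iff lookup_add by (metis add.left_neutral)

lemma homogeneous_uminus: "homogeneous d p \<Longrightarrow> homogeneous d (- p)"
  by (simp add: homogeneous_iff)

lemma homogeneous_diff: "homogeneous d p \<Longrightarrow> homogeneous d q \<Longrightarrow> homogeneous d (p - q)"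
  using homogeneous_add[of d p "- q"] homogeneous_uminus by fastforce

lemma homogeneous_sum: "(\<And>a. a \<in> A \<Longrightarrow> homogeneous d (f a)) \<Longrightarrow> homogeneous d (sum f A)"
  by (induction A rule: infinite_finite_induct) (auto intro: homogeneous_add)

lemma homogeneous_mult:
  assumes "homogeneous c p" "homogeneous d q" shows "homogeneous (c + d) (p * q)"
  unfolding homogeneous_def
proof
  fix t assume "t \<in> keys (p * q)"
  then obtain r s where "t = r + s" "r \<in> keys p" "s \<in> keys q"
    using keys_mult[of p q] by blast
  then show "mdeg t = c + d" using assms by (auto simp: homogeneous_def mdeg_add)
qed

lemma mdeg_0 [simp]: "mdeg 0 = 0"
  by (simp add: mdeg_def)

lemma mdeg_single: "mdeg (single x n) = int n"
proof -
  have "mdeg (single x n) = (\<Sum>y\<in>UNIV. if y = x then int n else 0)"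
    unfolding mdeg_def by (intro sum.cong) (auto simp: lookup_single when_def)
  then show ?thesis by simp
qed

lemma mdeg_eq_0_iff: "mdeg t = 0 \<longleftrightarrow> t = 0"
  by (auto simp: mdeg_def sum_nonneg_eq_0_iff intro!: poly_mapping_eqI)

lemma homogeneous_single: "mdeg t = d \<Longrightarrow> homogeneous d (single t c)"
  by (auto simp: homogeneous_def split: if_splits)

lemma homogeneous_Var: "homogeneous 1 (Var x)"
  unfolding Var_def by (rule homogeneous_single) (simp add: mdeg_single)

lemma homogeneous_1: "homogeneous 0 1"
  by (auto simp: homogeneous_iff lookup_one when_def split: if_splits)

lemma homogeneous_negative_degree: "homogeneous d p \<Longrightarrow> d < 0 \<Longrightarrow> p = 0"
  by (metis homogeneous_iff lookup_zero mdeg_nonneg not_less poly_mapping_eqI)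

lemma homogeneous_hcomp: "homogeneous d (hcomp d p)"
  by (auto simp: homogeneous_iff lookup_hcomp when_def)

lemma hcomp_homogeneous: "homogeneous d p \<Longrightarrow> hcomp d' p = (if d' = d then p else 0)"
  by (rule poly_mapping_eqI) (auto simp: lookup_hcomp homogeneous_iff when_def)

lemma hcomp_0 [simp]: "hcomp d 0 = 0"
  by (simp add: hcomp_def)

lemma hcomp_negative_degree: "d < 0 \<Longrightarrow> hcomp d p = 0"
  using homogeneous_negative_degree homogeneous_hcomp by blast

lemma hcomp_uminus: "hcomp d (- p) = - hcomp d p"
  by (rule poly_mapping_eqI) (simp add: lookup_hcomp when_def)

lemma hcomp_diff: "hcomp d (p - q) = hcomp d p - hcomp d q"
  by (rule poly_mapping_eqI) (simp add: lookup_hcomp when_def lookup_minus)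

lemma sum_hcomp:
  assumes "finite A" "mdeg ` keys p \<subseteq> A" shows "(\<Sum>d\<in>A. hcomp d p) = p"
proof (rule poly_mapping_eqI)
  fix t
  have "(\<Sum>d\<in>A. lookup (hcomp d p) t)
      = (\<Sum>d\<in>A. if d = mdeg t then lookup p t else 0)"
    by (intro sum.cong) (auto simp: lookup_hcomp when_def)
  also have "\<dots> = lookup p t"
    using assms by (cases "t \<in> keys p") (auto simp: in_keys_iff)
  finally show "lookup (\<Sum>d\<in>A. hcomp d p) t = lookup p t"
    by (simp add: lookup_sum)
qed

lemma hcomp_homogeneous_mult:
  assumes "homogeneous c p" shows "hcomp d (p * q) = p * hcomp (d - c) q"
proof -
  define A where "A = mdeg ` keys q \<union> {d - c}"
  have A: "finite A" "mdeg ` keys q \<subseteq> A" by (auto simp: A_def)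
  have "hcomp d (p * q) = (\<Sum>a\<in>A. hcomp d (p * hcomp a q))"
    by (subst sum_hcomp[OF A, symmetric]) (simp add: sum_distrib_left hcomp_sum)
  also have "\<dots> = (\<Sum>a\<in>A. if a = d - c then p * hcomp a q else 0)"
    by (intro sum.cong refl) (auto simp: hcomp_homogeneous[OF homogeneous_mult[OF assms homogeneous_hcomp]])
  also have "\<dots> = p * hcomp (d - c) q" using A(1) by (simp add: A_def)
  finally show ?thesis .
qed

lemma poly_sum_single: "p = (\<Sum>s\<in>keys p. single s (lookup p s))"
  by (rule poly_mapping_eqI)
     (auto simp: lookup_sum lookup_single when_def in_keys_iff sum.delta)

lemma lookup_single_mult:
  "lookup (single s c * p) (s + t) = c * lookup p (t :: 'x \<Rightarrow>\<^sub>0 nat)"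
proof -
  define A where "A = keys p"
  have p: "p = (\<Sum>r\<in>A. single r (lookup p r))"
    unfolding A_def by (rule poly_sum_single)
  have "single s c * p = (\<Sum>r\<in>A. single (s + r) (c * lookup p r))"
    by (subst p) (simp add: sum_distrib_left mult_single)
  then have "lookup (single s c * p) (s + t)
     = (\<Sum>r\<in>A. if r = t then c * lookup p r else 0)"
    by (simp add: lookup_sum lookup_single when_def)
  also have "\<dots> = c * lookup p t"
    by (auto simp: A_def in_keys_iff)
  finally show ?thesis .
qed

lemma Var_mult_lookup:
  "lookup (Var x * p) (single x 1 + t) = lookup p t"
  by (simp add: Var_def lookup_single_mult)

lemma Var_mult_lookup_0:
  assumes "lookup t x = 0" shows "lookup (Var x * p) t = 0"
proof (rule ccontr)
  assume "lookup (Var x * p) t \<noteq> 0"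
  then have "t \<in> keys (Var x * p)" by (simp add: in_keys_iff)
  then obtain r s where "t = r + s" "r \<in> keys (Var x :: ('a,'b) mpoly)"
    using keys_mult[of "Var x" p] by blast
  then show False using assms by (auto simp: Var_def lookup_add lookup_single split: if_splits)
qed

lemma Var_mult_cancel: "Var x * p = 0 \<Longrightarrow> p = 0"
  by (rule poly_mapping_eqI) (metis Var_mult_lookup lookup_zero)

lemma single_split: "lookup t x \<noteq> 0 \<Longrightarrow>
    \<exists>s. t = single x (1::nat) + s"
  by (rule exI[of _ "t - single x 1"], rule poly_mapping_eqI)
     (auto simp: lookup_add lookup_minus lookup_single when_def)

lemma monomial_split:
  assumes "t \<noteq> 0" obtains x s where "t = single x (1::nat) + s"
proof -
  from assms obtain x where "lookup t x \<noteq> 0" by (metis lookup_zero poly_mapping_eqI)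
  from single_split[OF this] show ?thesis using that by blast
qed

text \<open>
Each monomial \<open>t\<close> without \<open>x\<close> gets the coefficient \<open>0\<close>, so the truncated subtraction of exponents
does no harm.
\<close>

definition pderiv :: "'x \<Rightarrow> ('x, 'k::field_char_0) mpoly \<Rightarrow> ('x, 'k) mpoly" where
  "pderiv x p = (\<Sum>t\<in>keys p. single (t - single x 1)
     (of_nat (lookup t x) * lookup p t))"

lemma lookup_pderiv: "lookup (pderiv x p) t =
  of_nat (lookup t x + 1) * lookup p (single x 1 + t)"
proof -
  let ?s = "single x (1::nat) + t"
  have "lookup (pderiv x p) t = (\<Sum>s\<in>keys p.
     if s = ?s then of_nat (lookup ?s x) * lookup p ?s else 0)"
    unfolding pderiv_def lookup_sum
  proof (intro sum.cong refl)
    fix s assume "s \<in> keys p"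
    show "lookup (single (s - single x 1)
          (of_nat (lookup s x) * lookup p s)) t =
         (if s = ?s then of_nat (lookup ?s x) * lookup p ?s else 0)"
    proof (cases "lookup s x = 0")
      case True
      then have "s \<noteq> ?s" by (metis add_eq_0_iff_both_eq_0 lookup_add lookup_single_eq one_neq_zero)
      with True show ?thesis by simp
    next
      case False
      then obtain r where "s = single x 1 + r" using single_split[OF False] by blast
      then show ?thesis by (simp add: lookup_single when_def)
    qed
  qed
  also have "\<dots> = of_nat (lookup t x + 1) * lookup p ?s"
    by (auto simp: sum.delta in_keys_iff lookup_add)
  finally show ?thesis .
qed

lemma pderiv_add: "pderiv x (p + q) = pderiv x p + pderiv x q"
  by (rule poly_mapping_eqI) (simp add: lookup_pderiv lookup_add algebra_simps)

lemma pderiv_uminus: "pderiv x (- p) = - pderiv x p"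
  by (rule poly_mapping_eqI) (simp add: lookup_pderiv)

lemma pderiv_0 [simp]: "pderiv x 0 = 0"
  by (rule poly_mapping_eqI) (simp add: lookup_pderiv)

lemma pderiv_sum: "pderiv x (sum f A) = (\<Sum>a\<in>A. pderiv x (f a))"
  by (induction A rule: infinite_finite_induct) (auto simp: pderiv_add)

lemma pderiv_Var_mult:
  "pderiv x (Var y * p) = Var y * pderiv x p + (if x = y then p else 0)"
proof (rule poly_mapping_eqI)
  fix t
  show "lookup (pderiv x (Var y * p)) t =
      lookup (Var y * pderiv x p + (if x = y then p else 0)) t"
  proof (cases "lookup t y = 0")
    case True
    have "x \<noteq> y \<Longrightarrow> lookup (single x 1 + t) y = 0"
      using True by (simp add: lookup_add lookup_single)
    then show ?thesis using True
      by (auto simp: lookup_pderiv lookup_add Var_mult_lookup[simplified] Var_mult_lookup_0)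
  next
    case False
    then obtain s where s: "t = single y 1 + s" using single_split[OF False] by blast
    have e: "single x 1 + (single y 1 + s) =
        single y 1 + (single x 1 + s)" by (simp add: ac_simps)
    show ?thesis unfolding s lookup_pderiv e Var_mult_lookup lookup_add
      by (auto simp: lookup_single when_def algebra_simps lookup_pderiv)
  qed
qed

lemma euler_identity:
  fixes p :: "('x::finite, 'k::field_char_0) mpoly"
  assumes "homogeneous d p"
  shows "(\<Sum>x\<in>UNIV. Var x * pderiv x p) = single 0 (of_int d) * p"
proof (rule poly_mapping_eqI)
  fix t
  have 1: "lookup (Var x * pderiv x p) t = of_nat (lookup t x) * lookup p t" for x
  proof (cases "lookup t x = 0")
    case True then show ?thesis by (simp add: Var_mult_lookup_0)
  next
    case False
    then obtain s where s: "t = single x 1 + s" using single_split[OF False] by blast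
    show ?thesis unfolding s Var_mult_lookup by (simp add: lookup_pderiv lookup_add)
  qed
  have "lookup (\<Sum>x\<in>UNIV. Var x * pderiv x p) t = of_int (mdeg t) * lookup p t"
    by (simp add: lookup_sum 1 mdeg_def flip: sum_distrib_right)
  also have "\<dots> = of_int d * lookup p t"
    using assms by (auto simp: homogeneous_iff)
  also have "\<dots> = lookup (single 0 (of_int d) * p) t"
    by (subst mult_map_scale_conv_mult[symmetric]) (simp add: Poly_Mapping.map.rep_eq when_def)
  finally show "lookup (\<Sum>x\<in>UNIV. Var x * pderiv x p) t =
     lookup (single 0 (of_int d) * p) t" .
qed

section \<open>The Koszul differential and its contracting homotopy\<close>

text \<open>
The variables are ordered by \<open>to_nat\<close>, and \<open>ksign T x\<close> is the sign that arises when \<open>x\<close> is moved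
past the smaller elements of \<open>T\<close>. A function \<open>W\<close> on sets of variables stands for the alternating form
\<open>\<Sum>\<^sub>T W T e\<^sub>T\<close> with polynomial coefficients.
\<close>

definition ksign :: "'x::finite set \<Rightarrow> 'x \<Rightarrow> ('x, 'k::field_char_0) mpoly" where
  "ksign T x = (-1) ^ card {y \<in> T. to_nat y < to_nat x}"

text \<open>
The interior product with \<open>x\<close> here, and the exterior product \<open>e\<^sub>x \<and> _\<close> in \<open>wedge\<close>.
\<close>

definition contract :: "'x::finite \<Rightarrow> ('x set \<Rightarrow> ('x, 'k::field_char_0) mpoly) \<Rightarrow> 'x set \<Rightarrow> ('x, 'k) mpoly" where
  "contract x W T = (if x \<in> T then 0 else ksign T x * W (insert x T))"

definition wedge :: "'x::finite \<Rightarrow> ('x set \<Rightarrow> ('x, 'k::field_char_0) mpoly) \<Rightarrow> 'x set \<Rightarrow> ('x, 'k) mpoly" where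
  "wedge x W T = (if x \<in> T then ksign T x * W (T - {x}) else 0)"

lemma ksign_cases:
  fixes T :: "'x::finite set"
  shows "(ksign T x :: ('x, 'k::field_char_0) mpoly) = 1 \<or> (ksign T x :: ('x, 'k) mpoly) = - 1"
  unfolding ksign_def by (metis minus_one_power_iff)

lemma ksign_ksign_mult:
  fixes p :: "('x::finite, 'k::field_char_0) mpoly"
  shows "ksign T x * (ksign T x * p) = p"
  using ksign_cases[of T x, where ?'k = 'k] by auto

lemma ksign_insert:
  "x \<noteq> y \<Longrightarrow> y \<notin> T \<Longrightarrow> ksign (insert y T) x = (if to_nat y < to_nat x then - ksign T x else ksign T x)"
proof -
  assume "x \<noteq> y" "y \<notin> T"
  have "{z \<in> insert y T. to_nat z < to_nat x} =
     (if to_nat y < to_nat x then insert y {z \<in> T. to_nat z < to_nat x} else {z \<in> T. to_nat z < to_nat x})"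
    by auto
  then show ?thesis using \<open>y \<notin> T\<close> by (simp add: ksign_def)
qed

lemma ksign_insert_same: "ksign (insert x T) x = ksign T x"
proof -
  have "{z \<in> insert x T. to_nat z < to_nat x} = {z \<in> T. to_nat z < to_nat x}" by auto
  then show ?thesis by (simp add: ksign_def)
qed

lemma ksign_remove_same: "ksign (T - {x}) x = ksign T x"
  by (metis ksign_insert_same insert_Diff_single)

lemma ksign_remove:
  fixes T :: "'x::finite set"
  assumes "x \<noteq> y" "y \<in> T"
  shows "(ksign (T - {y}) x :: ('x, 'k::field_char_0) mpoly)
    = (if to_nat y < to_nat x then - ksign T x else ksign T x)"
  using ksign_insert[of x y "T - {y}", where ?'b = 'k] assms by (auto simp: insert_absorb)

lemma to_nat_linear: "x \<noteq> y \<Longrightarrow> to_nat x < to_nat y \<longleftrightarrow> \<not> to_nat y < to_nat (x::'x::countable)"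
  by (metis inj_to_nat injD linorder_neqE_nat not_less_iff_gr_or_eq)

lemma contract_contract: "contract x (contract y W) T + contract y (contract x W) T = 0"
proof (cases "x = y")
  case False
  then show ?thesis
    using to_nat_linear[OF False]
    by (auto simp: contract_def ksign_insert insert_commute)
qed (simp add: contract_def)

text \<open>
Together with \<open>contract_contract\<close> these are the canonical anticommutation relations. All identities
for the Koszul differential below are formal consequences of them.
\<close>

lemma contract_wedge:
  "contract x (wedge y W) T + wedge y (contract x W) T = (if x = y then W T else 0)"
proof (cases "x = y")
  case True
  then show ?thesis
    by (auto simp: contract_def wedge_def ksign_insert_same ksign_remove_same ksign_ksign_mult insert_absorb)
next
  case False
  then have e: "insert x T - {y} = insert x (T - {y})" by auto
  show ?thesis
    using False to_nat_linear[OF False]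
    by (auto simp: contract_def wedge_def ksign_insert ksign_remove e)
qed

lemma contract_add: "contract x (\<lambda>T. V T + W T) T = contract x V T + contract x W T"
  by (simp add: contract_def algebra_simps)
lemma contract_sum: "contract x (\<lambda>T. \<Sum>a\<in>A. W a T) T = (\<Sum>a\<in>A. contract x (W a) T)"
  by (simp add: contract_def sum_distrib_left)
lemma contract_mult: "contract x (\<lambda>T. p * W T) T = p * contract x W T"
  by (simp add: contract_def)
lemma contract_0: "contract x (\<lambda>T. 0) T = 0"
  by (simp add: contract_def)
lemma wedge_sum: "wedge x (\<lambda>T. \<Sum>a\<in>A. W a T) T = (\<Sum>a\<in>A. wedge x (W a) T)"
  by (simp add: wedge_def sum_distrib_left)
lemma wedge_add: "wedge x (\<lambda>T. V T + W T) T = wedge x V T + wedge x W T"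
  by (simp add: wedge_def algebra_simps)
lemma wedge_mult: "wedge x (\<lambda>T. p * W T) T = p * wedge x W T"
  by (simp add: wedge_def)
lemma pderiv_contract:
  fixes W :: "'x::finite set \<Rightarrow> ('x, 'k::field_char_0) mpoly"
  shows "pderiv y (contract x W T) = contract x (\<lambda>T. pderiv y (W T)) T"
  using ksign_cases[of T x, where ?'k = 'k] by (auto simp: contract_def pderiv_uminus)
definition koszul :: "('x::finite set \<Rightarrow> ('x, 'k::field_char_0) mpoly) \<Rightarrow> 'x set \<Rightarrow> ('x, 'k) mpoly" where
  "koszul W T = (\<Sum>x\<in>UNIV. Var x * contract x W T)"

text \<open>
The exterior derivative \<open>\<Sum>\<^sub>x e\<^sub>x \<and> \<partial>\<^sub>x\<close> of a polynomial differential form.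
\<close>

definition euler_homotopy :: "('x::finite set \<Rightarrow> ('x, 'k::field_char_0) mpoly) \<Rightarrow> 'x set \<Rightarrow> ('x, 'k) mpoly" where
  "euler_homotopy W T = (\<Sum>x\<in>UNIV. wedge x (\<lambda>U. pderiv x (W U)) T)"

lemma koszul_sum: "koszul (\<lambda>T. \<Sum>a\<in>A. W a T) T = (\<Sum>a\<in>A. koszul (W a) T)"
  unfolding koszul_def contract_sum sum_distrib_left by (rule sum.swap)
lemma koszul_add: "koszul (\<lambda>T. V T + W T) T = koszul V T + koszul W T"
  unfolding koszul_def contract_add by (simp add: algebra_simps sum.distrib)
lemma koszul_mult: "koszul (\<lambda>T. p * W T) T = p * koszul W T"
  unfolding koszul_def contract_mult by (simp add: algebra_simps sum_distrib_left)
lemma koszul_0: "koszul (\<lambda>T. 0) T = 0"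
  by (simp add: koszul_def contract_0)

lemma self_neg_0: "(a::('x, 'k::field_char_0) mpoly) + a = 0 \<Longrightarrow> a = 0"
proof (rule poly_mapping_eqI)
  fix t assume "a + a = 0"
  then have "lookup (a + a) t = 0" by simp
  then have "2 * lookup a t = 0" by (simp only: lookup_add mult_2)
  then show "lookup a t = lookup 0 t" by simp
qed

text \<open>
The composite is a sum over pairs of variables in which exchanging the pair changes the sign, so it
equals its own negative.
\<close>

lemma koszul_koszul: "koszul (koszul W) T = 0"
proof (rule self_neg_0)
  have 1: "koszul (koszul W) T = (\<Sum>x\<in>UNIV. \<Sum>y\<in>UNIV. Var x * Var y * contract x (contract y W) T)"
    unfolding koszul_def[abs_def] contract_sum contract_mult by (simp add: sum_distrib_left mult.assoc)
  also have "\<dots> = (\<Sum>y\<in>UNIV. \<Sum>x\<in>UNIV. Var x * Var y * contract x (contract y W) T)"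
    by (rule sum.swap)
  finally have 2: "koszul (koszul W) T = (\<Sum>x\<in>UNIV. \<Sum>y\<in>UNIV. Var x * Var y * contract y (contract x W) T)"
    by (simp add: ac_simps)
  have "koszul (koszul W) T + koszul (koszul W) T =
     (\<Sum>x\<in>UNIV. \<Sum>y\<in>UNIV. Var x * Var y * (contract x (contract y W) T + contract y (contract x W) T))"
    unfolding distrib_left sum.distrib using 1 2 by simp
  then show "koszul (koszul W) T + koszul (koszul W) T = 0" by (simp add: contract_contract)
qed

text \<open>
Multiplication by a variable is null-homotopic; hence the variables annihilate Koszul homology.
\<close>

lemma koszul_wedge: "koszul (wedge y W) T + wedge y (koszul W) T = Var y * W T"
proof -
  have "koszul (wedge y W) T + wedge y (koszul W) T =
      (\<Sum>x\<in>UNIV. Var x * (contract x (wedge y W) T + wedge y (contract x W) T))"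
    unfolding koszul_def[abs_def] wedge_sum wedge_mult by (simp add: sum.distrib algebra_simps)
  also have "\<dots> = (\<Sum>x\<in>UNIV. if x = y then Var x * W T else 0)"
    by (simp add: contract_wedge if_distrib cong: if_cong)
  finally show ?thesis by simp
qed

lemma wedge_contract_same: "wedge x (contract x W) T = (if x \<in> T then W T else 0)"
  by (auto simp: contract_def wedge_def ksign_insert_same ksign_remove_same ksign_ksign_mult insert_absorb)

text \<open>
Cartan's formula for the Euler vector field: on forms of exterior degree \<open>i\<close> whose coefficients are
homogeneous of degree \<open>d\<close>, the right-hand side is multiplication by \<open>d + i\<close>.
\<close>

lemma koszul_euler:
  "koszul (euler_homotopy W) T + euler_homotopy (koszul W) T
    = (\<Sum>x\<in>UNIV. Var x * pderiv x (W T)) + of_nat (card T) * W T"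
proof -
  let ?D = "\<lambda>x T. pderiv x (W T)"
  have "koszul (euler_homotopy W) T = (\<Sum>y\<in>UNIV. \<Sum>x\<in>UNIV. Var y * contract y (wedge x (?D x)) T)"
    unfolding koszul_def euler_homotopy_def[abs_def] contract_sum by (simp add: sum_distrib_left)
  moreover have "euler_homotopy (koszul W) T =
     (\<Sum>x\<in>UNIV. \<Sum>y\<in>UNIV. Var y * wedge x (contract y (?D x)) T + (if x = y then wedge x (contract y W) T else 0))"
    unfolding koszul_def[abs_def] euler_homotopy_def pderiv_sum pderiv_Var_mult wedge_sum wedge_add wedge_mult pderiv_contract
    by (intro sum.cong refl) (auto simp: wedge_def)
  moreover have "\<dots> = (\<Sum>y\<in>UNIV. \<Sum>x\<in>UNIV. Var y * wedge x (contract y (?D x)) T + (if x = y then wedge x (contract y W) T else 0))"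
    by (rule sum.swap)
  ultimately have "koszul (euler_homotopy W) T + euler_homotopy (koszul W) T =
     (\<Sum>y\<in>UNIV. \<Sum>x\<in>UNIV. Var y * (contract y (wedge x (?D x)) T + wedge x (contract y (?D x)) T)
       + (if x = y then wedge x (contract y W) T else 0))"
    by (simp add: algebra_simps flip: sum.distrib)
  also have "\<dots> = (\<Sum>y\<in>UNIV. \<Sum>x\<in>UNIV. if x = y then Var y * ?D y T + (if y \<in> T then W T else 0) else 0)"
    by (intro sum.cong refl) (auto simp: contract_wedge wedge_contract_same)
  also have "\<dots> = (\<Sum>y\<in>UNIV. Var y * ?D y T) + of_nat (card T) * W T"
    by (simp add: sum.distrib sum.If_cases)
  finally show ?thesis .
qed

text \<open>
A form of exterior degree \<open>i\<close>, given by all its coefficients.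
\<close>

definition alt_degree :: "nat \<Rightarrow> ('x set \<Rightarrow> 'v::zero) \<Rightarrow> bool" where
  "alt_degree i W \<longleftrightarrow> (\<forall>T. card T \<noteq> i \<longrightarrow> W T = 0)"

lemma alt_degree_wedge:
  fixes W :: "'x::finite set \<Rightarrow> ('x, 'k::field_char_0) mpoly"
  assumes "alt_degree i W" shows "alt_degree (Suc i) (wedge x W)"
  unfolding alt_degree_def
proof (intro allI impI)
  fix T :: "'x set" assume T: "card T \<noteq> Suc i"
  have "card (T - {x}) \<noteq> i" if "x \<in> T" using card.remove[OF finite that] T by simp
  then show "wedge x W T = 0" using assms by (simp add: wedge_def alt_degree_def)
qed

lemma alt_degree_contract: "alt_degree (Suc i) W \<Longrightarrow> alt_degree i (contract x W)"
  by (auto simp: alt_degree_def contract_def)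

lemma alt_degree_koszul: "alt_degree (Suc i) W \<Longrightarrow> alt_degree i (koszul W)"
  using alt_degree_contract[of i W] by (simp add: koszul_def alt_degree_def)

lemma koszul_alt_degree_0: "alt_degree 0 W \<Longrightarrow> koszul W T = 0"
  by (auto simp: alt_degree_def koszul_def contract_def intro!: sum.neutral)

text \<open>
By Cartan's formula a cycle \<open>W\<close> is the boundary of its exterior derivative divided by \<open>d + i\<close>, which
is invertible in characteristic zero.
\<close>

lemma koszul_exact_homogeneous:
  fixes W :: "'x::finite set \<Rightarrow> ('x, 'k::field_char_0) mpoly"
  assumes alt: "alt_degree i W" and cyc: "\<And>T. koszul W T = 0" and hom: "\<And>T. homogeneous d (W T)"
    and pos: "d + int i > 0"
  shows "\<exists>V. alt_degree (Suc i) V \<and> (\<forall>T. koszul V T = W T)"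
proof -
  define c :: 'k where "c = of_int (d + int i)"
  have c: "c \<noteq> 0" using pos unfolding c_def by (metis of_int_eq_0_iff less_irrefl)
  define V where "V T = single 0 (inverse c) * euler_homotopy W T" for T
  have "alt_degree (Suc i) (wedge x (\<lambda>U. pderiv x (W U)))" for x
    using alt by (intro alt_degree_wedge) (auto simp: alt_degree_def)
  then have "alt_degree (Suc i) V"
    by (simp add: alt_degree_def V_def euler_homotopy_def)
  moreover have "koszul V T = W T" for T
  proof -
    have cyc': "koszul W = (\<lambda>_. 0)" using cyc by auto
    have "koszul (euler_homotopy W) T = (\<Sum>x\<in>UNIV. Var x * pderiv x (W T)) + of_nat (card T) * W T"
      using koszul_euler[of W T] unfolding cyc' by (simp add: euler_homotopy_def wedge_def if_distrib cong: if_cong)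
    also have "\<dots> = single 0 c * W T"
    proof (cases "card T = i")
      case True
      then show ?thesis unfolding euler_identity[OF hom] c_def
        by (simp add: single_add algebra_simps)
    next
      case False
      then show ?thesis using alt by (auto simp: alt_degree_def)
    qed
    finally show ?thesis unfolding V_def koszul_mult
      using c by (simp add: mult.assoc[symmetric] mult_single)
  qed
  ultimately show ?thesis by blast
qed

lemma hcomp_ksign:
  fixes p :: "('x::finite, 'k::field_char_0) mpoly"
  shows "hcomp d (ksign T x * p) = ksign T x * hcomp d p"
  using ksign_cases[of T x, where ?'k = 'k] by (auto simp: hcomp_uminus)

lemma hcomp_koszul: "hcomp d (koszul W T) = koszul (\<lambda>U. hcomp (d - 1) (W U)) T"
proof -
  have "hcomp d (Var x * contract x W T) = Var x * contract x (\<lambda>U. hcomp (d - 1) (W U)) T" for x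
    by (simp add: hcomp_homogeneous_mult[OF homogeneous_Var]) (simp add: contract_def hcomp_ksign)
  then show ?thesis by (simp add: koszul_def hcomp_sum)
qed

text \<open>
Exactness of the Koszul complex of the polynomial ring in positive total degree, obtained from the
homogeneous case by splitting the coefficients into their homogeneous components.
\<close>

lemma koszul_exact:
  fixes W :: "'x::finite set \<Rightarrow> ('x, 'k::field_char_0) mpoly"
  assumes alt: "alt_degree i W" and cyc: "\<And>T. koszul W T = 0"
    and pos: "i > 0 \<or> lookup (W {}) 0 = 0"
  shows "\<exists>V. alt_degree (Suc i) V \<and> (\<forall>T. koszul V T = W T)"
proof -
  define A where "A = (\<Union>T. mdeg ` keys (W T))"
  have A: "finite A" unfolding A_def by (intro finite_UN_I finite finite_imageI finite_keys)
  have A': "mdeg ` keys (W T) \<subseteq> A" for T unfolding A_def by blast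
  have "\<exists>V. alt_degree (Suc i) V \<and> (\<forall>T. koszul V T = hcomp d (W T))" if "d \<in> A" for d
  proof (rule koszul_exact_homogeneous)
    show "alt_degree i (\<lambda>T. hcomp d (W T))" using alt by (auto simp: alt_degree_def)
    show "koszul (\<lambda>T. hcomp d (W T)) T = 0" for T
      using hcomp_koszul[of "d + 1" W T] cyc by simp
    obtain T where T: "d \<in> mdeg ` keys (W T)" using \<open>d \<in> A\<close> unfolding A_def by blast
    obtain t where t: "t \<in> keys (W T)" "d = mdeg t" using T by blast
    show "d + int i > 0"
    proof (cases "i > 0")
      case True
      then show ?thesis using t(2) mdeg_nonneg[of t] by linarith
    next
      case False
      with pos have i: "i = 0" and 0: "lookup (W {}) 0 = 0" by auto
      have "T = {}"
      proof (rule ccontr)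
        assume "T \<noteq> {}"
        then have "W T = 0" using alt i unfolding alt_degree_def by simp
        then show False using t(1) by simp
      qed
      then have "t \<noteq> 0" using t(1) 0 by (auto simp: in_keys_iff)
      then show ?thesis using t i mdeg_nonneg[of t] mdeg_eq_0_iff[of t] by linarith
    qed
  qed (rule homogeneous_hcomp)
  then obtain V where V: "\<And>d. d \<in> A \<Longrightarrow> alt_degree (Suc i) (V d)" "\<And>d T. d \<in> A \<Longrightarrow> koszul (V d) T = hcomp d (W T)"
    by metis
  have "alt_degree (Suc i) (\<lambda>T. \<Sum>d\<in>A. V d T)" using V(1) by (auto simp: alt_degree_def)
  moreover have "koszul (\<lambda>T. \<Sum>d\<in>A. V d T) T = W T" for T
    unfolding koszul_sum using V(2) sum_hcomp[OF A A'] by simp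
  ultimately show ?thesis by blast
qed

section \<open>Comparison of graded free resolutions\<close>

lemma module_mult: "module ((*) :: 'a::comm_ring_1 \<Rightarrow> 'a \<Rightarrow> 'a)"
  by unfold_locales (auto simp: algebra_simps)

text \<open>
The linear map of free modules that sends the \<open>q\<close>-th basis vector, \<open>q < t\<close>, to \<open>a q\<close>. Chain maps and
homotopies are given by such families of images of basis vectors, because these also act on
tuples with entries in a module.
\<close>

definition lincomb :: "nat \<Rightarrow> (nat \<Rightarrow> nat \<Rightarrow> 'a::comm_ring_1) \<Rightarrow> (nat \<Rightarrow> 'a) \<Rightarrow> nat \<Rightarrow> 'a" where
  "lincomb t a v = (\<lambda>p. \<Sum>q<t. a q p * v q)"

definition diff_column :: "('x, 'k::field) free_complex \<Rightarrow> nat \<Rightarrow> nat \<Rightarrow> nat \<Rightarrow> ('x, 'k) mpoly" where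
  "diff_column P i q = (\<lambda>p. if p < rnk P i then dmat P i p q else 0)"

lemma tensor_diff_lincomb: "tensor_diff (*) P i v = lincomb (rnk P (Suc i)) (diff_column P i) v"
  by (auto simp: tensor_diff_def lincomb_def diff_column_def)

lemma lincomb_lincomb: "lincomb s a (lincomb t b v) = lincomb t (\<lambda>q. lincomb s a (b q)) v"
proof
  fix p
  have "lincomb s a (lincomb t b v) p = (\<Sum>r<s. \<Sum>q<t. a r p * b q r * v q)"
    by (simp add: lincomb_def sum_distrib_left mult.assoc)
  also have "\<dots> = (\<Sum>q<t. \<Sum>r<s. a r p * b q r * v q)" by (rule sum.swap)
  finally show "lincomb s a (lincomb t b v) p = lincomb t (\<lambda>q. lincomb s a (b q)) v p"
    by (simp add: lincomb_def sum_distrib_right)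
qed

lemma lincomb_cong: "(\<And>q. q < t \<Longrightarrow> a q = b q) \<Longrightarrow> lincomb t a v = lincomb t b v"
  by (simp add: lincomb_def)

lemma lincomb_0: "lincomb t a 0 = 0" "lincomb t a (\<lambda>_. 0) = 0"
  by (auto simp: lincomb_def)

lemma lincomb_diff: "lincomb t a (u - v) = lincomb t a u - lincomb t a v"
  by (auto simp: lincomb_def algebra_simps sum_subtractf)

lemma lincomb_diff_left: "lincomb t (\<lambda>q. a q - b q) v = lincomb t a v - lincomb t b v"
  by (auto simp: lincomb_def algebra_simps sum_subtractf)

lemma if_1_0_mult: "(if b then 1 else 0) * a = (if b then a else (0::'a::comm_ring_1))"
  "a * (if b then 1 else 0) = (if b then a else 0)"
  by simp_all

lemma lincomb_unit: "v \<in> tensor_term P i UNIV \<Longrightarrow> lincomb (rnk P i) (\<lambda>q p. if p = q then 1 else 0) v = v"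
  by (auto simp: lincomb_def tensor_term_def fun_eq_iff if_1_0_mult)

definition aug_map :: "('x, 'k::field) free_complex \<Rightarrow> (nat \<Rightarrow> ('x, 'k) mpoly) \<Rightarrow> ('x, 'k) mpoly" where
  "aug_map P v = (\<Sum>q<rnk P 0. aug P q * v q)"

text \<open>
In position \<open>0\<close> the cycles are the kernel of the augmentation to \<open>S/I\<close>, so that exactness of a
resolution has the same form in all positions.
\<close>

definition is_cycle :: "('x, 'k::field) mpoly set \<Rightarrow> ('x, 'k) free_complex \<Rightarrow> nat \<Rightarrow> (nat \<Rightarrow> ('x, 'k) mpoly) \<Rightarrow> bool" where
  "is_cycle I P i v \<longleftrightarrow> (case i of 0 \<Rightarrow> aug_map P v \<in> I | Suc j \<Rightarrow> tensor_diff (*) P j v = 0)"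

lemma aug_map_lincomb: "aug_map P (lincomb t a v) = (\<Sum>q<t. v q * aug_map P (a q))"
proof -
  have "aug_map P (lincomb t a v) = (\<Sum>r<rnk P 0. \<Sum>q<t. aug P r * a q r * v q)"
    by (simp add: aug_map_def lincomb_def sum_distrib_left mult.assoc)
  also have "\<dots> = (\<Sum>q<t. \<Sum>r<rnk P 0. aug P r * a q r * v q)" by (rule sum.swap)
  finally show ?thesis by (simp add: aug_map_def sum_distrib_left algebra_simps)
qed

definition homogeneous_vec :: "('x::finite, 'k::field) free_complex \<Rightarrow> nat \<Rightarrow> int \<Rightarrow> (nat \<Rightarrow> ('x, 'k) mpoly) \<Rightarrow> bool" where
  "homogeneous_vec P i s v \<longleftrightarrow> v \<in> tensor_term P i UNIV \<and> (\<forall>p<rnk P i. homogeneous (s - shft P i p) (v p))"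

definition graded_ideal :: "('x::finite, 'k::field) mpoly set \<Rightarrow> bool" where
  "graded_ideal I \<longleftrightarrow> module.subspace (*) I \<and> (\<forall>p\<in>I. \<forall>d. hcomp d p \<in> I)"

lemma graded_idealD:
  assumes "graded_ideal I"
  shows "0 \<in> I" "p \<in> I \<Longrightarrow> q \<in> I \<Longrightarrow> p + q \<in> I" "p \<in> I \<Longrightarrow> q \<in> I \<Longrightarrow> p - q \<in> I" "p \<in> I \<Longrightarrow> a * p \<in> I"
    "(\<And>i. i \<in> A \<Longrightarrow> f i \<in> I) \<Longrightarrow> sum f A \<in> I" "p \<in> I \<Longrightarrow> hcomp d p \<in> I"
proof -
  have s: "module.subspace (*) I" using assms by (simp add: graded_ideal_def)
  note m = module.subspace_0[OF module_mult s] module.subspace_add[OF module_mult s]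
    module.subspace_diff[OF module_mult s] module.subspace_scale[OF module_mult s] module.subspace_sum[OF module_mult s]
  show "0 \<in> I" "p \<in> I \<Longrightarrow> q \<in> I \<Longrightarrow> p + q \<in> I" "p \<in> I \<Longrightarrow> q \<in> I \<Longrightarrow> p - q \<in> I" "p \<in> I \<Longrightarrow> a * p \<in> I"
    "(\<And>i. i \<in> A \<Longrightarrow> f i \<in> I) \<Longrightarrow> sum f A \<in> I" by (auto intro: m)
  show "p \<in> I \<Longrightarrow> hcomp d p \<in> I" using assms by (simp add: graded_ideal_def)
qed

lemma homogeneous_vec_lincomb:
  assumes "\<And>q. q < rnk Q j \<Longrightarrow> homogeneous_vec P i (shft Q j q) (a q)" and "homogeneous_vec Q j s v"
  shows "homogeneous_vec P i s (lincomb (rnk Q j) a v)"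
  unfolding homogeneous_vec_def
proof (intro conjI allI impI)
  show "lincomb (rnk Q j) a v \<in> tensor_term P i UNIV"
    using assms(1) by (auto simp: tensor_term_def lincomb_def homogeneous_vec_def)
  fix p assume p: "p < rnk P i"
  show "homogeneous (s - shft P i p) (lincomb (rnk Q j) a v p)"
    unfolding lincomb_def
  proof (rule homogeneous_sum)
    fix q assume q: "q \<in> {..<rnk Q j}"
    have "homogeneous ((shft Q j q - shft P i p) + (s - shft Q j q)) (a q p * v q)"
      using assms p q by (intro homogeneous_mult) (auto simp: homogeneous_vec_def)
    then show "homogeneous (s - shft P i p) (a q p * v q)" by (simp add: algebra_simps)
  qed
qed

lemma homogeneous_vec_diff: "homogeneous_vec P i s u \<Longrightarrow> homogeneous_vec P i s v \<Longrightarrow> homogeneous_vec P i s (u - v)"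
  by (auto simp: homogeneous_vec_def tensor_term_def intro: homogeneous_diff)

lemma homogeneous_vec_unit: "q < rnk P i \<Longrightarrow> homogeneous_vec P i (shft P i q) (\<lambda>p. if p = q then 1 else 0)"
  by (auto simp: homogeneous_vec_def tensor_term_def homogeneous_1)

context
  fixes I :: "('x::finite, 'k::field) mpoly set" and P :: "('x, 'k) free_complex"
  assumes res: "free_resolution I P" and I: "graded_ideal I"
begin

lemma is_cycle_iff_boundary:
  assumes "v \<in> tensor_term P i UNIV"
  shows "is_cycle I P i v \<longleftrightarrow> (\<exists>w\<in>tensor_term P (Suc i) UNIV. tensor_diff (*) P i w = v)"
proof (cases i)
  case 0
  have "{v \<in> tensor_term P 0 UNIV. aug_map P v \<in> I} = tensor_diff (*) P 0 ` tensor_term P 1 UNIV"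
    using res by (simp add: free_resolution_def aug_map_def)
  then have "v \<in> {v \<in> tensor_term P 0 UNIV. aug_map P v \<in> I} \<longleftrightarrow> v \<in> tensor_diff (*) P 0 ` tensor_term P 1 UNIV"
    by (rule arg_cong)
  with assms 0 show ?thesis by (auto simp: is_cycle_def)
next
  case (Suc j)
  have "{v \<in> tensor_term P (Suc j) UNIV. tensor_diff (*) P j v = 0}
        = tensor_diff (*) P (Suc j) ` tensor_term P (Suc (Suc j)) UNIV"
    using res unfolding free_resolution_def by blast
  then have "v \<in> {v \<in> tensor_term P (Suc j) UNIV. tensor_diff (*) P j v = 0} \<longleftrightarrow>
      v \<in> tensor_diff (*) P (Suc j) ` tensor_term P (Suc (Suc j)) UNIV"
    by (rule arg_cong)
  with assms Suc show ?thesis by (auto simp: is_cycle_def)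
qed

lemma homogeneous_dmat: "p < rnk P i \<Longrightarrow> q < rnk P (Suc i) \<Longrightarrow> homogeneous (shft P (Suc i) q - shft P i p) (dmat P i p q)"
  using res by (simp add: free_resolution_def)

lemma homogeneous_aug: "q < rnk P 0 \<Longrightarrow> homogeneous (shft P 0 q) (aug P q)"
  using res by (simp add: free_resolution_def)

lemma homogeneous_vec_diff_column: "q < rnk P (Suc i) \<Longrightarrow> homogeneous_vec P i (shft P (Suc i) q) (diff_column P i q)"
  by (auto simp: homogeneous_vec_def tensor_term_def diff_column_def homogeneous_dmat)

text \<open>
Any preimage under the differential can be replaced by its homogeneous component of the right degree,
because the matrix of the differential is homogeneous.
\<close>

lemma homogeneous_cycle_lift:
  assumes v: "homogeneous_vec P i s v" and cyc: "is_cycle I P i v"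
  shows "\<exists>w. homogeneous_vec P (Suc i) s w \<and> tensor_diff (*) P i w = v"
proof -
  from v cyc obtain w where w: "w \<in> tensor_term P (Suc i) UNIV" "tensor_diff (*) P i w = v"
    using is_cycle_iff_boundary[of v i] by (auto simp: homogeneous_vec_def)
  define w' where "w' = (\<lambda>q. if q < rnk P (Suc i) then hcomp (s - shft P (Suc i) q) (w q) else 0)"
  have "homogeneous_vec P (Suc i) s w'"
    by (auto simp: homogeneous_vec_def tensor_term_def w'_def homogeneous_hcomp)
  moreover have "tensor_diff (*) P i w' p = v p" for p
  proof (cases "p < rnk P i")
    case True
    have "tensor_diff (*) P i w' p = (\<Sum>q<rnk P (Suc i). hcomp (s - shft P i p) (dmat P i p q * w q))"
      using True by (simp add: tensor_diff_def w'_def hcomp_homogeneous_mult[OF homogeneous_dmat])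
    also have "\<dots> = hcomp (s - shft P i p) (v p)"
      using True unfolding w(2)[symmetric] by (simp add: tensor_diff_def hcomp_sum)
    also have "\<dots> = v p" using v True by (simp add: homogeneous_vec_def hcomp_homogeneous[of "s - shft P i p"])
    finally show ?thesis .
  next
    case False
    then show ?thesis using v by (simp add: tensor_diff_def homogeneous_vec_def tensor_term_def)
  qed
  ultimately show ?thesis by auto
qed

lemma homogeneous_aug_lift:
  assumes "homogeneous c s"
  shows "\<exists>v. homogeneous_vec P 0 c v \<and> s - aug_map P v \<in> I"
proof -
  obtain v where v: "v \<in> tensor_term P 0 UNIV" "s - aug_map P v \<in> I"
  proof -
    have "\<forall>s. \<exists>v\<in>tensor_term P 0 UNIV. s - (\<Sum>q<rnk P 0. aug P q * v q) \<in> I"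
      using res unfolding free_resolution_def by (elim conjE) assumption
    then have "\<exists>v\<in>tensor_term P 0 UNIV. s - aug_map P v \<in> I" unfolding aug_map_def ..
    then show ?thesis using that by blast
  qed
  define w where "w = (\<lambda>q. if q < rnk P 0 then hcomp (c - shft P 0 q) (v q) else 0)"
  have "homogeneous_vec P 0 c w"
    by (auto simp: homogeneous_vec_def tensor_term_def w_def homogeneous_hcomp)
  moreover have "aug_map P w = hcomp c (aug_map P v)"
    by (simp add: aug_map_def w_def hcomp_sum hcomp_homogeneous_mult[OF homogeneous_aug])
  then have "s - aug_map P w = hcomp c (s - aug_map P v)"
    using assms by (simp add: hcomp_diff hcomp_homogeneous)
  then have "s - aug_map P w \<in> I" using graded_idealD(6)[OF I v(2)] by simp
  ultimately show ?thesis by blast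
qed

lemma is_cycle_diff_column: "q < rnk P (Suc i) \<Longrightarrow> is_cycle I P i (diff_column P i q)"
proof (subst is_cycle_iff_boundary)
  assume q: "q < rnk P (Suc i)"
  then show "diff_column P i q \<in> tensor_term P i UNIV" using homogeneous_vec_diff_column by (simp add: homogeneous_vec_def)
  have "tensor_diff (*) P i (\<lambda>p. if p = q then 1 else 0) = diff_column P i q"
    using q by (auto simp: tensor_diff_def diff_column_def if_1_0_mult)
  moreover have "(\<lambda>p. if p = q then 1 else 0) \<in> tensor_term P (Suc i) UNIV"
    using q by (auto simp: tensor_term_def)
  ultimately show "\<exists>w\<in>tensor_term P (Suc i) UNIV. tensor_diff (*) P i w = diff_column P i q" by blast
qed

lemma lincomb_diff_column_diff_column: "q < rnk P (Suc (Suc i)) \<Longrightarrow> lincomb (rnk P (Suc i)) (diff_column P i) (diff_column P (Suc i) q) = 0"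
  using is_cycle_diff_column[of q "Suc i"] by (simp add: is_cycle_def tensor_diff_lincomb)

lemma lincomb_lincomb_diff_column:
  assumes "q < rnk P (Suc (Suc i))"
  shows "lincomb (rnk P (Suc i)) (\<lambda>r. lincomb (rnk P i) x (diff_column P i r)) (diff_column P (Suc i) q) = 0"
  using assms by (simp add: lincomb_lincomb[symmetric] lincomb_diff_column_diff_column lincomb_0)

text \<open>
A chain endomorphism \<open>\<theta>\<close> of a free resolution that induces zero on \<open>S/I\<close> is null-homotopic. The homotopy
is built recursively; the last conjunct of the invariant is what allows the next lifting step.
\<close>

lemma homotopy_exists:
  assumes \<theta>: "\<And>i q. q < rnk P i \<Longrightarrow> homogeneous_vec P i (shft P i q) (\<theta> i q)"
    and \<theta>0: "\<And>q. q < rnk P 0 \<Longrightarrow> is_cycle I P 0 (\<theta> 0 q)"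
    and chain: "\<And>i q. q < rnk P (Suc i) \<Longrightarrow> tensor_diff (*) P i (\<theta> (Suc i) q) = lincomb (rnk P i) (\<theta> i) (diff_column P i q)"
  shows "\<exists>h. (\<forall>i. \<forall>q<rnk P i. homogeneous_vec P (Suc i) (shft P i q) (h i q)) \<and>
     (\<forall>q<rnk P 0. tensor_diff (*) P 0 (h 0 q) = \<theta> 0 q) \<and>
     (\<forall>i. \<forall>q<rnk P (Suc i). tensor_diff (*) P (Suc i) (h (Suc i) q)
          = \<theta> (Suc i) q - lincomb (rnk P i) (h i) (diff_column P i q))"
proof -
  define Inv where "Inv n x \<longleftrightarrow> (\<forall>q<rnk P n. homogeneous_vec P (Suc n) (shft P n q) (x q)) \<and>
     (n = 0 \<longrightarrow> (\<forall>q<rnk P 0. tensor_diff (*) P 0 (x q) = \<theta> 0 q)) \<and>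
     (\<forall>q<rnk P (Suc n). is_cycle I P (Suc n) (\<theta> (Suc n) q - lincomb (rnk P n) x (diff_column P n q)))" for n x
  define Step where "Step n x y \<longleftrightarrow> (\<forall>q<rnk P (Suc n). tensor_diff (*) P (Suc n) (y q)
          = \<theta> (Suc n) q - lincomb (rnk P n) x (diff_column P n q))" for n x y
  have "\<exists>h. \<forall>n. Inv n (h n) \<and> Step n (h n) (h (Suc n))"
  proof (rule dependent_nat_choice)
    have "\<forall>q\<in>{..<rnk P 0}. \<exists>w. homogeneous_vec P 1 (shft P 0 q) w \<and> tensor_diff (*) P 0 w = \<theta> 0 q"
      using homogeneous_cycle_lift[OF \<theta> \<theta>0] by simp
    then obtain x where x: "\<And>q. q < rnk P 0 \<Longrightarrow> homogeneous_vec P 1 (shft P 0 q) (x q) \<and> tensor_diff (*) P 0 (x q) = \<theta> 0 q"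
      by (metis lessThan_iff)
    have "tensor_diff (*) P 0 (lincomb (rnk P 0) x v) = lincomb (rnk P 0) (\<theta> 0) v" for v
      using x unfolding tensor_diff_lincomb lincomb_lincomb by (intro lincomb_cong) (simp flip: tensor_diff_lincomb)
    then have "Inv 0 x" using x
      unfolding Inv_def by (simp add: is_cycle_def tensor_diff_lincomb lincomb_diff) (simp add: chain flip: tensor_diff_lincomb)
    then show "\<exists>x. Inv 0 x" by blast
  next
    fix x n assume x: "Inv n x"
    have "\<exists>w. homogeneous_vec P (Suc (Suc n)) (shft P (Suc n) q) w \<and>
        tensor_diff (*) P (Suc n) w = \<theta> (Suc n) q - lincomb (rnk P n) x (diff_column P n q)" if q: "q < rnk P (Suc n)" for q
    proof (rule homogeneous_cycle_lift)
      show "homogeneous_vec P (Suc n) (shft P (Suc n) q) (\<theta> (Suc n) q - lincomb (rnk P n) x (diff_column P n q))"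
        using x q by (intro homogeneous_vec_diff \<theta> homogeneous_vec_lincomb homogeneous_vec_diff_column) (auto simp: Inv_def)
      show "is_cycle I P (Suc n) (\<theta> (Suc n) q - lincomb (rnk P n) x (diff_column P n q))"
        using x q by (simp add: Inv_def)
    qed
    then obtain y where y: "\<And>q. q < rnk P (Suc n) \<Longrightarrow> homogeneous_vec P (Suc (Suc n)) (shft P (Suc n) q) (y q)"
        "\<And>q. q < rnk P (Suc n) \<Longrightarrow> tensor_diff (*) P (Suc n) (y q) = \<theta> (Suc n) q - lincomb (rnk P n) x (diff_column P n q)"
      by metis
    have "tensor_diff (*) P (Suc n) (\<theta> (Suc (Suc n)) q - lincomb (rnk P (Suc n)) y (diff_column P (Suc n) q)) = 0"
      if q: "q < rnk P (Suc (Suc n))" for q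
    proof -
      have "tensor_diff (*) P (Suc n) (lincomb (rnk P (Suc n)) y (diff_column P (Suc n) q))
         = lincomb (rnk P (Suc n)) (\<lambda>r. \<theta> (Suc n) r - lincomb (rnk P n) x (diff_column P n r)) (diff_column P (Suc n) q)"
        using y(2) unfolding tensor_diff_lincomb lincomb_lincomb by (intro lincomb_cong) (simp flip: tensor_diff_lincomb)
      also have "\<dots> = lincomb (rnk P (Suc n)) (\<theta> (Suc n)) (diff_column P (Suc n) q)"
        unfolding lincomb_diff_left lincomb_lincomb_diff_column[OF q] by simp
      also have "\<dots> = tensor_diff (*) P (Suc n) (\<theta> (Suc (Suc n)) q)" using chain[OF q] by simp
      finally show ?thesis by (simp add: tensor_diff_lincomb lincomb_diff)
    qed
    then have "Inv (Suc n) y" using y(1) by (simp add: Inv_def is_cycle_def)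
    moreover have "Step n x y" using y(2) by (simp add: Step_def)
    ultimately show "\<exists>y. Inv (Suc n) y \<and> Step n x y" by blast
  qed
  then obtain h where h: "\<And>n. Inv n (h n)" "\<And>n. Step n (h n) (h (Suc n))" by blast
  show ?thesis
  proof (intro exI[of _ h] conjI allI impI)
    fix i q
    show "q < rnk P i \<Longrightarrow> homogeneous_vec P (Suc i) (shft P i q) (h i q)" using h(1)[of i] by (simp add: Inv_def)
    show "q < rnk P 0 \<Longrightarrow> tensor_diff (*) P 0 (h 0 q) = \<theta> 0 q" using h(1)[of 0] by (simp add: Inv_def)
    show "q < rnk P (Suc i) \<Longrightarrow> tensor_diff (*) P (Suc i) (h (Suc i) q) = \<theta> (Suc i) q - lincomb (rnk P i) (h i) (diff_column P i q)" using h(2)[of i] by (simp add: Step_def)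
  qed
qed

text \<open>
The lift of the identity of \<open>S/I\<close> is built recursively: the images of the boundaries of the next basis
vectors are cycles, and these can be lifted.
\<close>

lemma chain_map_exists:
  assumes resQ: "free_resolution I Q"
    and Qhom: "\<And>i q. q < rnk Q (Suc i) \<Longrightarrow> homogeneous_vec Q i (shft Q (Suc i) q) (diff_column Q i q)"
    and Qcyc: "\<And>i q. q < rnk Q (Suc i) \<Longrightarrow> is_cycle I Q i (diff_column Q i q)"
  shows "\<exists>\<phi>. (\<forall>i. \<forall>q<rnk Q i. homogeneous_vec P i (shft Q i q) (\<phi> i q)) \<and>
     (\<forall>q<rnk Q 0. aug Q q - aug_map P (\<phi> 0 q) \<in> I) \<and>
     (\<forall>i. \<forall>q<rnk Q (Suc i). tensor_diff (*) P i (\<phi> (Suc i) q) = lincomb (rnk Q i) (\<phi> i) (diff_column Q i q))"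
proof -
  define Inv where "Inv n x \<longleftrightarrow> (\<forall>q<rnk Q n. homogeneous_vec P n (shft Q n q) (x q)) \<and>
     (n = 0 \<longrightarrow> (\<forall>q<rnk Q 0. aug Q q - aug_map P (x q) \<in> I)) \<and>
     (\<forall>q<rnk Q (Suc n). is_cycle I P n (lincomb (rnk Q n) x (diff_column Q n q)))" for n x
  define Step where "Step n x y \<longleftrightarrow> (\<forall>q<rnk Q (Suc n). tensor_diff (*) P n (y q)
          = lincomb (rnk Q n) x (diff_column Q n q))" for n x y
  have "\<exists>h. \<forall>n. Inv n (h n) \<and> Step n (h n) (h (Suc n))"
  proof (rule dependent_nat_choice)
    have "\<exists>w. homogeneous_vec P 0 (shft Q 0 q) w \<and> aug Q q - aug_map P w \<in> I" if "q < rnk Q 0" for q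
      using that resQ by (intro homogeneous_aug_lift) (simp add: free_resolution_def)
    then obtain x where x: "\<And>q. q < rnk Q 0 \<Longrightarrow> homogeneous_vec P 0 (shft Q 0 q) (x q) \<and> aug Q q - aug_map P (x q) \<in> I"
      by metis
    have "is_cycle I P 0 (lincomb (rnk Q 0) x (diff_column Q 0 q))" if q: "q < rnk Q 1" for q
    proof -
      let ?v = "diff_column Q 0 q"
      have "aug_map Q ?v \<in> I" using Qcyc[of q 0] q by (simp add: is_cycle_def)
      moreover have "(\<Sum>r<rnk Q 0. ?v r * (aug Q r - aug_map P (x r))) \<in> I"
        using x by (intro graded_idealD(4,5)[OF I]) auto
      ultimately have "aug_map Q ?v - (\<Sum>r<rnk Q 0. ?v r * (aug Q r - aug_map P (x r))) \<in> I"
        by (rule graded_idealD(3)[OF I])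
      also have "aug_map Q ?v - (\<Sum>r<rnk Q 0. ?v r * (aug Q r - aug_map P (x r))) = aug_map P (lincomb (rnk Q 0) x ?v)"
        unfolding aug_map_lincomb by (simp add: aug_map_def[of Q] algebra_simps sum_subtractf)
      finally show ?thesis by (simp add: is_cycle_def)
    qed
    then have "Inv 0 x" using x by (simp add: Inv_def)
    then show "\<exists>x. Inv 0 x" by blast
  next
    fix x n assume x: "Inv n x"
    have "\<exists>w. homogeneous_vec P (Suc n) (shft Q (Suc n) q) w \<and>
        tensor_diff (*) P n w = lincomb (rnk Q n) x (diff_column Q n q)" if q: "q < rnk Q (Suc n)" for q
      using x q by (intro homogeneous_cycle_lift homogeneous_vec_lincomb Qhom) (auto simp: Inv_def)
    then obtain y where y: "\<And>q. q < rnk Q (Suc n) \<Longrightarrow> homogeneous_vec P (Suc n) (shft Q (Suc n) q) (y q)"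
        "\<And>q. q < rnk Q (Suc n) \<Longrightarrow> tensor_diff (*) P n (y q) = lincomb (rnk Q n) x (diff_column Q n q)"
      by metis
    have "tensor_diff (*) P n (lincomb (rnk Q (Suc n)) y (diff_column Q (Suc n) q)) = 0"
      if q: "q < rnk Q (Suc (Suc n))" for q
    proof -
      have "tensor_diff (*) P n (lincomb (rnk Q (Suc n)) y (diff_column Q (Suc n) q))
         = lincomb (rnk Q (Suc n)) (\<lambda>r. lincomb (rnk Q n) x (diff_column Q n r)) (diff_column Q (Suc n) q)"
        using y(2) unfolding tensor_diff_lincomb lincomb_lincomb by (intro lincomb_cong) (simp flip: tensor_diff_lincomb)
      also have "\<dots> = lincomb (rnk Q n) x (lincomb (rnk Q (Suc n)) (diff_column Q n) (diff_column Q (Suc n) q))"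
        by (simp add: lincomb_lincomb)
      also have "\<dots> = 0" using Qcyc[OF q] by (simp add: is_cycle_def tensor_diff_lincomb lincomb_0)
      finally show ?thesis .
    qed
    then have "Inv (Suc n) y" using y(1) by (simp add: Inv_def is_cycle_def)
    moreover have "Step n x y" using y(2) by (simp add: Step_def)
    ultimately show "\<exists>y. Inv (Suc n) y \<and> Step n x y" by blast
  qed
  then obtain h where h: "\<And>n. Inv n (h n)" "\<And>n. Step n (h n) (h (Suc n))" by blast
  show ?thesis
  proof (intro exI[of _ h] conjI allI impI)
    fix i q
    show "q < rnk Q i \<Longrightarrow> homogeneous_vec P i (shft Q i q) (h i q)" using h(1)[of i] by (simp add: Inv_def)
    show "q < rnk Q 0 \<Longrightarrow> aug Q q - aug_map P (h 0 q) \<in> I" using h(1)[of 0] by (simp add: Inv_def)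
    show "q < rnk Q (Suc i) \<Longrightarrow> tensor_diff (*) P i (h (Suc i) q) = lincomb (rnk Q i) (h i) (diff_column Q i q)" using h(2)[of i] by (simp add: Step_def)
  qed
qed

end

text \<open>
The map that \<open>lincomb t a\<close> induces after tensoring with a submodule of a free module: it acts on each
coordinate \<open>b\<close> separately. Identities between linear maps of polynomial tuples therefore carry over
coordinatewise.
\<close>

definition flincomb :: "nat \<Rightarrow> (nat \<Rightarrow> nat \<Rightarrow> 'a::comm_ring_1) \<Rightarrow> (nat \<Rightarrow> 'f \<Rightarrow> 'a) \<Rightarrow> nat \<Rightarrow> 'f \<Rightarrow> 'a" where
  "flincomb t a w = (\<lambda>p b. lincomb t a (\<lambda>q. w q b) p)"

lemma sum_fun_apply: "(\<Sum>a\<in>A. f a) b = (\<Sum>a\<in>A. f a b)"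
  by (induction A rule: infinite_finite_induct) auto

lemma tensor_diff_fscale: "tensor_diff fscale P i w = flincomb (rnk P (Suc i)) (diff_column P i) w"
  by (auto simp: tensor_diff_def flincomb_def lincomb_def diff_column_def fscale_def sum_fun_apply fun_eq_iff)

lemma flincomb_flincomb: "flincomb s a (flincomb t b w) = flincomb t (\<lambda>q. lincomb s a (b q)) w"
  by (simp add: flincomb_def lincomb_lincomb)

lemma flincomb_cong: "(\<And>q. q < t \<Longrightarrow> a q = b q) \<Longrightarrow> flincomb t a v = flincomb t b v"
  unfolding flincomb_def using lincomb_cong[of t a b] by simp

lemma flincomb_0: "flincomb t a 0 = 0"
  by (auto simp: flincomb_def lincomb_def fun_eq_iff)

lemma flincomb_diff: "flincomb t a (u - v) = flincomb t a u - flincomb t a v"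
  by (auto simp: flincomb_def lincomb_def fun_eq_iff algebra_simps sum_subtractf)

lemma flincomb_diff_left: "flincomb t (\<lambda>q. a q - b q) v = flincomb t a v - flincomb t b v"
  by (auto simp: flincomb_def lincomb_def fun_eq_iff algebra_simps sum_subtractf)

lemma flincomb_add_left: "flincomb t (\<lambda>q. a q + b q) v = flincomb t a v + flincomb t b v"
  by (auto simp: flincomb_def lincomb_def fun_eq_iff algebra_simps sum.distrib)

lemma flincomb_unit: "w \<in> tensor_term P i N \<Longrightarrow> flincomb (rnk P i) (\<lambda>q p. if p = q then 1 else 0) w = w"
  by (auto simp: flincomb_def lincomb_def tensor_term_def fun_eq_iff if_1_0_mult)

lemma graded_submoduleD:
  assumes "graded_submodule e N"
  shows "0 \<in> N" "u \<in> N \<Longrightarrow> v \<in> N \<Longrightarrow> u + v \<in> N" "u \<in> N \<Longrightarrow> v \<in> N \<Longrightarrow> u - v \<in> N" "u \<in> N \<Longrightarrow> fscale a u \<in> N"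
    "(\<And>i. i \<in> A \<Longrightarrow> f i \<in> N) \<Longrightarrow> sum f A \<in> N" "u \<in> N \<Longrightarrow> (\<lambda>b. hcomp (d - e b) (u b)) \<in> N"
proof -
  have s: "module.subspace fscale N" using assms by (simp add: graded_submodule_def)
  note m = module.subspace_0[OF module_fscale s] module.subspace_add[OF module_fscale s]
    module.subspace_diff[OF module_fscale s] module.subspace_scale[OF module_fscale s] module.subspace_sum[OF module_fscale s]
  show "0 \<in> N" "u \<in> N \<Longrightarrow> v \<in> N \<Longrightarrow> u + v \<in> N" "u \<in> N \<Longrightarrow> v \<in> N \<Longrightarrow> u - v \<in> N" "u \<in> N \<Longrightarrow> fscale a u \<in> N"
    "(\<And>i. i \<in> A \<Longrightarrow> f i \<in> N) \<Longrightarrow> sum f A \<in> N" by (auto intro: m)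
  show "u \<in> N \<Longrightarrow> (\<lambda>b. hcomp (d - e b) (u b)) \<in> N" using assms by (simp add: graded_submodule_def)
qed

lemma flincomb_tensor_part:
  assumes a: "\<And>q. q < rnk Q j \<Longrightarrow> homogeneous_vec P i (shft Q j q) (a q)" and N: "graded_submodule e N"
    and w: "w \<in> tensor_part e Q j d N"
  shows "flincomb (rnk Q j) a w \<in> tensor_part e P i d N"
proof -
  have eq: "flincomb (rnk Q j) a w p = (\<Sum>q<rnk Q j. fscale (a q p) (w q))" for p
    by (auto simp: flincomb_def lincomb_def fscale_def sum_fun_apply)
  have "flincomb (rnk Q j) a w p \<in> N" for p
    unfolding eq using w by (intro graded_submoduleD(4,5)[OF N]) (auto simp: tensor_part_def tensor_term_def)
  moreover have "flincomb (rnk Q j) a w p = 0" if "p \<ge> rnk P i" for p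
    unfolding eq using a that by (intro sum.neutral) (auto simp: homogeneous_vec_def tensor_term_def fscale_def fun_eq_iff)
  moreover have "homogeneous (d - shft P i p - e b) (flincomb (rnk Q j) a w p b)" if p: "p < rnk P i" for p b
    unfolding flincomb_def lincomb_def
  proof (rule homogeneous_sum)
    fix q assume q: "q \<in> {..<rnk Q j}"
    have "homogeneous ((shft Q j q - shft P i p) + (d - shft Q j q - e b)) (a q p * w q b)"
      using a w p q by (intro homogeneous_mult) (auto simp: homogeneous_vec_def tensor_part_def free_part_def)
    then show "homogeneous (d - shft P i p - e b) (a q p * w q b)" by (simp add: algebra_simps)
  qed
  ultimately show ?thesis
    by (auto simp: tensor_part_def tensor_term_def free_part_def)
qed

text \<open>
Let \<open>\<phi>\<close> and \<open>\<psi>\<close> be comparison maps from \<open>Q\<close> to \<open>P\<close> and back, and let \<open>h\<close> be a homotopy from the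
identity of \<open>Q\<close> to \<open>\<psi>\<phi>\<close>. If the cycle \<open>\<phi>w\<close> is the boundary of \<open>y\<close>, then the cycle \<open>w\<close> is the boundary of
\<open>\<psi>y - hw\<close>.
\<close>

theorem tor_vanishing_independent:
  assumes I: "graded_ideal I" and P: "free_resolution I P" and Q: "free_resolution I Q"
    and N: "graded_submodule e N"
    and van: "tensor_cycles e P i j N \<subseteq> tensor_boundaries e P i j N"
  shows "tensor_cycles e Q i j N \<subseteq> tensor_boundaries e Q i j N"
proof
  obtain \<phi> where \<phi>: "\<And>i q. q < rnk Q i \<Longrightarrow> homogeneous_vec P i (shft Q i q) (\<phi> i q)"
     "\<And>q. q < rnk Q 0 \<Longrightarrow> aug Q q - aug_map P (\<phi> 0 q) \<in> I"
     "\<And>i q. q < rnk Q (Suc i) \<Longrightarrow> tensor_diff (*) P i (\<phi> (Suc i) q) = lincomb (rnk Q i) (\<phi> i) (diff_column Q i q)"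
    using chain_map_exists[OF P I Q homogeneous_vec_diff_column[OF Q I] is_cycle_diff_column[OF Q I]] by blast
  obtain \<psi> where \<psi>: "\<And>i q. q < rnk P i \<Longrightarrow> homogeneous_vec Q i (shft P i q) (\<psi> i q)"
     "\<And>q. q < rnk P 0 \<Longrightarrow> aug P q - aug_map Q (\<psi> 0 q) \<in> I"
     "\<And>i q. q < rnk P (Suc i) \<Longrightarrow> tensor_diff (*) Q i (\<psi> (Suc i) q) = lincomb (rnk P i) (\<psi> i) (diff_column P i q)"
    using chain_map_exists[OF Q I P homogeneous_vec_diff_column[OF P I] is_cycle_diff_column[OF P I]] by blast
  \<comment> \<open>\<open>\<theta>\<close> is the difference between \<open>\<psi>\<phi>\<close> and the identity\<close>
  define unit :: "nat \<Rightarrow> nat \<Rightarrow> ('a, 'b) mpoly" where "unit = (\<lambda>q p. if p = q then 1 else 0)"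
  define \<theta> where "\<theta> i q = lincomb (rnk P i) (\<psi> i) (\<phi> i q) - unit q" for i q
  have \<phi>c: "tensor_diff (*) P i (lincomb (rnk Q (Suc i)) (\<phi> (Suc i)) v) = lincomb (rnk Q i) (\<phi> i) (tensor_diff (*) Q i v)" for i v
    using \<phi>(3) unfolding tensor_diff_lincomb lincomb_lincomb by (intro lincomb_cong) simp
  have \<psi>c: "tensor_diff (*) Q i (lincomb (rnk P (Suc i)) (\<psi> (Suc i)) v) = lincomb (rnk P i) (\<psi> i) (tensor_diff (*) P i v)" for i v
    using \<psi>(3) unfolding tensor_diff_lincomb lincomb_lincomb by (intro lincomb_cong) simp
  have diff_unit: "tensor_diff (*) Q i (unit q) = diff_column Q i q" if "q < rnk Q (Suc i)" for i q
    using that by (auto simp: tensor_diff_def diff_column_def unit_def if_1_0_mult)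
  have "\<exists>h. (\<forall>i. \<forall>q<rnk Q i. homogeneous_vec Q (Suc i) (shft Q i q) (h i q)) \<and>
     (\<forall>q<rnk Q 0. tensor_diff (*) Q 0 (h 0 q) = \<theta> 0 q) \<and>
     (\<forall>i. \<forall>q<rnk Q (Suc i). tensor_diff (*) Q (Suc i) (h (Suc i) q)
          = \<theta> (Suc i) q - lincomb (rnk Q i) (h i) (diff_column Q i q))"
  proof (rule homotopy_exists[OF Q I])
    fix i q assume q: "q < rnk Q i"
    then show "homogeneous_vec Q i (shft Q i q) (\<theta> i q)"
      unfolding \<theta>_def unit_def by (intro homogeneous_vec_diff homogeneous_vec_lincomb \<psi>(1) \<phi>(1) homogeneous_vec_unit)
  next
    fix q assume q: "q < rnk Q 0"
    have "(\<Sum>r<rnk P 0. \<phi> 0 q r * (aug P r - aug_map Q (\<psi> 0 r))) \<in> I"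
      using \<psi>(2) by (intro graded_idealD(4,5)[OF I]) auto
    from graded_idealD(2)[OF I this \<phi>(2)[OF q]]
    have "aug Q q - (\<Sum>r<rnk P 0. \<phi> 0 q r * aug_map Q (\<psi> 0 r)) \<in> I"
      by (simp add: aug_map_def[of P] algebra_simps sum_subtractf)
    moreover have "aug_map Q (\<theta> 0 q) = (\<Sum>r<rnk P 0. \<phi> 0 q r * aug_map Q (\<psi> 0 r)) - aug Q q"
      using q aug_map_lincomb[of Q "rnk P 0" "\<psi> 0" "\<phi> 0 q"]
      by (simp add: \<theta>_def aug_map_def[of Q] algebra_simps sum_subtractf unit_def if_1_0_mult)
    ultimately show "is_cycle I Q 0 (\<theta> 0 q)"
      using graded_idealD(3)[OF I graded_idealD(1)[OF I]] by (fastforce simp: is_cycle_def)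
  next
    fix i q assume q: "q < rnk Q (Suc i)"
    have "lincomb (rnk Q i) (\<theta> i) (diff_column Q i q) = lincomb (rnk P i) (\<psi> i) (lincomb (rnk Q i) (\<phi> i) (diff_column Q i q)) - diff_column Q i q"
      unfolding \<theta>_def lincomb_diff_left lincomb_lincomb
      using lincomb_unit[of "diff_column Q i q" Q i] homogeneous_vec_diff_column[OF Q I q] by (simp add: unit_def homogeneous_vec_def)
    then show "tensor_diff (*) Q i (\<theta> (Suc i) q) = lincomb (rnk Q i) (\<theta> i) (diff_column Q i q)"
      using \<psi>c[of i "\<phi> (Suc i) q"] diff_unit[OF q] \<phi>(3)[OF q]
      by (simp add: \<theta>_def tensor_diff_lincomb lincomb_diff)
  qed
  then obtain h where h: "\<And>i q. q < rnk Q i \<Longrightarrow> homogeneous_vec Q (Suc i) (shft Q i q) (h i q)"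
     "\<And>q. q < rnk Q 0 \<Longrightarrow> tensor_diff (*) Q 0 (h 0 q) = \<theta> 0 q"
     "\<And>i q. q < rnk Q (Suc i) \<Longrightarrow> tensor_diff (*) Q (Suc i) (h (Suc i) q)
          = \<theta> (Suc i) q - lincomb (rnk Q i) (h i) (diff_column Q i q)" by blast
  fix w assume w: "w \<in> tensor_cycles e Q i j N"
  then have wp: "w \<in> tensor_part e Q i j N" by (simp add: tensor_cycles_def)
  define u where "u = flincomb (rnk Q i) (\<phi> i) w"
  have "u \<in> tensor_part e P i j N"
    unfolding u_def using \<phi>(1) N wp by (rule flincomb_tensor_part)
  moreover have "tensor_diff fscale P i' u = 0" if i: "i = Suc i'" for i'
  proof -
    have "tensor_diff fscale P i' u = flincomb (rnk Q i) (\<lambda>q. lincomb (rnk Q i') (\<phi> i') (diff_column Q i' q)) w"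
      unfolding u_def tensor_diff_fscale flincomb_flincomb i
      using \<phi>(3) by (intro flincomb_cong) (simp add: tensor_diff_lincomb)
    also have "\<dots> = flincomb (rnk Q i') (\<phi> i') (tensor_diff fscale Q i' w)"
      unfolding tensor_diff_fscale flincomb_flincomb i ..
    also have "\<dots> = 0" using w i by (simp add: tensor_cycles_def flincomb_0)
    finally show ?thesis .
  qed
  ultimately have "u \<in> tensor_cycles e P i j N"
    by (auto simp: tensor_cycles_def split: nat.split)
  with van obtain y where y: "y \<in> tensor_part e P (Suc i) j N" "u = tensor_diff fscale P i y"
    by (auto simp: tensor_boundaries_def)
  define z where "z = flincomb (rnk P (Suc i)) (\<psi> (Suc i)) y - flincomb (rnk Q i) (h i) w"
  have "z \<in> tensor_part e Q (Suc i) j N"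
  proof -
    have "flincomb (rnk P (Suc i)) (\<psi> (Suc i)) y \<in> tensor_part e Q (Suc i) j N" "flincomb (rnk Q i) (h i) w \<in> tensor_part e Q (Suc i) j N"
      by (rule flincomb_tensor_part[OF _ N y(1)], rule \<psi>(1), assumption)
         (rule flincomb_tensor_part[OF _ N wp], rule h(1), assumption)
    then show ?thesis
      by (auto simp: z_def tensor_part_def tensor_term_def free_part_def intro: homogeneous_diff graded_submoduleD(3)[OF N])
  qed
  moreover have "tensor_diff fscale Q i z = w"
  proof -
    have "tensor_diff fscale Q i (flincomb (rnk P (Suc i)) (\<psi> (Suc i)) y)
        = flincomb (rnk P (Suc i)) (\<lambda>q. lincomb (rnk P i) (\<psi> i) (diff_column P i q)) y"
      unfolding tensor_diff_fscale flincomb_flincomb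
      using \<psi>(3) by (intro flincomb_cong) (simp add: tensor_diff_lincomb)
    also have "\<dots> = flincomb (rnk P i) (\<psi> i) u"
      unfolding y(2) tensor_diff_fscale flincomb_flincomb ..
    also have "\<dots> = flincomb (rnk Q i) (\<lambda>q. \<theta> i q + unit q) w"
      unfolding u_def flincomb_flincomb \<theta>_def by simp
    also have "\<dots> = flincomb (rnk Q i) (\<theta> i) w + w"
      unfolding flincomb_add_left using flincomb_unit[of w Q i N] wp by (simp add: unit_def tensor_part_def)
    finally have 1: "tensor_diff fscale Q i (flincomb (rnk P (Suc i)) (\<psi> (Suc i)) y) = flincomb (rnk Q i) (\<theta> i) w + w" .
    have "tensor_diff fscale Q i (flincomb (rnk Q i) (h i) w) = flincomb (rnk Q i) (\<lambda>q. tensor_diff (*) Q i (h i q)) w"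
      by (simp add: tensor_diff_fscale flincomb_flincomb tensor_diff_lincomb)
    also have "\<dots> = flincomb (rnk Q i) (\<theta> i) w"
    proof (cases i)
      case 0
      show ?thesis unfolding 0 using h(2) by (intro flincomb_cong) simp
    next
      case (Suc i')
      have "flincomb (rnk Q i) (\<lambda>q. tensor_diff (*) Q i (h i q)) w =
          flincomb (rnk Q i) (\<lambda>q. \<theta> i q - lincomb (rnk Q i') (h i') (diff_column Q i' q)) w"
        unfolding Suc using h(3) by (intro flincomb_cong) simp
      also have "\<dots> = flincomb (rnk Q i) (\<theta> i) w - flincomb (rnk Q i') (h i') (tensor_diff fscale Q i' w)"
        unfolding flincomb_diff_left tensor_diff_fscale flincomb_flincomb Suc ..
      also have "\<dots> = flincomb (rnk Q i) (\<theta> i) w" using w Suc by (simp add: tensor_cycles_def flincomb_0)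
      finally show ?thesis .
    qed
    finally show ?thesis using 1 by (simp add: z_def tensor_diff_fscale flincomb_diff)
  qed
  ultimately show "w \<in> tensor_boundaries e Q i j N" unfolding tensor_boundaries_def by blast
qed

section \<open>The Koszul complex as a free resolution\<close>

text \<open>
An enumeration of the sets of \<open>i\<close> variables, which turns the basis \<open>e\<^sub>T\<close> of the \<open>i\<close>-th exterior power into
one that is indexed by natural numbers.
\<close>

definition nth_subset :: "nat \<Rightarrow> nat \<Rightarrow> 'x::finite set" where
  "nth_subset i = (SOME f. bij_betw f {..<card {T :: 'x set. card T = i}} {T. card T = i})"

lemma nth_subset_bij: "bij_betw (nth_subset i) {..<card {T :: 'x::finite set. card T = i}} {T :: 'x set. card T = i}"
proof -
  have "\<exists>f. bij_betw f {..<card {T :: 'x set. card T = i}} {T :: 'x set. card T = i}"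
    using ex_bij_betw_nat_finite[of "{T :: 'x set. card T = i}"] by (simp add: lessThan_atLeast0)
  then show ?thesis unfolding nth_subset_def by (rule someI_ex)
qed

definition koszul_complex :: "('x::finite, 'k::field_char_0) free_complex" where
  "koszul_complex = \<lparr>rnk = \<lambda>i. card {T :: 'x set. card T = i}, shft = \<lambda>i q. int i,
     dmat = \<lambda>i p q. koszul (\<lambda>U. if U = nth_subset (Suc i) q then 1 else 0) (nth_subset i p), aug = \<lambda>q. 1\<rparr>"

abbreviation subset_count :: "'x::finite itself \<Rightarrow> nat \<Rightarrow> nat" where
  "subset_count _ i \<equiv> card {T :: 'x set. card T = i}"

text \<open>
\<open>spread\<close> and \<open>gather\<close> translate between tuples indexed by \<open>{..<subset_count i}\<close> and forms of exterior
degree \<open>i\<close>; they are inverse to each other.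
\<close>

definition spread :: "nat \<Rightarrow> (nat \<Rightarrow> 'v::comm_monoid_add) \<Rightarrow> 'x::finite set \<Rightarrow> 'v" where
  "spread i w T = (\<Sum>q<card {T :: 'x set. card T = i}. if T = nth_subset i q then w q else 0)"

definition gather :: "nat \<Rightarrow> ('x::finite set \<Rightarrow> 'v::comm_monoid_add) \<Rightarrow> nat \<Rightarrow> 'v" where
  "gather i W q = (if q < card {T :: 'x set. card T = i} then W (nth_subset i q) else 0)"

lemma card_nth_subset: "q < subset_count TYPE('x::finite) i \<Longrightarrow> card (nth_subset i q :: 'x set) = i"
  using bij_betw_apply[OF nth_subset_bij[where ?'x = 'x]] by fastforce

lemma nth_subset_inj:
  assumes "q < subset_count TYPE('x::finite) i" "r < subset_count TYPE('x) i" "(nth_subset i q :: 'x set) = nth_subset i r"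
  shows "q = r"
  using inj_onD[OF bij_betw_imp_inj_on[OF nth_subset_bij] assms(3)] assms(1,2) by simp

lemma nth_subset_surj:
  fixes T :: "'x::finite set"
  assumes "card T = i"
  obtains q where "q < subset_count TYPE('x) i" "T = nth_subset i q"
proof -
  have "T \<in> nth_subset i ` {..<subset_count TYPE('x) i}"
    using assms by (simp add: bij_betw_imp_surj_on[OF nth_subset_bij])
  then show ?thesis using that by blast
qed

lemma spread_nth_subset:
  assumes "q < subset_count TYPE('x::finite) i" shows "spread i w (nth_subset i q :: 'x set) = w q"
proof -
  have "spread i w (nth_subset i q :: 'x set) = (\<Sum>r<subset_count TYPE('x) i. if r = q then w q else 0)"
    unfolding spread_def using assms nth_subset_inj by (intro sum.cong) auto
  then show ?thesis using assms by simp
qed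

lemma alt_degree_spread: "alt_degree i (spread i w :: 'x::finite set \<Rightarrow> _)"
  unfolding alt_degree_def spread_def using card_nth_subset[where ?'x = 'x] by (auto intro!: sum.neutral)

lemma spread_gather:
  fixes W :: "'x::finite set \<Rightarrow> _"
  assumes "alt_degree i W" shows "spread i (gather i W) = W"
proof
  fix T :: "'x set"
  show "spread i (gather i W) T = W T"
  proof (cases "card T = i")
    case True
    then obtain q where "q < subset_count TYPE('x) i" "T = nth_subset i q" by (rule nth_subset_surj)
    then show ?thesis by (simp add: spread_nth_subset gather_def)
  next
    case False
    then show ?thesis using assms alt_degree_spread[of i "gather i W", where ?'x = 'x] by (simp add: alt_degree_def)
  qed
qed

lemma koszul_complex_simps [simp]:
  "rnk (koszul_complex :: ('x::finite, 'k::field_char_0) free_complex) i = subset_count TYPE('x) i"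
  "shft (koszul_complex :: ('x, 'k) free_complex) i q = int i"
  "aug (koszul_complex :: ('x, 'k) free_complex) q = 1"
  by (simp_all add: koszul_complex_def)

lemma tensor_diff_koszul:
  fixes w :: "nat \<Rightarrow> ('x::finite, 'k::field_char_0) mpoly"
  shows "tensor_diff (*) koszul_complex i w = gather i (koszul (spread (Suc i) w))"
proof
  fix p
  have "spread (Suc i) w = (\<lambda>T :: 'x set. \<Sum>q<subset_count TYPE('x) (Suc i). w q * (if T = nth_subset (Suc i) q then 1 else 0))"
    by (simp add: spread_def if_1_0_mult fun_eq_iff)
  then have "koszul (spread (Suc i) w) T =
      (\<Sum>q<subset_count TYPE('x) (Suc i). w q * koszul (\<lambda>T. if T = nth_subset (Suc i) q then 1 else 0) T)" for T
    by (simp add: koszul_sum koszul_mult)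
  then show "tensor_diff (*) koszul_complex i w p = gather i (koszul (spread (Suc i) w)) p"
    by (simp add: tensor_diff_def gather_def) (simp add: koszul_complex_def mult.commute)
qed

lemma max_ideal_iff: "p \<in> max_ideal \<longleftrightarrow> lookup p 0 = 0"
proof
  let ?J = "{p. lookup p 0 = 0} :: ('a, 'b) mpoly set"
  have sub: "module.subspace (*) ?J"
  proof (rule module.subspaceI[OF module_mult])
    fix c x :: "('a, 'b) mpoly" assume x: "x \<in> ?J"
    have "lookup (c * x) 0 = 0"
    proof (rule ccontr)
      assume "lookup (c * x) 0 \<noteq> 0"
      then have "0 \<in> keys (c * x)" by (simp add: in_keys_iff)
      then obtain r s where rs: "r + s = 0" "s \<in> keys x" using keys_mult[of c x] by force
      have "s = 0"
      proof (rule poly_mapping_eqI)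
        fix y
        have "lookup (r + s) y = 0" using rs by simp
        then show "lookup s y = lookup 0 y" by (simp add: lookup_add)
      qed
      then show False using x rs(2) by (simp add: in_keys_iff)
    qed
    then show "c * x \<in> ?J" by simp
  qed (auto simp: lookup_add)
  have "range Var \<subseteq> ?J"
  proof safe
    fix x :: 'a show "lookup (Var x) 0 = 0"
      using Var_mult_lookup_0[of 0 x 1] by simp
  qed
  then have "max_ideal \<subseteq> ?J" unfolding max_ideal_def by (rule module.span_minimal[OF module_mult _ sub])
  then show "p \<in> max_ideal \<Longrightarrow> lookup p 0 = 0" by auto
next
  note span = module.span_superset[OF module_mult] module.span_scale[OF module_mult]
     module.span_sum[OF module_mult]
  have single: "single t c \<in> max_ideal" if t: "t \<noteq> 0" for t and c :: 'b
  proof -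
    from t obtain x s where s: "t = single x 1 + s" by (rule monomial_split)
    have "single t c = single s c * Var x"
      by (simp add: s Var_def mult_single add.commute)
    moreover have "Var x \<in> max_ideal" unfolding max_ideal_def using span(1) by blast
    ultimately show ?thesis unfolding max_ideal_def using span(2) by auto
  qed
  assume "lookup p 0 = 0"
  then have "single s (lookup p s) \<in> max_ideal" for s
    using single[of s] module.span_zero[OF module_mult, of "range Var"]
    by (cases "s = 0") (simp_all add: max_ideal_def)
  then have "(\<Sum>s\<in>keys p. single s (lookup p s)) \<in> max_ideal"
    unfolding max_ideal_def by (intro span(3)) auto
  then show "p \<in> max_ideal" by (simp flip: poly_sum_single)
qed

lemma graded_max_ideal: "graded_ideal max_ideal"
  unfolding graded_ideal_def
proof (intro conjI ballI allI)
  show "module.subspace (*) max_ideal"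
    unfolding max_ideal_def by (rule module.subspace_span[OF module_mult])
qed (simp add: max_ideal_iff lookup_hcomp)

lemma koszul_in_max_ideal: "koszul W T \<in> max_ideal"
  unfolding koszul_def
  by (intro graded_idealD(5)[OF graded_max_ideal]) (simp add: max_ideal_iff Var_mult_lookup_0)

lemma homogeneous_koszul_unit: "homogeneous 1 (koszul (\<lambda>U. if U = T then 1 else 0) V)"
  unfolding koszul_def
proof (rule homogeneous_sum)
  fix x
  have "homogeneous 0 (ksign S y :: ('a, 'b) mpoly)" for S y using ksign_cases[of S y, where ?'k = 'b]
    using homogeneous_1 homogeneous_uminus[OF homogeneous_1] by auto
  then have "homogeneous 0 (contract x (\<lambda>U. if U = T then 1 else 0) V :: ('a, 'b) mpoly)"
    by (auto simp: contract_def)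
  then show "homogeneous 1 (Var x * contract x (\<lambda>U. if U = T then 1 else 0) V :: ('a, 'b) mpoly)"
    using homogeneous_mult[OF homogeneous_Var] by fastforce
qed

lemma gather_eq_0_iff:
  fixes W :: "'x::finite set \<Rightarrow> _"
  assumes "alt_degree i W" shows "gather i W = (\<lambda>_. 0) \<longleftrightarrow> (\<forall>T. W T = 0)"
proof
  assume 0: "gather i W = (\<lambda>_. 0)"
  show "\<forall>T. W T = 0" using spread_gather[OF assms] unfolding 0 by (auto simp: spread_def fun_eq_iff)
qed (auto simp: gather_def)

lemma gather_spread:
  assumes "w \<in> tensor_term (koszul_complex :: ('x::finite, 'k::field_char_0) free_complex) i UNIV"
  shows "gather i (spread i w :: 'x set \<Rightarrow> _) = w"
  using assms by (auto simp: gather_def spread_nth_subset tensor_term_def fun_eq_iff not_less)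

lemma gather_in: "gather i (W :: 'x set \<Rightarrow> 'v::ab_group_add) \<in> tensor_term (koszul_complex :: ('x::finite, 'k::field_char_0) free_complex) i UNIV"
  by (auto simp: gather_def tensor_term_def)

lemma subset_count_0: "subset_count TYPE('x::finite) 0 = 1"
proof -
  have "{T :: 'x set. card T = 0} = {{}}" by auto
  then show ?thesis by simp
qed

lemma spread_0_empty: "spread 0 w ({} :: 'x::finite set) = w 0"
proof -
  have "nth_subset 0 0 = ({} :: 'x set)" using card_nth_subset[of 0 0, where ?'x = 'x] subset_count_0[where ?'x = 'x] by simp
  then show ?thesis using spread_nth_subset[of 0 0 w, where ?'x = 'x] subset_count_0[where ?'x = 'x] by simp
qed

lemma koszul_image:
  fixes v :: "nat \<Rightarrow> ('x::finite, 'k::field_char_0) mpoly"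
  assumes v: "v \<in> tensor_term (koszul_complex :: ('x, 'k) free_complex) i UNIV"
    and cyc: "\<And>T. koszul (spread i v) T = 0" and pos: "i > 0 \<or> v 0 \<in> max_ideal"
  shows "v \<in> tensor_diff (*) koszul_complex i ` tensor_term (koszul_complex :: ('x, 'k) free_complex) (Suc i) UNIV"
proof -
  have "i > 0 \<or> lookup (spread i v {}) 0 = 0"
    using pos by (cases i) (auto simp: spread_0_empty max_ideal_iff)
  from koszul_exact[OF alt_degree_spread cyc this] obtain V where
    V: "alt_degree (Suc i) V" "\<And>T. koszul V T = spread i v T" by blast
  have "tensor_diff (*) koszul_complex i (gather (Suc i) V) = v"
    unfolding tensor_diff_koszul spread_gather[OF V(1)] using V(2) gather_spread[OF v]
    by (metis ext)
  then show ?thesis using gather_in by blast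
qed

theorem koszul_free_resolution:
  "free_resolution max_ideal (koszul_complex :: ('x::finite, 'k::field_char_0) free_complex)"
  unfolding free_resolution_def
proof (intro conjI allI impI)
  let ?P = "koszul_complex :: ('x, 'k) free_complex"
  note [simp] = subset_count_0[where ?'x = 'x]
  show "homogeneous (shft ?P 0 q) (aug ?P q)" for q by (simp add: homogeneous_1)
  show "homogeneous (shft ?P (Suc i) q - shft ?P i p) (dmat ?P i p q)" for i p q
    by (simp add: homogeneous_koszul_unit koszul_complex_def)
  show "\<exists>v\<in>tensor_term ?P 0 UNIV. s - (\<Sum>q<rnk ?P 0. aug ?P q * v q) \<in> max_ideal" for s
    by (rule bexI[of _ "\<lambda>q. if q = 0 then s else 0"])
       (auto simp: tensor_term_def max_ideal_iff)
  have a: "(\<Sum>q<rnk ?P 0. aug ?P q * v q) = v 0" for v by simp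
  show "{v \<in> tensor_term ?P 0 UNIV. (\<Sum>q<rnk ?P 0. aug ?P q * v q) \<in> max_ideal}
        = tensor_diff (*) ?P 0 ` tensor_term ?P 1 UNIV" (is "?L = ?R")
  proof
    show "?L \<subseteq> ?R"
      unfolding a using koszul_image[of _ 0] koszul_alt_degree_0[OF alt_degree_spread] by auto
    show "?R \<subseteq> ?L"
      unfolding a by (auto simp: tensor_diff_koszul gather_in) (simp add: gather_def koszul_in_max_ideal)
  qed
  fix i
  have alt: "alt_degree i (koszul (spread (Suc i) v :: 'x set \<Rightarrow> ('x, 'k) mpoly))" for v
    by (intro alt_degree_koszul alt_degree_spread)
  show "{v \<in> tensor_term ?P (Suc i) UNIV. tensor_diff (*) ?P i v = 0}
        = tensor_diff (*) ?P (Suc i) ` tensor_term ?P (Suc (Suc i)) UNIV" (is "?L = ?R")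
  proof
    show "?L \<subseteq> ?R"
    proof
      fix v assume v: "v \<in> ?L"
      then have "gather i (koszul (spread (Suc i) v :: 'x set \<Rightarrow> ('x, 'k) mpoly)) = (\<lambda>_. 0)"
        by (simp add: tensor_diff_koszul zero_fun_def)
      then have "koszul (spread (Suc i) v :: 'x set \<Rightarrow> ('x, 'k) mpoly) T = 0" for T
        unfolding gather_eq_0_iff[OF alt] by blast
      then show "v \<in> ?R" using v by (intro koszul_image) auto
    qed
    show "?R \<subseteq> ?L"
    proof safe
      fix w :: "nat \<Rightarrow> ('x, 'k) mpoly"
      show "tensor_diff (*) ?P (Suc i) w \<in> tensor_term ?P (Suc i) UNIV"
        by (simp add: tensor_diff_koszul gather_in)
      have "spread (Suc i) (tensor_diff (*) ?P (Suc i) w) = koszul (spread (Suc (Suc i)) w)"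
        unfolding tensor_diff_koszul by (intro spread_gather alt_degree_koszul alt_degree_spread)
      then show "tensor_diff (*) ?P i (tensor_diff (*) ?P (Suc i) w) = 0"
        unfolding tensor_diff_koszul[of i] by (auto simp: gather_def koszul_koszul)
    qed
  qed
qed

section \<open>Vanishing of Betti numbers through the Koszul complex\<close>

text \<open>
Inside a finite-dimensional space the truncated difference of dimensions detects whether the quotient
vanishes.
\<close>

lemma (in vector_space) dim_diff_eq_0_iff:
  assumes "subspace U" "subspace V" "U \<subseteq> V" "V \<subseteq> span X" "finite X"
  shows "dim V - dim U = 0 \<longleftrightarrow> V \<subseteq> U"
proof
  obtain B where B: "B \<subseteq> U" "independent B" "U \<subseteq> span B"
    using maximal_independent_subset by blast
  obtain C where C: "B \<subseteq> C" "C \<subseteq> V" "independent C" "V \<subseteq> span C"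
    using maximal_independent_subset_extend[of B V] B assms(3) by blast
  have finC: "finite C" using independent_span_bound[OF assms(5) C(3)] C(2) assms(4) by auto
  have "dim V = card C" using C by (metis dim_unique)
  moreover have "dim U = card B" using B by (metis dim_unique)
  moreover assume "dim V - dim U = 0"
  ultimately have "card C \<le> card B" by simp
  then have "B = C" using C(1) finC by (simp add: card_seteq)
  then show "V \<subseteq> U" using C(4) span_minimal[OF B(1) assms(1)] by simp
next
  assume "V \<subseteq> U"
  then have "V = U" using assms(3) by auto
  then show "dim V - dim U = 0" by simp
qed

lemma lookup_le_mdeg: "int (lookup t x) \<le> mdeg t"
  unfolding mdeg_def by (rule member_le_sum) auto

lemma finite_mdeg: "finite {t :: 'x::finite \<Rightarrow>\<^sub>0 nat. mdeg t = d}"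
proof (rule inj_on_finite)
  show "inj_on lookup {t :: 'x \<Rightarrow>\<^sub>0 nat. mdeg t = d}"
    by (rule inj_onI) (simp add: poly_mapping.lookup_inject)
  show "lookup ` {t :: 'x \<Rightarrow>\<^sub>0 nat. mdeg t = d} \<subseteq> {f. \<forall>x. f x \<in> {..nat d}}"
  proof (rule image_subsetI, unfold mem_Collect_eq, rule allI)
    fix t :: "'x \<Rightarrow>\<^sub>0 nat" and x assume "mdeg t = d"
    then show "lookup t x \<in> {..nat d}" using lookup_le_mdeg[of t x] by simp
  qed
  show "finite {f :: 'x \<Rightarrow> nat. \<forall>x. f x \<in> {..nat d}}"
    using finite_set_of_finite_funs[of "UNIV :: 'x set" "{..nat d}"] by simp
qed

lemma module_kscale:
  "module (kscale :: 'k::field \<Rightarrow> (nat \<Rightarrow> 'f \<Rightarrow> ('x, 'k) mpoly) \<Rightarrow> _)"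
  using vector_space_kscale by (simp add: module_iff_vector_space)

lemma kscale_fscale: "kscale c w q = fscale (single 0 c) (w q)"
  by (simp add: kscale_def fscale_def)

lemma homogeneous_const_mult: "homogeneous d p \<Longrightarrow> homogeneous d (single 0 c * p)"
  using homogeneous_mult[of 0 "single 0 c" d p] homogeneous_single[of 0 0 c] by simp

context
  fixes e :: "'f::finite \<Rightarrow> int" and N :: "('f \<Rightarrow> ('x::finite, 'k::field) mpoly) set"
    and P :: "('x, 'k) free_complex"
  assumes N: "graded_submodule e N"
begin

lemma subspace_tensor_part: "module.subspace kscale (tensor_part e P i j N)"
proof (rule module.subspaceI[OF module_kscale])
  show "0 \<in> tensor_part e P i j N"
    by (simp add: tensor_part_def tensor_term_def free_part_def graded_submoduleD(1)[OF N])
  show "u + v \<in> tensor_part e P i j N" if "u \<in> tensor_part e P i j N" "v \<in> tensor_part e P i j N" for u v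
    using that by (auto simp: tensor_part_def tensor_term_def free_part_def intro: homogeneous_add graded_submoduleD(2)[OF N])
  show "kscale c u \<in> tensor_part e P i j N" if "u \<in> tensor_part e P i j N" for c u
    using that graded_submoduleD(4)[OF N, of _ "single 0 c"]
    by (auto simp: tensor_part_def tensor_term_def free_part_def kscale_fscale)
       (auto simp: fscale_def fun_eq_iff intro: homogeneous_const_mult)
qed

lemma tensor_diff_linear:
  "tensor_diff fscale P i 0 = 0"
  "tensor_diff fscale P i (u + v) = tensor_diff fscale P i u + tensor_diff fscale P i v"
  "tensor_diff fscale P i (kscale c u) = kscale c (tensor_diff fscale P i u)"
  by (auto simp: tensor_diff_fscale flincomb_def lincomb_def fun_eq_iff algebra_simps sum.distrib kscale_def sum_distrib_left)

lemma subspace_tensor_cycles: "module.subspace kscale (tensor_cycles e P i j N)"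
proof -
  note ms = module_kscale
  note s = module.subspace_0[OF ms subspace_tensor_part] module.subspace_add[OF ms subspace_tensor_part]
    module.subspace_scale[OF ms subspace_tensor_part]
  show ?thesis
  proof (rule module.subspaceI[OF ms])
    fix c u v assume "u \<in> tensor_cycles e P i j N"
    then show "kscale c u \<in> tensor_cycles e P i j N"
      using s(3)[of u i j c] by (auto simp: tensor_cycles_def tensor_diff_linear split: nat.splits)
         (simp add: kscale_def zero_fun_def)
  qed (use s(1,2) in \<open>auto simp: tensor_cycles_def tensor_diff_linear split: nat.splits\<close>)
qed

lemma subspace_tensor_boundaries: "module.subspace kscale (tensor_boundaries e P i j N)"
proof -
  note ms = module_kscale
  note s = module.subspace_0[OF ms subspace_tensor_part] module.subspace_add[OF ms subspace_tensor_part]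
    module.subspace_scale[OF ms subspace_tensor_part]
  show ?thesis
    unfolding tensor_boundaries_def
  proof (rule module.subspaceI[OF ms])
    show "0 \<in> tensor_diff fscale P i ` tensor_part e P (Suc i) j N"
      by (rule image_eqI[of _ _ 0]) (simp_all add: tensor_diff_linear s)
  next
    fix x y assume "x \<in> tensor_diff fscale P i ` tensor_part e P (Suc i) j N" "y \<in> tensor_diff fscale P i ` tensor_part e P (Suc i) j N"
    then obtain u v where "x = tensor_diff fscale P i u" "u \<in> tensor_part e P (Suc i) j N"
      "y = tensor_diff fscale P i v" "v \<in> tensor_part e P (Suc i) j N" by (elim imageE)
    then show "x + y \<in> tensor_diff fscale P i ` tensor_part e P (Suc i) j N"
      by (intro image_eqI[of _ _ "u + v"] s(2)) (simp_all add: tensor_diff_linear(2))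
  next
    fix c x assume "x \<in> tensor_diff fscale P i ` tensor_part e P (Suc i) j N"
    then obtain u where "x = tensor_diff fscale P i u" "u \<in> tensor_part e P (Suc i) j N" by (elim imageE)
    then show "kscale c x \<in> tensor_diff fscale P i ` tensor_part e P (Suc i) j N"
      by (intro image_eqI[of _ _ "kscale c u"] s(3)) (simp_all add: tensor_diff_linear(3))
  qed
qed

text \<open>
There are only finitely many monomials of a given degree, and those of the right degree, placed in
some entry and some coordinate, span.
\<close>

lemma tensor_part_finite_dim: "\<exists>X. finite X \<and> tensor_part e P i j N \<subseteq> module.span kscale X"
proof -
  note ms = module_kscale
  define unit :: "nat \<Rightarrow> 'f \<Rightarrow> ('x \<Rightarrow>\<^sub>0 nat) \<Rightarrow> nat \<Rightarrow> 'f \<Rightarrow> ('x, 'k) mpoly" where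
    "unit = (\<lambda>q b t p c. if p = q \<and> c = b then single t 1 else 0)"
  define X where "X = (\<Union>q\<in>{..<rnk P i}. \<Union>b\<in>UNIV. unit q b ` {t. mdeg t = j - shft P i q - e b})"
  have "finite X" unfolding X_def by (intro finite_UN_I finite_imageI finite_mdeg) auto
  moreover have "w \<in> module.span kscale X" if w: "w \<in> tensor_part e P i j N" for w
  proof -
    let ?s = "\<lambda>q b t. kscale (lookup (w q b) t) (unit q b t)"
    have "(\<Sum>q<rnk P i. \<Sum>b\<in>UNIV. \<Sum>t\<in>keys (w q b). ?s q b t) p c = w p c" for p c
    proof -
      have 1: "?s q b t p c = (if q = p then (if b = c then single t (lookup (w q b) t) else 0) else 0)" for q b t
        by (auto simp: kscale_def unit_def mult_single)
      have "(\<Sum>q<rnk P i. \<Sum>b\<in>UNIV. \<Sum>t\<in>keys (w q b). ?s q b t) p c =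
         (\<Sum>q<rnk P i. if q = p then (\<Sum>b\<in>UNIV. if b = c then w p c else 0) else 0)"
        unfolding sum_fun_apply 1
      proof (intro sum.cong refl)
        fix q
        have "(\<Sum>t\<in>keys (w q b). if b = c then single t (lookup (w q b) t) else 0)
            = (if b = c then w q c else 0)" for b
          by (cases "b = c") (simp_all flip: poly_sum_single)
        then show "(\<Sum>b\<in>UNIV. \<Sum>t\<in>keys (w q b). if q = p then
              (if b = c then single t (lookup (w q b) t) else 0) else 0)
            = (if q = p then (\<Sum>b\<in>UNIV. if b = c then w p c else 0) else 0)"
          by (cases "q = p") simp_all
      qed
      also have "\<dots> = w p c" using w by (auto simp: tensor_part_def tensor_term_def)
      finally show ?thesis .
    qed
    then have eq: "(\<Sum>q<rnk P i. \<Sum>b\<in>UNIV. \<Sum>t\<in>keys (w q b). ?s q b t) = w"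
      by (simp add: fun_eq_iff)
    have in_span: "?s q b t \<in> module.span kscale X" if "q < rnk P i" "t \<in> keys (w q b)" for q b t
    proof -
      have "mdeg t = j - shft P i q - e b"
        using w that by (auto simp: tensor_part_def free_part_def homogeneous_def)
      then have "unit q b t \<in> X" using that unfolding X_def by blast
      then show ?thesis by (intro module.span_scale[OF ms] module.span_base[OF ms])
    qed
    have "(\<Sum>q<rnk P i. \<Sum>b\<in>UNIV. \<Sum>t\<in>keys (w q b). ?s q b t) \<in> module.span kscale X"
      by (intro module.span_sum[OF ms] in_span) auto
    then show ?thesis unfolding eq .
  qed
  ultimately show ?thesis by blast
qed

lemma boundaries_subset_cycles:
  assumes res: "free_resolution I P" and I: "graded_ideal I"
  shows "tensor_boundaries e P i j N \<subseteq> tensor_cycles e P i j N"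
proof
  fix w assume "w \<in> tensor_boundaries e P i j N"
  then obtain y where y: "y \<in> tensor_part e P (Suc i) j N" "w = tensor_diff fscale P i y"
    by (auto simp: tensor_boundaries_def)
  have "w \<in> tensor_part e P i j N"
    unfolding y(2) tensor_diff_fscale by (rule flincomb_tensor_part[OF homogeneous_vec_diff_column[OF res I] N y(1)])
  moreover have "tensor_diff fscale P i' w = 0" if i: "i = Suc i'" for i'
  proof -
    have "tensor_diff fscale P i' w = flincomb (rnk P (Suc i)) (\<lambda>q. 0) y"
      unfolding y(2) tensor_diff_fscale flincomb_flincomb i using lincomb_diff_column_diff_column[OF res I]
      by (intro flincomb_cong) simp
    then show ?thesis by (simp add: flincomb_def lincomb_def zero_fun_def)
  qed
  ultimately show "w \<in> tensor_cycles e P i j N" by (auto simp: tensor_cycles_def split: nat.split)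
qed

end

text \<open>
Exactness of \<open>\<Lambda>\<^bsup>i+1\<^esup> \<otimes> A \<rightarrow> \<Lambda>\<^sup>i \<otimes> B \<rightarrow> \<Lambda>\<^bsup>i-1\<^esup> \<otimes> F\<close> in the middle, where \<open>F\<close> is the free module.
\<close>

definition koszul_exact_at ::
  "nat \<Rightarrow> ('f \<Rightarrow> ('x::finite, 'k::field_char_0) mpoly) set \<Rightarrow> ('f \<Rightarrow> ('x, 'k) mpoly) set \<Rightarrow> bool" where
  "koszul_exact_at i A B \<longleftrightarrow> (\<forall>W :: 'x set \<Rightarrow> 'f \<Rightarrow> ('x, 'k) mpoly.
     alt_degree i W \<longrightarrow> (\<forall>T. W T \<in> B) \<longrightarrow> (\<forall>T b. koszul (\<lambda>U. W U b) T = 0) \<longrightarrow>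
     (\<exists>V. alt_degree (Suc i) V \<and> (\<forall>T. V T \<in> A) \<and> (\<forall>T b. koszul (\<lambda>U. V U b) T = W T b)))"

lemma spread_apply: "spread i (\<lambda>q. w q b) T = spread i w T b"
  unfolding spread_def sum_fun_apply by (intro sum.cong) auto

lemma tensor_diff_fscale_koszul:
  fixes w :: "nat \<Rightarrow> 'f \<Rightarrow> ('x::finite, 'k::field_char_0) mpoly"
  shows "tensor_diff fscale koszul_complex i w p b = gather i (koszul (\<lambda>T. spread (Suc i) w T b)) p"
  unfolding tensor_diff_fscale flincomb_def tensor_diff_lincomb[symmetric] tensor_diff_koszul
  by (simp add: spread_apply[symmetric])

lemma gather_in_tensor_part:
  fixes W :: "'x::finite set \<Rightarrow> 'f::finite \<Rightarrow> ('x, 'k::field_char_0) mpoly"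
  assumes "\<And>T. W T \<in> N \<inter> free_part e (j - int i)"
  shows "gather i W \<in> tensor_part e koszul_complex i j N"
  using assms by (auto simp: tensor_part_def tensor_term_def gather_def)

lemma spread_in_part:
  fixes w :: "nat \<Rightarrow> 'f::finite \<Rightarrow> ('x::finite, 'k::field_char_0) mpoly"
  assumes N: "graded_submodule e N" and w: "w \<in> tensor_part e koszul_complex i j N"
  shows "spread i w (T :: 'x set) \<in> N \<inter> free_part e (j - int i)"
proof (cases "card T = i")
  case True
  then obtain q where "q < subset_count TYPE('x) i" "T = nth_subset i q" by (rule nth_subset_surj)
  then show ?thesis using w by (simp add: spread_nth_subset tensor_part_def tensor_term_def)
next
  case False
  then have "spread i w T = 0" using alt_degree_spread[of i w, where ?'x = 'x] by (simp add: alt_degree_def)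
  then show ?thesis using graded_submoduleD(1)[OF N] by (simp add: free_part_def)
qed

text \<open>
The chosen resolution may be exchanged for the Koszul complex by \<open>tor_vanishing_independent\<close>. Its
\<open>i\<close>-th basis elements have degree \<open>i\<close>, so cycles of degree \<open>i + l\<close> have coefficients of degree \<open>l\<close>.
\<close>

theorem betti_eq_0_iff:
  fixes e :: "'f::finite \<Rightarrow> int" and N :: "('f \<Rightarrow> ('x::finite, 'k::field_char_0) mpoly) set"
  assumes N: "graded_submodule e N"
  shows "betti e i (int i + l) N = 0 \<longleftrightarrow> koszul_exact_at i (N \<inter> free_part e (l - 1)) (N \<inter> free_part e l)"
proof -
  let ?K = "koszul_complex :: ('x, 'k) free_complex"
  define P where "P = (SOME P :: ('x, 'k) free_complex. free_resolution max_ideal P)"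
  define j where "j = int i + l"
  have P: "free_resolution max_ideal P" unfolding P_def by (rule someI) (rule koszul_free_resolution)
  obtain X where X: "finite X" "tensor_part e P i j N \<subseteq> module.span kscale X"
    using tensor_part_finite_dim[OF N] by blast
  have "tensor_cycles e P i j N \<subseteq> module.span kscale X"
    using X(2) by (auto simp: tensor_cycles_def)
  then have "betti e i j N = 0 \<longleftrightarrow> tensor_cycles e P i j N \<subseteq> tensor_boundaries e P i j N"
    unfolding betti_def tor_dim_def Let_def P_def[symmetric]
    by (intro vector_space.dim_diff_eq_0_iff[OF vector_space_kscale, where X = X] X(1)
      subspace_tensor_cycles subspace_tensor_boundaries boundaries_subset_cycles[OF N P graded_max_ideal] N)
  also have "\<dots> \<longleftrightarrow> tensor_cycles e ?K i j N \<subseteq> tensor_boundaries e ?K i j N"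
    using tor_vanishing_independent[OF graded_max_ideal P koszul_free_resolution N]
      tor_vanishing_independent[OF graded_max_ideal koszul_free_resolution P N] by blast
  also have "\<dots> \<longleftrightarrow> koszul_exact_at i (N \<inter> free_part e (l - 1)) (N \<inter> free_part e l)"
  proof
    assume sub: "tensor_cycles e ?K i j N \<subseteq> tensor_boundaries e ?K i j N"
    show "koszul_exact_at i (N \<inter> free_part e (l - 1)) (N \<inter> free_part e l)"
      unfolding koszul_exact_at_def
    proof (intro allI impI)
      fix W :: "'x set \<Rightarrow> 'f \<Rightarrow> ('x, 'k) mpoly"
      assume W: "alt_degree i W" "\<forall>T. W T \<in> N \<inter> free_part e l" "\<forall>T b. koszul (\<lambda>U. W U b) T = 0"
      have "gather i W \<in> tensor_part e ?K i j N"
        using W(2) by (intro gather_in_tensor_part) (simp add: j_def)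
      moreover have "tensor_diff fscale ?K i' (gather i W) = 0" if "i = Suc i'" for i'
        unfolding fun_eq_iff tensor_diff_fscale_koszul using W(3) spread_gather[OF W(1)] that
        by (simp add: gather_def)
      ultimately have "gather i W \<in> tensor_cycles e ?K i j N"
        by (auto simp: tensor_cycles_def split: nat.split)
      with sub obtain y where y: "y \<in> tensor_part e ?K (Suc i) j N" "gather i W = tensor_diff fscale ?K i y"
        by (auto simp: tensor_boundaries_def)
      define V :: "'x set \<Rightarrow> 'f \<Rightarrow> ('x, 'k) mpoly" where "V = spread (Suc i) y"
      have aV: "alt_degree (Suc i) V" unfolding V_def by (rule alt_degree_spread)
      have "koszul (\<lambda>U. V U b) T = W T b" for T b
      proof (cases "card T = i")
        case True
        then obtain q where q: "q < subset_count TYPE('x) i" "T = nth_subset i q" by (rule nth_subset_surj)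
        have "gather i W q b = tensor_diff fscale ?K i y q b" unfolding y(2) ..
        then show ?thesis using q unfolding tensor_diff_fscale_koszul V_def by (simp add: gather_def)
      next
        case False
        have "alt_degree i (koszul (\<lambda>U. V U b))"
          using aV by (intro alt_degree_koszul) (simp add: alt_degree_def)
        then show ?thesis using False W(1) by (simp add: alt_degree_def)
      qed
      moreover have "V T \<in> N \<inter> free_part e (l - 1)" for T
        using spread_in_part[OF N y(1), of T] by (simp add: V_def j_def)
      ultimately show "\<exists>V. alt_degree (Suc i) V \<and> (\<forall>T. V T \<in> N \<inter> free_part e (l - 1)) \<and> (\<forall>T b. koszul (\<lambda>U. V U b) T = W T b)"
        using aV by blast
    qed
  next
    assume ex: "koszul_exact_at i (N \<inter> free_part e (l - 1)) (N \<inter> free_part e l)"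
    show "tensor_cycles e ?K i j N \<subseteq> tensor_boundaries e ?K i j N"
    proof
      fix w assume w: "w \<in> tensor_cycles e ?K i j N"
      then have wp: "w \<in> tensor_part e ?K i j N" by (simp add: tensor_cycles_def)
      define W :: "'x set \<Rightarrow> 'f \<Rightarrow> ('x, 'k) mpoly" where "W = spread i w"
      have aW: "alt_degree i W" unfolding W_def by (rule alt_degree_spread)
      have "koszul (\<lambda>U. W U b) T = 0" for b T
      proof (cases i)
        case 0
        then show ?thesis using aW by (intro koszul_alt_degree_0) (simp add: alt_degree_def)
      next
        case (Suc i')
        have alt: "alt_degree i' (koszul (\<lambda>U. W U b))"
          using aW Suc by (intro alt_degree_koszul) (simp add: alt_degree_def)
        have "gather i' (koszul (\<lambda>U. W U b)) = (\<lambda>_. 0)"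
          using w Suc by (simp add: tensor_cycles_def fun_eq_iff tensor_diff_fscale_koszul W_def)
        then show ?thesis using gather_eq_0_iff[OF alt] by blast
      qed
      moreover have "W T \<in> N \<inter> free_part e l" for T
        using spread_in_part[OF N wp, of T] by (simp add: W_def j_def)
      ultimately obtain V where V: "alt_degree (Suc i) V" "\<And>T. V T \<in> N \<inter> free_part e (l - 1)"
          "\<And>T b. koszul (\<lambda>U. V U b) T = W T b"
        using ex aW unfolding koszul_exact_at_def by metis
      have "gather (Suc i) V \<in> tensor_part e ?K (Suc i) j N"
        using V(2) by (intro gather_in_tensor_part) (simp add: j_def)
      moreover have "tensor_diff fscale ?K i (gather (Suc i) V) = w"
      proof (intro ext)
        fix p b
        have "tensor_diff fscale ?K i (gather (Suc i) V) p b = gather i (\<lambda>T. W T b) p"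
          unfolding tensor_diff_fscale_koszul spread_gather[OF V(1)] by (simp add: gather_def V(3))
        also have "\<dots> = w p b"
          using wp by (auto simp: gather_def W_def spread_nth_subset tensor_part_def tensor_term_def)
        finally show "tensor_diff fscale ?K i (gather (Suc i) V) p b = w p b" .
      qed
      ultimately show "w \<in> tensor_boundaries e ?K i j N" unfolding tensor_boundaries_def by blast
    qed
  qed
  finally show ?thesis unfolding j_def .
qed

section \<open>Homogeneous pieces and multiplication by the variables\<close>

text \<open>
Subspaces over the coefficient field. They are closed under multiplication by constants only, as
homogeneous pieces are.
\<close>

definition ksubspace :: "('f \<Rightarrow> ('x, 'k::field) mpoly) set \<Rightarrow> bool" where
  "ksubspace A \<longleftrightarrow> 0 \<in> A \<and> (\<forall>u\<in>A. \<forall>v\<in>A. u + v \<in> A) \<and>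
     (\<forall>c. \<forall>u\<in>A. fscale (single 0 c) u \<in> A)"

definition vars_mult :: "('f \<Rightarrow> ('x::finite, 'k::field) mpoly) set \<Rightarrow> ('f \<Rightarrow> ('x, 'k) mpoly) set" where
  "vars_mult A = {(\<Sum>x\<in>UNIV. fscale (Var x) (v x)) | v. \<forall>x. v x \<in> A}"

abbreviation piece :: "('f \<Rightarrow> int) \<Rightarrow> ('f \<Rightarrow> ('x::finite, 'k::field) mpoly) set \<Rightarrow> int \<Rightarrow> ('f \<Rightarrow> ('x, 'k) mpoly) set" where
  "piece e N d \<equiv> N \<inter> free_part e d"

lemma ksubspaceD:
  assumes "ksubspace A"
  shows "0 \<in> A" "u \<in> A \<Longrightarrow> v \<in> A \<Longrightarrow> u + v \<in> A" "u \<in> A \<Longrightarrow> fscale (single 0 c) u \<in> A"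
    "u \<in> A \<Longrightarrow> - u \<in> A" "(\<And>i. i \<in> J \<Longrightarrow> f i \<in> A) \<Longrightarrow> sum f J \<in> A"
proof -
  show 1: "0 \<in> A" "u \<in> A \<Longrightarrow> v \<in> A \<Longrightarrow> u + v \<in> A" "u \<in> A \<Longrightarrow> fscale (single 0 c) u \<in> A" for u v c
    using assms by (simp_all add: ksubspace_def)
  have "fscale (single 0 (- 1)) u = - u"
    by (simp add: fscale_def single_uminus fun_eq_iff)
  then show "u \<in> A \<Longrightarrow> - u \<in> A" using 1(3)[of u "- 1"] by simp
  show "(\<And>i. i \<in> J \<Longrightarrow> f i \<in> A) \<Longrightarrow> sum f J \<in> A"
    by (induction J rule: infinite_finite_induct) (auto intro: 1)
qed

lemma vars_multI: "(\<And>x. v x \<in> A) \<Longrightarrow> (\<Sum>x\<in>UNIV. fscale (Var x) (v x)) \<in> vars_mult A"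
  unfolding vars_mult_def by blast

lemma vars_multE:
  assumes "u \<in> vars_mult A"
  obtains v where "u = (\<Sum>x\<in>UNIV. fscale (Var x) (v x))" "\<And>x. v x \<in> A"
  using assms unfolding vars_mult_def by blast

lemma vars_mult_mono: "A \<subseteq> B \<Longrightarrow> vars_mult A \<subseteq> vars_mult B"
  unfolding vars_mult_def by blast

lemma fscale_zero [simp]: "fscale p 0 = 0" "fscale 0 v = 0"
  by (auto simp: fscale_def)

lemma fscale_add: "fscale p (u + v) = fscale p u + fscale p v"
  by (auto simp: fscale_def algebra_simps)

lemma fscale_fscale: "fscale p (fscale q v) = fscale (p * q) v"
  by (simp add: fscale_def algebra_simps)

lemma fscale_commute: "fscale p (fscale q v) = fscale q (fscale p v)"
  by (simp add: fscale_def algebra_simps)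

lemma Var_in_vars_mult: "0 \<in> A \<Longrightarrow> u \<in> A \<Longrightarrow> fscale (Var x) u \<in> vars_mult A"
proof -
  assume a: "0 \<in> A" "u \<in> A"
  have "(\<Sum>y\<in>UNIV. fscale (Var y) (if y = x then u else 0)) = (\<Sum>y\<in>UNIV. if y = x then fscale (Var x) u else 0)"
    by (intro sum.cong) auto
  then have "(\<Sum>y\<in>UNIV. fscale (Var y) (if y = x then u else 0)) = fscale (Var x) u" by simp
  moreover have "(\<Sum>y\<in>UNIV. fscale (Var y) (if y = x then u else 0)) \<in> vars_mult A"
    using a by (intro vars_multI) auto
  ultimately show ?thesis by (simp only:)
qed

lemma vars_mult_add: "(\<And>u v. u \<in> A \<Longrightarrow> v \<in> A \<Longrightarrow> u + v \<in> A) \<Longrightarrow>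
    u \<in> vars_mult A \<Longrightarrow> v \<in> vars_mult A \<Longrightarrow> u + v \<in> vars_mult A"
proof (elim vars_multE)
  fix f g assume add: "\<And>u v. u \<in> A \<Longrightarrow> v \<in> A \<Longrightarrow> u + v \<in> A"
    and f: "u = (\<Sum>x\<in>UNIV. fscale (Var x) (f x))" "\<And>x. f x \<in> A"
    and g: "v = (\<Sum>x\<in>UNIV. fscale (Var x) (g x))" "\<And>x. g x \<in> A"
  have "u + v = (\<Sum>x\<in>UNIV. fscale (Var x) (f x + g x))"
    by (simp add: f g fscale_add sum.distrib)
  then show ?thesis using add f(2) g(2) by (auto intro: vars_multI)
qed

lemma vars_mult_scale: "(\<And>u. u \<in> A \<Longrightarrow> fscale p u \<in> A) \<Longrightarrow>
    u \<in> vars_mult A \<Longrightarrow> fscale p u \<in> vars_mult A"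
proof (elim vars_multE)
  fix f assume s: "\<And>u. u \<in> A \<Longrightarrow> fscale p u \<in> A"
    and f: "u = (\<Sum>x\<in>UNIV. fscale (Var x) (f x))" "\<And>x. f x \<in> A"
  have "fscale p u = (\<Sum>x\<in>UNIV. fscale (Var x) (fscale p (f x)))"
    by (simp add: f fscale_sum_right fscale_commute[of p])
  then show ?thesis using s f(2) by (auto intro: vars_multI)
qed

lemma ksubspace_vars_mult: "ksubspace A \<Longrightarrow> ksubspace (vars_mult A)"
  unfolding ksubspace_def[of "vars_mult A"]
proof (intro conjI ballI allI)
  assume A: "ksubspace A"
  show "0 \<in> vars_mult A" using Var_in_vars_mult[of A 0 undefined] ksubspaceD[OF A] by simp
qed (auto intro: vars_mult_add vars_mult_scale ksubspaceD)

lemma ksubspace_vars_mult_pow: "ksubspace A \<Longrightarrow> ksubspace ((vars_mult ^^ r) A)"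
  by (induction r) (auto intro: ksubspace_vars_mult)

lemma vars_mult_pow_mono: "A \<subseteq> B \<Longrightarrow> (vars_mult ^^ r) A \<subseteq> (vars_mult ^^ r) B"
  by (induction r) (auto dest: vars_mult_mono)

lemma vars_mult_pow_Suc: "(vars_mult ^^ Suc r) A = (vars_mult ^^ r) (vars_mult A)"
  by (simp add: funpow_swap1)

lemma ksubspace_graded_submodule: "graded_submodule e N \<Longrightarrow> ksubspace N"
  unfolding ksubspace_def using graded_submoduleD[of e N] by blast

lemma free_part_closed:
  "0 \<in> free_part e d" "u \<in> free_part e d \<Longrightarrow> v \<in> free_part e d \<Longrightarrow> u + v \<in> free_part e d"
  "u \<in> free_part e d \<Longrightarrow> v \<in> free_part e d \<Longrightarrow> u - v \<in> free_part e d"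
  "homogeneous c p \<Longrightarrow> u \<in> free_part e d \<Longrightarrow> fscale p u \<in> free_part e (c + d)"
  using homogeneous_mult[of c p] by (auto simp: free_part_def fscale_def intro: homogeneous_add homogeneous_diff)
     (metis add_diff_eq)

lemma free_part_sum: "(\<And>i. i \<in> J \<Longrightarrow> f i \<in> free_part e d) \<Longrightarrow> sum f J \<in> free_part e d"
  by (induction J rule: infinite_finite_induct) (auto intro: free_part_closed)

lemma free_part_const: "u \<in> free_part e d \<Longrightarrow> fscale (single 0 c) u \<in> free_part e d"
  using free_part_closed(4)[OF homogeneous_single[of 0 0 c]] by simp

lemma ksubspace_piece: "graded_submodule e N \<Longrightarrow> ksubspace (piece e N d)"
  unfolding ksubspace_def using graded_submoduleD[of e N] by (auto intro: free_part_closed free_part_const)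

definition hpart :: "('f \<Rightarrow> int) \<Rightarrow> int \<Rightarrow> ('f \<Rightarrow> ('x::finite, 'k::field) mpoly) \<Rightarrow> ('f \<Rightarrow> ('x, 'k) mpoly)" where
  "hpart e d u = (\<lambda>b. hcomp (d - e b) (u b))"

lemma hpart_free_part: "hpart e d u \<in> free_part e d"
  by (simp add: hpart_def free_part_def homogeneous_hcomp)

lemma hpart_id: "u \<in> free_part e d \<Longrightarrow> hpart e j u = (if j = d then u else 0)"
proof (rule ext)
  fix b assume "u \<in> free_part e d"
  then have "hcomp (j - e b) (u b) = (if j - e b = d - e b then u b else 0)"
    by (intro hcomp_homogeneous) (simp add: free_part_def)
  then show "hpart e j u b = (if j = d then u else 0) b" by (simp add: hpart_def)
qed

lemma hpart_in: "graded_submodule e N \<Longrightarrow> u \<in> N \<Longrightarrow> hpart e d u \<in> piece e N d"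
  using hpart_free_part graded_submoduleD(6) unfolding hpart_def by blast

lemma hpart_sum: "hpart e d (sum f J) = (\<Sum>i\<in>J. hpart e d (f i))"
  by (simp add: hpart_def fun_eq_iff sum_fun_apply hcomp_sum)

lemma hpart_fscale_homogeneous: "homogeneous c p \<Longrightarrow> hpart e d (fscale p u) = fscale p (hpart e (d - c) u)"
  by (simp add: hpart_def fscale_def fun_eq_iff hcomp_homogeneous_mult algebra_simps)

lemma hpart_fscale_free: "u \<in> free_part e c \<Longrightarrow> hpart e d (fscale p u) = fscale (hcomp (d - c) p) u"
proof (rule ext)
  fix b assume "u \<in> free_part e c"
  then have "hcomp (d - e b) (u b * p) = u b * hcomp (d - e b - (c - e b)) p"
    by (intro hcomp_homogeneous_mult) (simp add: free_part_def)
  then show "hpart e d (fscale p u) b = fscale (hcomp (d - c) p) u b"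
    by (simp add: hpart_def fscale_def mult.commute)
qed

lemma subspace_vars_mult: "module.subspace fscale N \<Longrightarrow> module.subspace fscale (vars_mult N)"
proof -
  assume s: "module.subspace fscale N"
  note m = module.subspace_0[OF module_fscale s] module.subspace_add[OF module_fscale s] module.subspace_scale[OF module_fscale s]
  show ?thesis
  proof (rule module.subspaceI[OF module_fscale])
    show "0 \<in> vars_mult N" using Var_in_vars_mult[of N 0 undefined] m(1) by simp
  qed (auto intro: vars_mult_add vars_mult_scale m)
qed

lemma graded_vars_mult:
  assumes N: "graded_submodule e N" shows "graded_submodule e (vars_mult N)"
  unfolding graded_submodule_def
proof (intro conjI ballI allI)
  show "module.subspace fscale (vars_mult N)"
    using N by (intro subspace_vars_mult) (simp add: graded_submodule_def)
  fix u d assume "u \<in> vars_mult N"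
  then obtain v where v: "u = (\<Sum>x\<in>UNIV. fscale (Var x) (v x))" "\<And>x. v x \<in> N" unfolding vars_mult_def by blast
  have "hpart e d u = (\<Sum>x\<in>UNIV. fscale (Var x) (hpart e (d - 1) (v x)))"
    unfolding v(1) hpart_sum hpart_fscale_homogeneous[OF homogeneous_Var] ..
  also have "\<dots> \<in> vars_mult N" using hpart_in[OF N v(2)] by (intro vars_multI) blast
  finally show "(\<lambda>b. hcomp (d - e b) (u b)) \<in> vars_mult N" by (simp add: hpart_def)
qed

lemma vars_mult_free_part: "A \<subseteq> free_part e d \<Longrightarrow> vars_mult A \<subseteq> free_part e (d + 1)"
proof
  fix u assume A: "A \<subseteq> free_part e d" and "u \<in> vars_mult A"
  then obtain v where v: "u = (\<Sum>x\<in>UNIV. fscale (Var x) (v x))" "\<And>x. v x \<in> A" unfolding vars_mult_def by blast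
  have "fscale (Var x) (v x) \<in> free_part e (1 + d)" for x
    using A v(2)[of x] by (intro free_part_closed(4)[OF homogeneous_Var]) auto
  then show "u \<in> free_part e (d + 1)" unfolding v(1) by (intro free_part_sum) (simp add: add.commute[of d])
qed

lemma piece_vars_mult:
  assumes N: "graded_submodule e N"
  shows "piece e (vars_mult N) (d + 1) = vars_mult (piece e N d)"
proof
  show "vars_mult (piece e N d) \<subseteq> piece e (vars_mult N) (d + 1)"
    using vars_mult_free_part[of "piece e N d" e d] vars_mult_mono[of "piece e N d" N] by auto
  show "piece e (vars_mult N) (d + 1) \<subseteq> vars_mult (piece e N d)"
  proof
    fix u assume u: "u \<in> piece e (vars_mult N) (d + 1)"
    then obtain v where v: "u = (\<Sum>x\<in>UNIV. fscale (Var x) (v x))" "\<And>x. v x \<in> N" unfolding vars_mult_def by blast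
    have "u = hpart e (d + 1) u" using u hpart_id[of u e "d + 1" "d + 1"] by simp
    also have "\<dots> = (\<Sum>x\<in>UNIV. fscale (Var x) (hpart e d (v x)))"
      unfolding v(1) hpart_sum hpart_fscale_homogeneous[OF homogeneous_Var] by simp
    also have "\<dots> \<in> vars_mult (piece e N d)" using hpart_in[OF N v(2)] by (intro vars_multI)
    finally show "u \<in> vars_mult (piece e N d)" .
  qed
qed

lemma vars_mult_piece_subset:
  assumes N: "graded_submodule e N"
  shows "vars_mult (piece e N (l - 1)) \<subseteq> piece e N l"
proof -
  have "vars_mult N \<subseteq> N"
    by (auto elim!: vars_multE intro!: graded_submoduleD(5)[OF N] graded_submoduleD(4)[OF N])
  then have "vars_mult (piece e N (l - 1)) \<subseteq> N" using vars_mult_mono[of "piece e N (l - 1)" N] by blast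
  moreover have "vars_mult (piece e N (l - 1)) \<subseteq> free_part e (l - 1 + 1)" by (rule vars_mult_free_part) blast
  ultimately show ?thesis by simp
qed

lemma power_mult_0: "graded_submodule e M \<Longrightarrow> power_mult 0 M = M"
proof -
  assume M: "graded_submodule e M"
  then have s: "module.subspace fscale M" by (simp add: graded_submodule_def)
  have "{fscale a v |a v. a \<in> UNIV \<and> v \<in> M} = M"
  proof
    show "M \<subseteq> {fscale a v |a v. a \<in> UNIV \<and> v \<in> M}"
    proof
      fix v assume "v \<in> M"
      moreover have "v = fscale 1 v" by (simp add: fscale_def)
      ultimately show "v \<in> {fscale a v |a v. a \<in> UNIV \<and> v \<in> M}" by blast
    qed
  qed (auto intro: graded_submoduleD(4)[OF M])
  then show ?thesis unfolding power_mult_def ideal_mult_def max_ideal_power_def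
    using module.span_eq_iff[OF module_fscale, of M] s by simp
qed

text \<open>
Both inclusions are checked on generators of the spans, first for the ideal power and then for the
module.
\<close>

lemma power_mult_Suc:
  fixes M :: "('f \<Rightarrow> ('x::finite, 'k::field) mpoly) set"
  shows "power_mult (Suc k) M = vars_mult (power_mult k M)"
proof
  let ?G = "\<lambda>k. {fscale a v |a v. a \<in> max_ideal_power k \<and> v \<in> M}"
  note sp = module.span_superset[OF module_fscale] module.span_minimal[OF module_fscale]
    module.span_sum[OF module_fscale] module.subspace_span[OF module_fscale]
  have pm: "power_mult k M = module.span fscale (?G k)" for k
    by (simp add: power_mult_def ideal_mult_def)
  have mp: "(max_ideal_power (Suc k) :: ('x, 'k) mpoly set) = module.span (*) {a * b |a b. a \<in> max_ideal \<and> b \<in> max_ideal_power k}"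
    by (simp add: max_ideal_power_def ideal_mult_def)
  have sub: "module.subspace fscale (power_mult k M)" unfolding pm by (rule sp(4))
  note S = module.subspace_0[OF module_fscale sub]
  have subv: "module.subspace fscale (vars_mult (power_mult k M))"
    by (rule subspace_vars_mult[OF sub])
  note V = module.subspace_0[OF module_fscale subv] module.subspace_add[OF module_fscale subv] module.subspace_scale[OF module_fscale subv]
  have lincl: "module.subspace (*) {c. fscale (c * p) v \<in> vars_mult (power_mult k M)}" for p :: "('x, 'k) mpoly" and v :: "'f \<Rightarrow> ('x, 'k) mpoly"
  proof (rule module.subspaceI[OF module_mult])
    fix x y :: "('x, 'k) mpoly" assume "x \<in> {c. fscale (c * p) v \<in> vars_mult (power_mult k M)}" "y \<in> {c. fscale (c * p) v \<in> vars_mult (power_mult k M)}"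
    moreover have "fscale ((x + y) * p) v = fscale (x * p) v + fscale (y * p) v"
      by (auto simp: fscale_def algebra_simps)
    ultimately show "x + y \<in> {c. fscale (c * p) v \<in> vars_mult (power_mult k M)}" using V(2) by simp
  next
    fix a x :: "('x, 'k) mpoly" assume "x \<in> {c. fscale (c * p) v \<in> vars_mult (power_mult k M)}"
    moreover have "fscale (a * x * p) v = fscale a (fscale (x * p) v)"
      by (simp add: fscale_fscale mult.assoc)
    ultimately show "a * x \<in> {c. fscale (c * p) v \<in> vars_mult (power_mult k M)}" using V(3) by simp
  qed (use V(1) in simp)
  show "power_mult (Suc k) M \<subseteq> vars_mult (power_mult k M)"
    unfolding pm[of "Suc k"]
  proof (rule sp(2)[OF _ subv], rule subsetI)
    fix w assume "w \<in> ?G (Suc k)"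
    then obtain c v where w: "w = fscale c v" and c: "c \<in> max_ideal_power (Suc k)" and v: "v \<in> M"
      by blast
    have "fscale (a * b) v \<in> vars_mult (power_mult k M)" if "a \<in> max_ideal" "b \<in> max_ideal_power k" for a b :: "('x, 'k) mpoly"
    proof -
      have "range Var \<subseteq> {c. fscale (c * b) v \<in> vars_mult (power_mult k M)}"
      proof (rule image_subsetI, rule CollectI)
        fix x
        have "fscale b v \<in> power_mult k M" unfolding pm using v that(2) by (intro module.span_base[OF module_fscale]) blast
        then show "fscale (Var x * b) v \<in> vars_mult (power_mult k M)"
          using Var_in_vars_mult[OF S, of "fscale b v" x] by (simp add: fscale_fscale)
      qed
      from module.span_minimal[OF module_mult this lincl] have "a \<in> {c. fscale (c * b) v \<in> vars_mult (power_mult k M)}"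
        using that(1) unfolding max_ideal_def by (rule subsetD)
      then show ?thesis by simp
    qed
    then have "{a * b |a b. a \<in> max_ideal \<and> b \<in> max_ideal_power k} \<subseteq> {c. fscale (c * 1) v \<in> vars_mult (power_mult k M)}"
      by auto
    from module.span_minimal[OF module_mult this lincl] have "c \<in> {c. fscale (c * 1) v \<in> vars_mult (power_mult k M)}"
      using c unfolding mp by (rule subsetD)
    then show "w \<in> vars_mult (power_mult k M)" by (simp add: w)
  qed
  have "fscale (Var x) u \<in> power_mult (Suc k) M" if u: "u \<in> power_mult k M" for x :: 'x and u
  proof -
    have "?G k \<subseteq> {u. fscale (Var x) u \<in> power_mult (Suc k) M}"
    proof (rule subsetI)
      fix w assume "w \<in> ?G k"
      then obtain a v where w: "w = fscale a v" and av: "a \<in> max_ideal_power k" "v \<in> M" by blast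
      have "Var x \<in> max_ideal" unfolding max_ideal_def by (intro module.span_base[OF module_mult]) blast
      then have "Var x * a \<in> max_ideal_power (Suc k)"
        unfolding mp using av(1) by (intro module.span_base[OF module_mult]) blast
      then have "fscale (Var x) w \<in> power_mult (Suc k) M"
        unfolding pm w fscale_fscale using av(2) by (intro module.span_base[OF module_fscale]) blast
      then show "w \<in> {u. fscale (Var x) u \<in> power_mult (Suc k) M}" by simp
    qed
    moreover have "module.subspace fscale {u. fscale (Var x) u \<in> power_mult (Suc k) M}"
    proof -
      have s: "module.subspace fscale (power_mult (Suc k) M)" unfolding pm by (rule sp(4))
      note m = module.subspace_0[OF module_fscale s] module.subspace_add[OF module_fscale s] module.subspace_scale[OF module_fscale s]
      show ?thesis
        by (rule module.subspaceI[OF module_fscale])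
           (auto simp: fscale_add fscale_commute[of "Var x"] intro: m)
    qed
    ultimately have "power_mult k M \<subseteq> {u. fscale (Var x) u \<in> power_mult (Suc k) M}"
      unfolding pm[of k] by (rule sp(2))
    then show ?thesis using u by blast
  qed
  moreover have "module.subspace fscale (power_mult (Suc k) M)" unfolding pm by (rule sp(4))
  ultimately show "vars_mult (power_mult k M) \<subseteq> power_mult (Suc k) M"
    by (auto elim!: vars_multE intro!: module.subspace_sum[OF module_fscale])
qed

lemma graded_power_mult: "graded_submodule e M \<Longrightarrow> graded_submodule e (power_mult k M)"
  by (induction k) (auto simp: power_mult_0 power_mult_Suc intro: graded_vars_mult)

lemma piece_power_mult_Suc:
  assumes "graded_submodule e M"
  shows "piece e (power_mult (Suc k) M) d = vars_mult (piece e (power_mult k M) (d - 1))"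
  using piece_vars_mult[OF graded_power_mult[OF assms], of k "d - 1"] by (simp add: power_mult_Suc)

lemma piece_power_mult:
  assumes "graded_submodule e M"
  shows "piece e (power_mult k M) d = (vars_mult ^^ k) (piece e M (d - int k))"
  by (induction k arbitrary: d) (auto simp: power_mult_0[OF assms] piece_power_mult_Suc[OF assms] algebra_simps)

text \<open>
A monomial of degree \<open>r\<close> is a product of \<open>r\<close> variables.
\<close>

lemma homogeneous_fscale_in_pow:
  assumes A: "ksubspace A" and p: "homogeneous (int r) p" and u: "u \<in> A"
  shows "fscale p u \<in> (vars_mult ^^ r) A"
proof -
  have single: "fscale (single t c) u \<in> (vars_mult ^^ r) A" if "mdeg t = int r" for t c r
    using that
  proof (induction r arbitrary: t)
    case 0
    then have "t = 0" by (simp add: mdeg_eq_0_iff)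
    then show ?case using ksubspaceD(3)[OF A u] by simp
  next
    case (Suc r)
    then have "t \<noteq> 0" by auto
    then obtain x s where s: "t = single x 1 + s" by (rule monomial_split)
    have "mdeg s = int r" using Suc.prems by (simp add: s mdeg_add mdeg_single)
    from Suc.IH[OF this] have "fscale (Var x) (fscale (single s c) u) \<in> (vars_mult ^^ Suc r) A"
      using Var_in_vars_mult[OF ksubspaceD(1)[OF ksubspace_vars_mult_pow[OF A, of r]]] by simp
    then show ?case by (simp add: fscale_fscale s Var_def mult_single)
  qed
  have "fscale p u = (\<Sum>t\<in>keys p. fscale (single t (lookup p t)) u)"
    by (subst poly_sum_single[of p]) (rule fscale_sum_left)
  also have "\<dots> \<in> (vars_mult ^^ r) A"
    using p by (intro ksubspaceD(5)[OF ksubspace_vars_mult_pow[OF A]] single) (auto simp: homogeneous_def)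
  finally show ?thesis .
qed

text \<open>
For \<open>u = \<Sum>\<^sub>a p\<^sub>a a\<close> with all \<open>a \<in> A\<close> of degree \<open>d\<close>, the component of degree \<open>j\<close> only involves the components
of degree \<open>j - d\<close> of the coefficients \<open>p\<^sub>a\<close>.
\<close>

lemma hpart_span:
  assumes A: "ksubspace A" "A \<subseteq> free_part e d" and u: "u \<in> module.span fscale A"
  shows "hpart e (d + int r) u \<in> (vars_mult ^^ r) A" and "j < d \<Longrightarrow> hpart e j u = 0"
proof -
  obtain F p where F: "finite F" "F \<subseteq> A" "u = (\<Sum>a\<in>F. fscale (p a) a)"
    using u unfolding module.span_explicit[OF module_fscale] by blast
  have eq: "hpart e j u = (\<Sum>a\<in>F. fscale (hcomp (j - d) (p a)) a)" for j
    unfolding F(3) hpart_sum using F(2) A(2) by (intro sum.cong refl hpart_fscale_free) auto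
  show "hpart e (d + int r) u \<in> (vars_mult ^^ r) A"
    unfolding eq using F(2) homogeneous_hcomp[of "int r"]
    by (intro ksubspaceD(5)[OF ksubspace_vars_mult_pow[OF A(1)]] homogeneous_fscale_in_pow[OF A(1)]) auto
  show "hpart e j u = 0" if "j < d"
    unfolding eq using that by (intro sum.neutral) (simp add: hcomp_negative_degree)
qed

lemma vars_mult_pow_subset_span:
  assumes "A \<subseteq> free_part e d"
  shows "(vars_mult ^^ r) A \<subseteq> module.span fscale A \<inter> free_part e (d + int r)"
proof (induction r)
  case 0 then show ?case using assms module.span_superset[OF module_fscale] by auto
next
  case (Suc r)
  have "vars_mult (module.span fscale A) \<subseteq> module.span fscale A"
    by (auto elim!: vars_multE intro!: module.span_sum[OF module_fscale] module.span_scale[OF module_fscale])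
  then have "(vars_mult ^^ Suc r) A \<subseteq> module.span fscale A"
    using Suc vars_mult_mono[of "(vars_mult ^^ r) A" "module.span fscale A"] by auto
  moreover have "(vars_mult ^^ Suc r) A \<subseteq> free_part e (d + int (Suc r))"
    using Suc vars_mult_free_part[of "(vars_mult ^^ r) A" e "d + int r"] by (simp add: algebra_simps)
  ultimately show ?case by blast
qed

lemma graded_span:
  assumes A: "ksubspace A" "A \<subseteq> free_part e d"
  shows "graded_submodule e (module.span fscale A)"
  unfolding graded_submodule_def
proof (intro conjI ballI allI)
  show "module.subspace fscale (module.span fscale A)" by (rule module.subspace_span[OF module_fscale])
  fix u j assume u: "u \<in> module.span fscale A"
  have "hpart e j u \<in> module.span fscale A"
  proof (cases "j < d")
    case True
    then show ?thesis using hpart_span(2)[OF A u True] module.span_zero[OF module_fscale] by simp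
  next
    case False
    then obtain r where "j = d + int r" by (metis not_less zle_iff_zadd)
    then show ?thesis using hpart_span(1)[OF A u, of r] vars_mult_pow_subset_span[OF A(2), of r] by auto
  qed
  then show "(\<lambda>b. hcomp (j - e b) (u b)) \<in> module.span fscale A" by (simp add: hpart_def)
qed

lemma piece_span:
  assumes A: "ksubspace A" "A \<subseteq> free_part e d"
  shows "piece e (module.span fscale A) (d + int r) = (vars_mult ^^ r) A"
    and "j < d \<Longrightarrow> piece e (module.span fscale A) j = {0}"
proof -
  have id: "hpart e j u = u" if "u \<in> piece e (module.span fscale A) j" for u j
    using hpart_id[of u e j j] that by simp
  show "piece e (module.span fscale A) (d + int r) = (vars_mult ^^ r) A"
    using vars_mult_pow_subset_span[OF A(2), of r] hpart_span(1)[OF A, of _ r] id[of _ "d + int r"] by fastforce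
  show "piece e (module.span fscale A) j = {0}" if "j < d"
    using hpart_span(2)[OF A _ that] id[of _ j] module.span_zero[OF module_fscale] free_part_closed(1) by fastforce
qed

section \<open>Exactness of the Koszul complex on homogeneous pieces\<close>

lemma koszul_exact_zero:
  fixes A :: "('f \<Rightarrow> ('x::finite, 'k::field_char_0) mpoly) set"
  assumes "0 \<in> A" shows "koszul_exact_at i A {0}"
  unfolding koszul_exact_at_def
proof (intro allI impI)
  fix W :: "'x set \<Rightarrow> 'f \<Rightarrow> ('x, 'k) mpoly"
  assume "\<forall>T. W T \<in> {0}"
  then show "\<exists>V. alt_degree (Suc i) V \<and> (\<forall>T. V T \<in> A) \<and> (\<forall>T b. koszul (\<lambda>U. V U b) T = W T b)"
    using assms by (intro exI[of _ "\<lambda>_. 0"]) (simp add: alt_degree_def koszul_0)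
qed

text \<open>
The pieces of the module generated by \<open>N\<^sub>d\<close> are \<open>S\<^sub>1\<^sup>r N\<^sub>d\<close> in degree \<open>d + r\<close> and zero below \<open>d\<close>, so the Betti
numbers off the row \<open>d\<close> are governed by consecutive powers of \<open>S\<^sub>1\<close>.
\<close>

lemma componentwise_linear_iff:
  fixes e :: "'f::finite \<Rightarrow> int" and N :: "('f \<Rightarrow> ('x::finite, 'k::field_char_0) mpoly) set"
  assumes N: "graded_submodule e N"
  shows "componentwise_linear e N \<longleftrightarrow>
    (\<forall>d i r. koszul_exact_at i ((vars_mult ^^ r) (piece e N d)) ((vars_mult ^^ Suc r) (piece e N d)))"
proof -
  have "linear_resolution e d (degree_generated e d N) \<longleftrightarrow>
    (\<forall>i r. koszul_exact_at i ((vars_mult ^^ r) (piece e N d)) ((vars_mult ^^ Suc r) (piece e N d)))" for d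
  proof -
    let ?A = "piece e N d" and ?D = "degree_generated e d N"
    have A: "ksubspace ?A" "?A \<subseteq> free_part e d" using ksubspace_piece[OF N] by auto
    have D: "?D = module.span fscale ?A" by (simp add: degree_generated_def)
    note b = betti_eq_0_iff[OF graded_span[OF A]]
    have 1: "betti e i (int i + (d + 1 + int r)) ?D = 0 \<longleftrightarrow> koszul_exact_at i ((vars_mult ^^ r) ?A) ((vars_mult ^^ Suc r) ?A)" for i r
      using b[of i "d + 1 + int r"] piece_span(1)[OF A, of r] piece_span(1)[OF A, of "Suc r"]
      by (simp add: D algebra_simps)
    have 2: "betti e i (int i + j) ?D = 0" if "j < d" for i j
    proof -
      have "koszul_exact_at i (piece e ?D (j - 1)) {0}"
        using that by (intro koszul_exact_zero) (simp add: D piece_span(2)[OF A])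
      then show ?thesis using b[of i j] piece_span(2)[OF A that] by (simp add: D)
    qed
    show ?thesis
      unfolding linear_resolution_def
    proof (intro iffI allI impI)
      fix i r assume "\<forall>i j. j \<noteq> d \<longrightarrow> betti e i (int i + j) ?D = 0"
      then show "koszul_exact_at i ((vars_mult ^^ r) ?A) ((vars_mult ^^ Suc r) ?A)"
        using 1[of i r] by auto
    next
      fix i j assume *: "\<forall>i r. koszul_exact_at i ((vars_mult ^^ r) ?A) ((vars_mult ^^ Suc r) ?A)" and "j \<noteq> d"
      then consider "j < d" | "d + 1 \<le> j" by linarith
      then show "betti e i (int i + j) ?D = 0"
      proof cases
        assume "d + 1 \<le> j"
        then obtain r where r: "j = d + 1 + int r" by (metis zle_iff_zadd)
        show ?thesis unfolding r 1 using * by blast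
      qed (rule 2)
    qed
  qed
  then show ?thesis unfolding componentwise_linear_def by simp
qed

lemma koszul_in_vars_mult:
  fixes V :: "'x::finite set \<Rightarrow> 'f \<Rightarrow> ('x, 'k::field_char_0) mpoly"
  assumes A: "ksubspace A" and V: "\<And>T. V T \<in> A"
  shows "(\<lambda>b. koszul (\<lambda>U. V U b) T) \<in> vars_mult A"
proof -
  have "(\<lambda>b. contract x (\<lambda>U. V U b) T) \<in> A" for x
    using ksign_cases[of T x, where ?'k = 'k] ksubspaceD(1,4)[OF A] V
    by (cases "x \<in> T") (auto simp: contract_def zero_fun_def fun_Compl_def)
  from vars_multI[of "\<lambda>x b. contract x (\<lambda>U. V U b) T", OF this]
  show ?thesis by (simp add: koszul_def fscale_def sum_fun_apply[abs_def])
qed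

text \<open>
Only \<open>e\<^sub>T\<close> contributes to the coefficient at \<open>T - {x}\<close>, provided that no other set of the same size carries a
coefficient.
\<close>

lemma koszul_point: "x \<in> T \<Longrightarrow> (\<And>U. card U = card T \<Longrightarrow> U \<noteq> T \<Longrightarrow> W U = 0) \<Longrightarrow>
   koszul W (T - {x}) = Var x * (ksign T x * W T)"
proof -
  assume x: "x \<in> T" and W: "\<And>U. card U = card T \<Longrightarrow> U \<noteq> T \<Longrightarrow> W U = 0"
  have "Var y * contract y W (T - {x}) = (if y = x then Var x * (ksign T x * W T) else 0)" for y
  proof (cases "y = x")
    case True
    then show ?thesis using x by (simp add: contract_def ksign_remove_same insert_absorb)
  next
    case False
    then have "insert y (T - {x}) \<noteq> T" using x by auto
    moreover have "y \<notin> T - {x} \<Longrightarrow> card (insert y (T - {x})) = card T"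
      using x card.remove[OF finite x] by simp
    ultimately show ?thesis using False W by (auto simp: contract_def)
  qed
  then show ?thesis unfolding koszul_def by simp
qed

lemma card_eq_UNIV: "card (T :: 'x::finite set) = CARD('x) \<Longrightarrow> T = UNIV"
  by (rule card_subset_eq) auto

lemma koszul_top_injective:
  fixes W :: "'x::finite set \<Rightarrow> ('x, 'k::field_char_0) mpoly"
  assumes "alt_degree CARD('x) W" "\<And>T. koszul W T = 0" shows "W T = 0"
proof (cases "T = UNIV")
  case True
  have "koszul W (UNIV - {undefined}) = Var undefined * (ksign UNIV undefined * W UNIV)"
    by (rule koszul_point) (auto dest: card_eq_UNIV)
  then have "ksign UNIV undefined * W UNIV = 0" using assms(2) by (metis Var_mult_cancel)
  then have "ksign UNIV undefined * (ksign UNIV undefined * W UNIV) = 0" by simp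
  then show ?thesis unfolding ksign_ksign_mult using True by simp
next
  case False
  then show ?thesis using assms(1) card_eq_UNIV[of T] by (auto simp: alt_degree_def)
qed

lemma koszul_exact_top:
  fixes A B :: "('f \<Rightarrow> ('x::finite, 'k::field_char_0) mpoly) set"
  assumes "0 \<in> A" "i \<ge> CARD('x)" shows "koszul_exact_at i A B"
  unfolding koszul_exact_at_def
proof (intro allI impI)
  fix W :: "'x set \<Rightarrow> 'f \<Rightarrow> ('x, 'k) mpoly"
  assume W: "alt_degree i W" "\<forall>T b. koszul (\<lambda>U. W U b) T = 0"
  have "W T b = 0" for T b
  proof (cases "i = CARD('x)")
    case True
    then show ?thesis using W by (intro koszul_top_injective[of "\<lambda>U. W U b" T]) (simp_all add: alt_degree_def)
  next
    case False
    then have "card T \<noteq> i" using assms(2) card_mono[of UNIV T] by auto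
    then show ?thesis using W(1) by (simp add: alt_degree_def)
  qed
  then show "\<exists>V. alt_degree (Suc i) V \<and> (\<forall>T. V T \<in> A) \<and> (\<forall>T b. koszul (\<lambda>U. V U b) T = W T b)"
    using assms(1) by (intro exI[of _ "\<lambda>_. 0"]) (simp add: alt_degree_def koszul_0)
qed

text \<open>
For \<open>i = 0\<close> every element of \<open>B\<close> is a cycle, and the boundaries are the sums \<open>\<Sum>\<^sub>x x a\<^sub>x\<close>.
\<close>

lemma koszul_exact_0_iff:
  fixes A B :: "('f \<Rightarrow> ('x::finite, 'k::field_char_0) mpoly) set"
  assumes A: "ksubspace A" and B: "0 \<in> B"
  shows "koszul_exact_at 0 A B \<longleftrightarrow> B \<subseteq> vars_mult A"
proof
  assume ex: "koszul_exact_at 0 A B"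
  show "B \<subseteq> vars_mult A"
  proof
    fix u assume u: "u \<in> B"
    define W :: "'x set \<Rightarrow> 'f \<Rightarrow> ('x, 'k) mpoly" where "W T = (if T = {} then u else 0)" for T
    have "alt_degree 0 W" by (simp add: alt_degree_def W_def)
    moreover have "koszul (\<lambda>U. W U b) T = 0" for T b
      by (intro koszul_alt_degree_0) (simp add: alt_degree_def W_def)
    ultimately obtain V where V: "\<And>T. V T \<in> A" "\<And>T b. koszul (\<lambda>U. V U b) T = W T b"
      using ex u B unfolding koszul_exact_at_def by (metis W_def)
    have "u = (\<lambda>b. koszul (\<lambda>U. V U b) {})" unfolding V(2) by (simp add: W_def)
    then show "u \<in> vars_mult A" using koszul_in_vars_mult[OF A V(1)] by simp
  qed
next
  assume sub: "B \<subseteq> vars_mult A"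
  show "koszul_exact_at 0 A B"
    unfolding koszul_exact_at_def
  proof (intro allI impI)
    fix W :: "'x set \<Rightarrow> 'f \<Rightarrow> ('x, 'k) mpoly"
    assume W: "alt_degree 0 W" "\<forall>T. W T \<in> B"
    then obtain v where v: "W {} = (\<Sum>x\<in>UNIV. fscale (Var x) (v x))" "\<And>x. v x \<in> A"
      using sub by (metis subsetD vars_multE)
    define V :: "'x set \<Rightarrow> 'f \<Rightarrow> ('x, 'k) mpoly" where "V T = (if card T = 1 then v (the_elem T) else 0)" for T
    have aV: "alt_degree (Suc 0) V" by (simp add: alt_degree_def V_def)
    have "koszul (\<lambda>U. V U b) T = W T b" for T b
    proof (cases "T = {}")
      case True
      have "koszul (\<lambda>U. V U b) {} = (\<Sum>x\<in>UNIV. Var x * v x b)"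
        by (simp add: koszul_def contract_def ksign_def V_def)
      then show ?thesis using True by (simp add: v(1) sum_fun_apply fscale_def)
    next
      case False
      have "alt_degree 0 (koszul (\<lambda>U. V U b))" using aV by (intro alt_degree_koszul) (simp add: alt_degree_def)
      then show ?thesis using False W(1) by (simp add: alt_degree_def)
    qed
    moreover have "V T \<in> A" for T using v(2) ksubspaceD(1)[OF A] by (simp add: V_def)
    ultimately show "\<exists>V. alt_degree (Suc 0) V \<and> (\<forall>T. V T \<in> A) \<and> (\<forall>T b. koszul (\<lambda>U. V U b) T = W T b)"
      using aV by blast
  qed
qed

text \<open>
The boundary of the form \<open>e\<^sub>T \<otimes> u\<close> is a cycle with coefficients in \<open>S\<^sub>1B\<close>, so exactness makes it the
boundary of a form with coefficients in \<open>A\<close>. Both key lemmas start from here.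
\<close>

lemma boundary_of_point:
  fixes u :: "'f \<Rightarrow> ('x::finite, 'k::field_char_0) mpoly"
  assumes B: "ksubspace B" and u: "u \<in> B" and T: "card T = Suc i"
    and ex: "koszul_exact_at i A C" and C: "vars_mult B \<subseteq> C"
  shows "\<exists>V. alt_degree (Suc i) V \<and> (\<forall>U. V U \<in> A) \<and>
    (\<forall>S b. koszul (\<lambda>U. V U b) S = koszul (\<lambda>U. if U = T then u b else 0) S)"
proof -
  define Z :: "'x set \<Rightarrow> 'f \<Rightarrow> ('x, 'k) mpoly" where "Z U = (if U = T then u else 0)" for U
  have Z: "Z U \<in> B" for U using u ksubspaceD(1)[OF B] by (simp add: Z_def)
  have Zb: "(\<lambda>U. Z U b) = (\<lambda>U. if U = T then u b else 0)" for b by (auto simp: Z_def)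
  define W where "W S = (\<lambda>b. koszul (\<lambda>U. Z U b) S)" for S
  have "alt_degree i (koszul (\<lambda>U. Z U b))" for b
    using T by (intro alt_degree_koszul) (auto simp: alt_degree_def Z_def)
  then have "alt_degree i W" by (auto simp: alt_degree_def W_def)
  moreover have "W S \<in> C" for S using koszul_in_vars_mult[of B Z, OF B Z] C by (auto simp: W_def)
  moreover have "koszul (\<lambda>S. W S b) S = 0" for S b unfolding W_def by (rule koszul_koszul)
  ultimately have "\<exists>V. alt_degree (Suc i) V \<and> (\<forall>U. V U \<in> A) \<and> (\<forall>S b. koszul (\<lambda>U. V U b) S = W S b)"
    using ex unfolding koszul_exact_at_def by blast
  then show ?thesis unfolding W_def Zb .
qed

text \<open>
With \<open>T\<close> the set of all variables, \<open>boundary_of_point\<close> yields top forms \<open>e\<^sub>T \<otimes> u\<close> and \<open>e\<^sub>T \<otimes> a\<close>, \<open>a \<in> A\<close>, with the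
same boundary. Injectivity of the top differential gives \<open>u = a\<close>.
\<close>

lemma vars_mult_cancel:
  fixes A B :: "('f \<Rightarrow> ('x::finite, 'k::field_char_0) mpoly) set"
  assumes B: "ksubspace B" and ex: "koszul_exact_at (CARD('x) - 1) A (vars_mult A)"
    and sub: "vars_mult B \<subseteq> vars_mult A"
  shows "B \<subseteq> A"
proof
  fix u assume u: "u \<in> B"
  have c: "card (UNIV :: 'x set) = Suc (CARD('x) - 1)" by simp
  obtain V where V: "alt_degree (Suc (CARD('x) - 1)) V" "\<And>U. V U \<in> A"
    "\<And>S b. koszul (\<lambda>U. V U b) S = koszul (\<lambda>U. if U = UNIV then u b else 0) S"
    using boundary_of_point[OF B u c ex sub] by blast
  have "V UNIV b - u b = 0" for b
  proof -
    let ?Z = "\<lambda>U. V U b - (if U = UNIV then u b else 0)"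
    have 1: "koszul ?Z S = 0" for S
    proof -
      have "koszul (\<lambda>U. V U b) S = koszul (\<lambda>U. ?Z U + (if U = UNIV then u b else 0)) S" by simp
      then show ?thesis unfolding koszul_add V(3) by simp
    qed
    have "alt_degree CARD('x) ?Z" using V(1) by (auto simp: alt_degree_def)
    from koszul_top_injective[OF this 1, of UNIV] show ?thesis by simp
  qed
  then have "V UNIV = u" by (simp add: fun_eq_iff)
  then show "u \<in> A" using V(2)[of UNIV] by simp
qed

text \<open>
The coefficient at \<open>T - {x}\<close> of the boundary of \<open>e\<^sub>T \<otimes> u\<close> is \<open>x u\<close> up to sign, and that of any form with
coefficients in \<open>A\<close> lies in \<open>S\<^sub>1A\<close>. The bound on \<open>i\<close> provides a set \<open>T\<close> of \<open>i + 1\<close> variables through \<open>x\<close>.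
\<close>

lemma vars_mult_subset_of_exact:
  fixes A B :: "('f \<Rightarrow> ('x::finite, 'k::field_char_0) mpoly) set"
  assumes A: "ksubspace A" and B: "ksubspace B" and i: "i < CARD('x)"
    and ex: "koszul_exact_at i A (vars_mult B)"
  shows "vars_mult B \<subseteq> vars_mult A"
proof -
  have 1: "fscale (Var x) u \<in> vars_mult A" if u: "u \<in> B" for x u
  proof -
    have "i \<le> card (UNIV - {x})" using i by (simp add: card_Diff_singleton)
    then obtain T0 where T0: "T0 \<subseteq> UNIV - {x}" "card T0 = i" using obtain_subset_with_card_n by metis
    define T where "T = insert x T0"
    have T: "x \<in> T" "card T = Suc i" using T0 by (auto simp: T_def card_insert_if)
    obtain V where V: "\<And>U. V U \<in> A"
      "\<And>S b. koszul (\<lambda>U. V U b) S = koszul (\<lambda>U. if U = T then u b else 0) S"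
      using boundary_of_point[OF B u T(2) ex order.refl] by blast
    have eq: "koszul (\<lambda>U. V U b) (T - {x}) = Var x * (ksign T x * u b)" for b
      unfolding V(2) by (subst koszul_point[OF T(1)]) auto
    have in_A: "(\<lambda>b. Var x * (ksign T x * u b)) \<in> vars_mult A"
      using koszul_in_vars_mult[of A V, OF A V(1), of "T - {x}"] unfolding eq .
    then show ?thesis
      using ksign_cases[of T x, where ?'k = 'k] ksubspaceD(4)[OF ksubspace_vars_mult[OF A] in_A]
      by (auto simp: fscale_def fun_Compl_def)
  qed
  show ?thesis
    by (auto elim!: vars_multE intro!: ksubspaceD(5)[OF ksubspace_vars_mult[OF A]] 1)
qed

section \<open>Graded submodules are generated in bounded degree\<close>

text \<open>
A monotone subsequence that is not increasing is decreasing, and hence eventually constant.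
\<close>

lemma nat_seq_mono_subseq:
  fixes g :: "nat \<Rightarrow> nat" shows "\<exists>s :: nat \<Rightarrow> nat. strict_mono s \<and> mono (\<lambda>n. g (s n))"
proof -
  obtain s where s: "strict_mono s" "monoseq (\<lambda>n. g (s n))" using seq_monosub by blast
  show ?thesis
  proof (cases "mono (\<lambda>n. g (s n))")
    case False
    then have dec: "\<And>m n. m \<le> n \<Longrightarrow> g (s n) \<le> g (s m)"
      using s(2) by (auto simp: monoseq_def mono_def)
    define v where "v = (LEAST v. v \<in> range (\<lambda>n. g (s n)))"
    have "v \<in> range (\<lambda>n. g (s n))" unfolding v_def by (rule LeastI) (rule rangeI)
    then obtain n0 where n0: "v = g (s n0)" by blast
    have const: "g (s (n + n0)) = v" for n
    proof (rule antisym)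
      show "g (s (n + n0)) \<le> v" unfolding n0 by (rule dec) simp
      show "v \<le> g (s (n + n0))" unfolding v_def by (rule Least_le) (rule rangeI)
    qed
    have "strict_mono (\<lambda>n. s (n + n0))" using s(1) by (simp add: strict_mono_def)
    moreover have "mono (\<lambda>n. g (s (n + n0)))" unfolding const by (simp add: mono_def)
    ultimately show ?thesis by (intro exI[of _ "\<lambda>n. s (n + n0)"] conjI)
  qed (use s in blast)
qed

text \<open>
Passing to monotone subsequences one coordinate at a time proves this form of Dickson's lemma.
\<close>

lemma dickson:
  fixes f :: "nat \<Rightarrow> 'x::finite \<Rightarrow> nat"
  shows "\<exists>m n. m < n \<and> (\<forall>x. f m x \<le> f n x)"
proof -
  have "\<exists>r :: nat \<Rightarrow> nat. strict_mono r \<and> (\<forall>x\<in>A. mono (\<lambda>n. f (r n) x))" if "finite A" for A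
    using that
  proof (induction A rule: finite_induct)
    case empty
    show ?case by (intro exI[of _ id]) (simp add: strict_mono_def)
  next
    case (insert x A)
    then obtain r :: "nat \<Rightarrow> nat" where r: "strict_mono r" "\<forall>x\<in>A. mono (\<lambda>n. f (r n) x)" by blast
    obtain s :: "nat \<Rightarrow> nat" where s: "strict_mono s" "mono (\<lambda>n. f (r (s n)) x)"
      using nat_seq_mono_subseq[of "\<lambda>n. f (r n) x"] by blast
    have "mono s" using s(1) by (rule strict_mono_mono)
    then have "mono (\<lambda>n. f (r (s n)) y)" if "y \<in> A" for y
      using r(2) that by (simp add: mono_def)
    moreover have "strict_mono (\<lambda>n. r (s n))" using r(1) s(1) by (simp add: strict_mono_def)
    ultimately show ?case using s(2) by (intro exI[of _ "\<lambda>n. r (s n)"]) auto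
  qed
  from this[of UNIV] obtain r :: "nat \<Rightarrow> nat" where r: "strict_mono r" "\<And>x. mono (\<lambda>n. f (r n) x)" by auto
  have "r 0 < r 1" using r(1) by (simp add: strict_mono_def)
  moreover have "f (r 0) x \<le> f (r 1) x" for x using r(2)[of x] by (simp add: mono_def)
  ultimately show ?thesis by blast
qed

definition exp_key :: "('x::finite \<Rightarrow>\<^sub>0 nat) \<Rightarrow> (nat \<Rightarrow>\<^sub>0 nat)" where
  "exp_key t = (\<Sum>x\<in>UNIV. single (Suc (to_nat x)) (lookup t x))"

text \<open>
A monomial \<open>t\<close> at the basis element \<open>b\<close> is encoded as one exponent sequence whose entry \<open>0\<close> holds the index
of \<open>b\<close>. The lexicographic order on exponent sequences then becomes a total order on the monomials of
the free module that is compatible with multiplication (\<open>mono_key_add\<close>).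
\<close>

definition mono_key :: "('x::finite \<Rightarrow>\<^sub>0 nat) \<Rightarrow> 'f::finite \<Rightarrow> (nat \<Rightarrow>\<^sub>0 nat)" where
  "mono_key t b = exp_key t + single 0 (to_nat b)"

lemma mono_key_add: "mono_key (s + t) b = exp_key s + mono_key t b"
  by (simp add: mono_key_def exp_key_def lookup_add single_add sum.distrib add.assoc)

lemma mono_key_inj:
  assumes "mono_key s b = mono_key t c" shows "s = t \<and> b = c"
proof
  have l: "lookup (mono_key u d) (Suc (to_nat x)) = lookup u x" for u :: "'a \<Rightarrow>\<^sub>0 nat" and d :: 'b and x
  proof -
    have "lookup (mono_key u d) (Suc (to_nat x)) =
        (\<Sum>y\<in>UNIV. if y = x then lookup u x else 0)"
      by (auto simp: mono_key_def exp_key_def lookup_add lookup_sum lookup_single when_def intro!: sum.cong)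
    then show ?thesis by simp
  qed
  have l0: "lookup (mono_key u d) 0 = to_nat d" for u :: "'a \<Rightarrow>\<^sub>0 nat" and d :: 'b
    by (simp add: mono_key_def exp_key_def lookup_add lookup_sum lookup_single)
  show "s = t" by (rule poly_mapping_eqI) (metis assms l)
  have "to_nat b = to_nat c" by (metis assms l0)
  then show "b = c" by simp
qed

definition key_set :: "('f::finite \<Rightarrow> ('x::finite, 'k::field) mpoly) \<Rightarrow> (nat \<Rightarrow>\<^sub>0 nat) set" where
  "key_set u = (\<Union>b. (\<lambda>t. mono_key t b) ` keys (u b))"

lemma finite_key_set: "finite (key_set u)"
  unfolding key_set_def by (intro finite_UN_I finite finite_imageI finite_keys)

lemma key_set_eq_empty: "key_set u = {} \<Longrightarrow> u = 0"
proof (rule ext)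
  fix b assume "key_set u = {}"
  then have "keys (u b) = {}" by (simp add: key_set_def)
  then show "u b = 0 b" by simp
qed

definition lead :: "('f::finite \<Rightarrow> ('x::finite, 'k::field) mpoly) \<Rightarrow> (nat \<Rightarrow>\<^sub>0 nat)" where
  "lead u = Max (key_set u)"

text \<open>
The usual reduction step: subtracting the right multiple cancels the leading monomial and creates only smaller ones.
\<close>

lemma lead_reduction:
  fixes u v :: "'f::finite \<Rightarrow> ('x::finite, 'k::field) mpoly"
  assumes u: "t + s \<in> keys (u b)" "lead u = mono_key (t + s) b"
    and v: "t \<in> keys (v b)" "lead v = mono_key t b"
  defines "w \<equiv> u - fscale (single s (lookup (u b) (t + s) / lookup (v b) t)) v"
  assumes "w \<noteq> 0"
  shows "lead w < lead u"
proof -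
  let ?c = "lookup (u b) (t + s) / lookup (v b) t"
  have max: "k \<le> lead z" if "k \<in> key_set z" for k and z :: "'f \<Rightarrow> ('x, 'k) mpoly"
    unfolding lead_def using that finite_key_set by (rule Max_ge[rotated])
  have "key_set w \<noteq> {}" using key_set_eq_empty \<open>w \<noteq> 0\<close> by blast
  then have "lead w \<in> key_set w" unfolding lead_def by (intro Max_in finite_key_set)
  then obtain b' t' where bt: "lead w = mono_key t' b'" "t' \<in> keys (w b')"
    unfolding key_set_def by blast
  have wb: "w b' = u b' - single s ?c * v b'" for b'
    by (simp add: w_def fscale_def)
  have "lead w \<le> lead u"
  proof (cases "t' \<in> keys (u b')")
    case True
    then show ?thesis unfolding bt(1) by (intro max) (auto simp: key_set_def)
  next
    case False
    then have "t' \<in> keys (single s ?c * v b')"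
      using bt(2) by (simp add: wb in_keys_iff lookup_minus)
    then obtain t2 where t2: "t' = s + t2" "t2 \<in> keys (v b')"
      using keys_mult[of "single s ?c" "v b'"] by (auto split: if_splits)
    then have "mono_key t2 b' \<le> lead v" by (intro max) (auto simp: key_set_def)
    then have "exp_key s + mono_key t2 b' \<le> exp_key s + mono_key t b"
      unfolding v(2) by (rule add_left_mono)
    then show ?thesis by (simp add: bt(1) t2(1) u(2) mono_key_add[symmetric] add.commute)
  qed
  moreover have "lead w \<noteq> lead u"
  proof
    assume "lead w = lead u"
    then have "mono_key t' b' = mono_key (t + s) b" using bt(1) u(2) by simp
    then have "t' = t + s" "b' = b" using mono_key_inj by blast+
    then have "lookup (w b) (s + t) \<noteq> 0"
      using bt(2) by (simp add: in_keys_iff add.commute)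
    moreover have "lookup (w b) (s + t) = 0"
      using v(1) by (simp add: wb lookup_minus lookup_single_mult in_keys_iff add.commute[of t s])
    ultimately show False by simp
  qed
  ultimately show ?thesis by simp
qed

text \<open>
Otherwise there are degrees \<open>d\<^sub>0 < d\<^sub>1 < \<dots>\<close> with elements \<open>u\<^sub>n\<close> of degree \<open>d\<^sub>n\<close> outside \<open>S\<^sub>1N\<close>; choose each with the
smallest possible leading monomial. By Dickson's lemma, the leading monomial of some \<open>u\<^sub>m\<close> divides
that of a later \<open>u\<^sub>n\<close>. Reducing \<open>u\<^sub>n\<close> by \<open>u\<^sub>m\<close> contradicts minimality.
\<close>

theorem generated_in_bounded_degree:
  fixes e :: "'f::finite \<Rightarrow> int" and N :: "('f \<Rightarrow> ('x::finite, 'k::field) mpoly) set"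
  assumes N: "graded_submodule e N"
  shows "\<exists>D. \<forall>d>D. piece e N d \<subseteq> vars_mult (piece e N (d - 1))"
proof (rule ccontr)
  define New where "New d = piece e N d - vars_mult (piece e N (d - 1))" for d
  assume "\<not> ?thesis"
  then have bad: "\<exists>d>D. New d \<noteq> {}" for D by (auto simp: New_def)
  have "\<exists>d :: nat \<Rightarrow> int. \<forall>n. New (d n) \<noteq> {} \<and> d n < d (Suc n)"
  proof (rule dependent_nat_choice)
    show "\<exists>x. New x \<noteq> {}" using bad[of 0] by blast
    show "\<exists>y. New y \<noteq> {} \<and> x < y" for x and n :: nat using bad[of x] by blast
  qed
  then obtain d where d: "\<And>n. New (d n) \<noteq> {}" "\<And>n. d n < d (Suc n)" by blast
  have d_mono: "d m < d n" if "m < n" for m n by (rule lift_Suc_mono_less[of d, OF d(2) that])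
  have "\<exists>u t b. u \<in> New (d n) \<and> t \<in> keys (u b) \<and> lead u = mono_key t b \<and>
      (\<forall>v\<in>New (d n). lead u \<le> lead v)" for n
  proof -
    let ?K = "\<Union>b. (\<lambda>t. mono_key t b) ` {t :: 'x \<Rightarrow>\<^sub>0 nat. mdeg t = d n - e b}"
    have lead_ex: "\<exists>t b. t \<in> keys (u b) \<and> lead u = mono_key t b" if "u \<in> New (d n)" for u
    proof -
      have "0 \<in> vars_mult (piece e N (d n - 1))"
        by (rule ksubspaceD(1)[OF ksubspace_vars_mult[OF ksubspace_piece[OF N]]])
      then have "u \<noteq> 0" using that by (auto simp: New_def)
      then have "lead u \<in> key_set u" unfolding lead_def using key_set_eq_empty by (intro Max_in finite_key_set) blast
      then show ?thesis unfolding key_set_def by blast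
    qed
    have "lead ` New (d n) \<subseteq> ?K"
    proof (rule image_subsetI)
      fix u assume u: "u \<in> New (d n)"
      then obtain t b where tb: "t \<in> keys (u b)" "lead u = mono_key t b" using lead_ex by blast
      have "mdeg t = d n - e b" using u tb(1) by (simp add: New_def free_part_def homogeneous_def)
      then show "lead u \<in> ?K" using tb(2) by blast
    qed
    moreover have "finite ?K" by (intro finite_UN_I finite finite_imageI finite_mdeg)
    ultimately have fin: "finite (lead ` New (d n))" by (rule finite_subset)
    then have "Min (lead ` New (d n)) \<in> lead ` New (d n)" using d(1) by (intro Min_in) auto
    then obtain u where u: "u \<in> New (d n)" "Min (lead ` New (d n)) = lead u" by blast
    have "\<forall>v\<in>New (d n). lead u \<le> lead v" unfolding u(2)[symmetric] using fin by simp
    then show ?thesis using u(1) lead_ex by blast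
  qed
  then obtain u t b where u: "\<And>n. u n \<in> New (d n)"
    and tb: "\<And>n. t n \<in> keys (u n (b n))" "\<And>n. lead (u n) = mono_key (t n) (b n)"
    and min: "\<And>n v. v \<in> New (d n) \<Longrightarrow> lead (u n) \<le> lead v"
    by metis
  obtain m n where mn: "m < n"
    and le: "\<And>y. case_sum (lookup (t m)) (\<lambda>c. if b m = c then 1 else 0) y
       \<le> case_sum (lookup (t n)) (\<lambda>c. if b n = c then 1 else (0 :: nat)) y"
    using dickson[of "\<lambda>n. case_sum (lookup (t n)) (\<lambda>c. if b n = c then 1 else (0 :: nat))"] by blast
  \<comment> \<open>the indicator entries of the compared vectors force equal basis elements\<close>
  have b: "b n = b m" using le[of "Inr (b m)"] by (auto split: if_splits)
  define s where "s = t n - t m"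
  have ts: "t n = t m + s"
    by (rule poly_mapping_eqI) (use le[of "Inl _"] in \<open>simp add: s_def lookup_add lookup_minus\<close>)
  have deg: "mdeg (t k) = d k - e (b k)" for k
    using u[of k] tb(1)[of k] by (simp add: New_def free_part_def homogeneous_def)
  have mdeg_s: "mdeg s = d n - d m" using deg[of n] deg[of m] b by (simp add: ts mdeg_add)
  define c where "c = lookup (u n (b m)) (t m + s) / lookup (u m (b m)) (t m)"
  define w where "w = u n - fscale (single s c) (u m)"
  have "s \<noteq> 0" using d_mono[OF mn] mdeg_s by auto
  then obtain x s' where s': "s = single x 1 + s'" by (rule monomial_split)
  have "fscale (single s' c) (u m) \<in> piece e N (d n - 1)"
  proof -
    have "mdeg s' = d n - d m - 1" using mdeg_s by (simp add: s' mdeg_add mdeg_single)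
    then have "fscale (single s' c) (u m) \<in> free_part e (d n - d m - 1 + d m)"
      using u[of m] by (intro free_part_closed(4) homogeneous_single) (auto simp: New_def)
    then show ?thesis using u[of m] graded_submoduleD(4)[OF N] by (auto simp: New_def)
  qed
  then have "fscale (Var x) (fscale (single s' c) (u m)) \<in> vars_mult (piece e N (d n - 1))"
    by (intro Var_in_vars_mult ksubspaceD(1)[OF ksubspace_piece[OF N]])
  then have mult: "fscale (single s c) (u m) \<in> vars_mult (piece e N (d n - 1))"
    by (simp add: fscale_fscale s' Var_def mult_single)
  note kv = ksubspace_vars_mult[OF ksubspace_piece[OF N, of "d n - 1"]]
  have "w \<in> vars_mult (piece e N (d n - 1))"
  proof (cases "w = 0")
    case True
    then show ?thesis using ksubspaceD(1)[OF kv] by simp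
  next
    case False
    have "lead w < lead (u n)"
      using lead_reduction[of "t m" s "u n" "b m" "u m"] tb(1)[of n] tb(2)[of n] tb(1)[of m] tb(2)[of m] False
      unfolding w_def c_def b ts by blast
    then have "w \<notin> New (d n)" using min[of w n] by auto
    moreover have "w \<in> piece e N (d n)"
    proof -
      have "vars_mult (piece e N (d n - 1)) \<subseteq> free_part e (d n - 1 + 1)" by (rule vars_mult_free_part) blast
      then have "fscale (single s c) (u m) \<in> free_part e (d n)" using mult by auto
      then show ?thesis
        unfolding w_def using u[of n] u[of m] graded_submoduleD(3,4)[OF N] by (auto simp: New_def intro: free_part_closed(3))
    qed
    ultimately show ?thesis by (simp add: New_def)
  qed
  then have "w + fscale (single s c) (u m) \<in> vars_mult (piece e N (d n - 1))"
    using mult by (rule ksubspaceD(2)[OF kv])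
  then show False using u[of n] by (simp add: w_def New_def)
qed

section \<open>Power multiples are eventually componentwise linear\<close>

text \<open>
The cycles form a graded submodule \<open>Z\<close> of the free module with basis \<open>e\<^sub>T \<otimes> b\<close>. In degrees beyond those
of its generators each cycle is \<open>\<Sum>\<^sub>x x v\<^sub>x\<close> with cycles \<open>v\<^sub>x\<close>, which is the boundary of \<open>\<Sum>\<^sub>x e\<^sub>x \<and> v\<^sub>x\<close>.
\<close>

lemma koszul_exact_high_degree_fixed:
  fixes e :: "'f::finite \<Rightarrow> int" and N :: "('f \<Rightarrow> ('x::finite, 'k::field_char_0) mpoly) set"
  assumes N: "graded_submodule e N"
  shows "\<exists>D. \<forall>d>D. koszul_exact_at i (piece e N (d - 1)) (piece e N d)"
proof -
  define Z :: "('x set \<times> 'f \<Rightarrow> ('x, 'k) mpoly) set" where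
    "Z = {w. (\<forall>T b. card T \<noteq> i \<longrightarrow> w (T, b) = 0) \<and> (\<forall>T. (\<lambda>b. w (T, b)) \<in> N) \<and>
        (\<forall>T b. koszul (\<lambda>U. w (U, b)) T = 0)}"
  define e' :: "'x set \<times> 'f \<Rightarrow> int" where "e' = (\<lambda>(T, b). e b)"
  have Z: "graded_submodule e' Z"
    unfolding graded_submodule_def
  proof (intro conjI ballI allI)
    show "module.subspace fscale Z"
    proof (rule module.subspaceI[OF module_fscale])
      show "0 \<in> Z" using graded_submoduleD(1)[OF N] by (simp add: Z_def koszul_0 zero_fun_def)
      show "u + v \<in> Z" if "u \<in> Z" "v \<in> Z" for u v
      proof -
        have "(\<lambda>b. u (T, b)) + (\<lambda>b. v (T, b)) \<in> N" for T using that by (intro graded_submoduleD(2)[OF N]) (auto simp: Z_def)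
        then show ?thesis using that by (simp add: Z_def koszul_add plus_fun_def)
      qed
      show "fscale c u \<in> Z" if "u \<in> Z" for c u
      proof -
        have "fscale c (\<lambda>b. u (T, b)) \<in> N" for T using that by (intro graded_submoduleD(4)[OF N]) (auto simp: Z_def)
        then show ?thesis using that by (simp add: Z_def fscale_def koszul_mult)
      qed
    qed
    fix v d assume v: "v \<in> Z"
    have "(\<lambda>b. hcomp (d - e b) (v (T, b))) \<in> N" for T
      using graded_submoduleD(6)[OF N, of "\<lambda>b. v (T, b)" d] v by (simp add: Z_def)
    moreover have "koszul (\<lambda>U. hcomp (d - e b) (v (U, b))) T = 0" for T b
      using hcomp_koszul[of "d - e b + 1" "\<lambda>U. v (U, b)" T] v by (simp add: Z_def)
    ultimately show "(\<lambda>b. hcomp (d - e' b) (v b)) \<in> Z"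
      using v by (simp add: Z_def e'_def)
  qed
  obtain D where D: "\<And>d. d > D \<Longrightarrow> piece e' Z d \<subseteq> vars_mult (piece e' Z (d - 1))"
    using generated_in_bounded_degree[OF Z] by blast
  have "koszul_exact_at i (piece e N (d - 1)) (piece e N d)" if d: "d > D" for d
    unfolding koszul_exact_at_def
  proof (intro allI impI)
    fix W :: "'x set \<Rightarrow> 'f \<Rightarrow> ('x, 'k) mpoly"
    assume W: "alt_degree i W" "\<forall>T. W T \<in> piece e N d" "\<forall>T b. koszul (\<lambda>U. W U b) T = 0"
    have "(\<lambda>(T, b). W T b) \<in> piece e' Z d"
      using W by (simp add: Z_def e'_def free_part_def alt_degree_def)
    then obtain v where v: "(\<lambda>(T, b). W T b) = (\<Sum>x\<in>UNIV. fscale (Var x) (v x))" "\<And>x. v x \<in> piece e' Z (d - 1)"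
      using D[OF d] unfolding vars_mult_def by blast
    have Wv: "W T b = (\<Sum>x\<in>UNIV. Var x * v x (T, b))" for T b
      using fun_cong[OF v(1), of "(T, b)"] by (simp add: sum_fun_apply fscale_def)
    define V where "V T = (\<lambda>b. \<Sum>x\<in>UNIV. wedge x (\<lambda>U. v x (U, b)) T)" for T
    have "alt_degree (Suc i) (wedge x (\<lambda>U. v x (U, b)))" for x b
      using v(2)[of x] by (intro alt_degree_wedge) (simp add: alt_degree_def Z_def)
    then have "alt_degree (Suc i) V" by (simp add: alt_degree_def V_def zero_fun_def)
    moreover have "V T \<in> piece e N (d - 1)" for T
    proof -
      note k = ksubspace_piece[OF N, of "d - 1"]
      have vin: "(\<lambda>b. v x (U, b)) \<in> piece e N (d - 1)" for x U
        using v(2)[of x] by (simp add: Z_def free_part_def e'_def)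
      have "(\<lambda>b. wedge x (\<lambda>U. v x (U, b)) T) \<in> piece e N (d - 1)" for x
      proof (cases "x \<in> T")
        case True
        show ?thesis
          using ksign_cases[of T x, where ?'k = 'k] True vin[of x "T - {x}"] ksubspaceD(4)[OF k vin[of x "T - {x}"]]
          by (auto simp: wedge_def fun_Compl_def)
      next
        case False
        then show ?thesis using ksubspaceD(1)[OF k] by (simp add: wedge_def zero_fun_def)
      qed
      then have "(\<Sum>x\<in>UNIV. (\<lambda>b. wedge x (\<lambda>U. v x (U, b)) T)) \<in> piece e N (d - 1)"
        by (intro ksubspaceD(5)[OF k])
      moreover have "(\<Sum>x\<in>UNIV. (\<lambda>b. wedge x (\<lambda>U. v x (U, b)) T)) = V T"
        by (simp add: V_def fun_eq_iff sum_fun_apply)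
      ultimately show ?thesis by simp
    qed
    moreover have "koszul (\<lambda>U. V U b) T = W T b" for T b
    proof -
      have "koszul (wedge x (\<lambda>U. v x (U, b))) T = Var x * v x (T, b)" for x
      proof -
        have "koszul (\<lambda>U. v x (U, b)) = (\<lambda>_. 0)" using v(2)[of x] by (simp add: Z_def fun_eq_iff)
        then show ?thesis using koszul_wedge[of x "\<lambda>U. v x (U, b)" T] by (cases "x \<in> T") (simp_all add: wedge_def[of _ "\<lambda>_. 0"])
      qed
      then show ?thesis unfolding V_def koszul_sum Wv by simp
    qed
    ultimately show "\<exists>V. alt_degree (Suc i) V \<and> (\<forall>T. V T \<in> piece e N (d - 1)) \<and> (\<forall>T b. koszul (\<lambda>U. V U b) T = W T b)"
      by blast
  qed
  then show ?thesis by blast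
qed

text \<open>
Only finitely many homological degrees matter, since there are no cycles from the number of variables on.
\<close>

theorem koszul_exact_high_degree:
  fixes e :: "'f::finite \<Rightarrow> int" and N :: "('f \<Rightarrow> ('x::finite, 'k::field_char_0) mpoly) set"
  assumes N: "graded_submodule e N"
  shows "\<exists>D. \<forall>d>D. \<forall>i. koszul_exact_at i (piece e N (d - 1)) (piece e N d)"
proof -
  obtain D where D: "\<And>i d. d > D i \<Longrightarrow> koszul_exact_at i (piece e N (d - 1)) (piece e N d)"
    using koszul_exact_high_degree_fixed[OF N] by metis
  have "koszul_exact_at i (piece e N (d - 1)) (piece e N d)" if d: "d > Max (D ` {..<CARD('x)})" for d i
  proof (cases "i < CARD('x)")
    case True
    then have "D i \<le> Max (D ` {..<CARD('x)})" by (intro Max_ge) auto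
    then show ?thesis using D d by simp
  next
    case False
    then show ?thesis using ksubspaceD(1)[OF ksubspace_piece[OF N]] by (intro koszul_exact_top) auto
  qed
  then show ?thesis by blast
qed

lemma vars_mult_pow_zero: "(vars_mult ^^ r) {0 :: 'f \<Rightarrow> ('x::finite, 'k::field) mpoly} = {0}"
proof (induction r)
  case (Suc r)
  have "vars_mult {0 :: 'f \<Rightarrow> ('x, 'k) mpoly} = {0}"
    using Var_in_vars_mult[of "{0}" 0 undefined] by (auto elim!: vars_multE)
  then show ?case unfolding funpow.simps o_apply Suc .
qed simp

text \<open>
Each module generated by a piece \<open>M\<^sub>d\<close> has finite regularity. Pieces in very negative degrees vanish, and
for large \<open>d\<close> the pieces are \<open>S\<^sub>1\<^sup>qM\<^sub>D\<close> for one fixed \<open>D\<close>, so finitely many bounds suffice.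
\<close>

theorem ex_componentwise_linear:
  fixes e :: "'f::finite \<Rightarrow> int" and M :: "('f \<Rightarrow> ('x::finite, 'k::field_char_0) mpoly) set"
  assumes M: "graded_submodule e M"
  shows "\<exists>k. componentwise_linear e (power_mult k M)"
proof -
  let ?A = "piece e M"
  have "\<exists>k. \<forall>r\<ge>k. \<forall>i. koszul_exact_at i ((vars_mult ^^ r) (?A d)) ((vars_mult ^^ Suc r) (?A d))" for d
  proof -
    have A: "ksubspace (?A d)" "?A d \<subseteq> free_part e d" using ksubspace_piece[OF M] by auto
    obtain D where D: "\<And>j i. j > D \<Longrightarrow> koszul_exact_at i (piece e (module.span fscale (?A d)) (j - 1)) (piece e (module.span fscale (?A d)) j)"
      using koszul_exact_high_degree[OF graded_span[OF A]] by blast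
    have "koszul_exact_at i ((vars_mult ^^ r) (?A d)) ((vars_mult ^^ Suc r) (?A d))" if r: "r \<ge> nat (D - d)" for r i
      using D[of "d + int (Suc r)" i] r piece_span(1)[OF A, of r] piece_span(1)[OF A, of "Suc r"]
      by (simp add: algebra_simps)
    then show ?thesis by blast
  qed
  then obtain K where K: "\<And>d r i. r \<ge> K d \<Longrightarrow> koszul_exact_at i ((vars_mult ^^ r) (?A d)) ((vars_mult ^^ Suc r) (?A d))"
    by metis
  obtain D where D: "\<And>d. d > D \<Longrightarrow> ?A d \<subseteq> vars_mult (?A (d - 1))"
    using generated_in_bounded_degree[OF M] by blast
  have D': "?A (D + int r) = (vars_mult ^^ r) (?A D)" for r
  proof (induction r)
    case (Suc r)
    have "?A (D + int (Suc r)) \<subseteq> vars_mult (?A (D + int r))" using D[of "D + int (Suc r)"] by (simp add: algebra_simps)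
    moreover have "vars_mult (?A (D + int r)) \<subseteq> ?A (D + int (Suc r))"
      using vars_mult_piece_subset[OF M, of "D + int (Suc r)"] by (simp add: algebra_simps)
    ultimately have "?A (D + int (Suc r)) = vars_mult (?A (D + int r))" by (rule subset_antisym)
    then show ?case using Suc by simp
  qed simp
  define m where "m = Min (range e)"
  have low: "?A d = {0}" if "d < m" for d
  proof -
    have "u = 0" if "u \<in> free_part e d" for u :: "'f \<Rightarrow> ('x, 'k) mpoly"
    proof (rule ext)
      fix b
      have "m \<le> e b" unfolding m_def by simp
      then show "u b = 0 b" using that \<open>d < m\<close> homogeneous_negative_degree[of "d - e b" "u b"] by (simp add: free_part_def)
    qed
    then show ?thesis using ksubspaceD(1)[OF ksubspace_piece[OF M]] by blast
  qed
  \<comment> \<open>\<open>D\<close> is added because it may lie below \<open>m\<close>\<close>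
  define k where "k = Max (K ` ({m..D} \<union> {D}))"
  have K_le: "K d \<le> k" if "d \<in> {m..D} \<union> {D}" for d
    unfolding k_def using that by (intro Max_ge) auto
  have exact: "koszul_exact_at i ((vars_mult ^^ r) (?A d)) ((vars_mult ^^ Suc r) (?A d))" if r: "r \<ge> k" for d r i
  proof -
    consider "d < m" | "m \<le> d" "d \<le> D" | "d > D" by linarith
    then show ?thesis
    proof cases
      case 1
      show ?thesis unfolding low[OF 1] vars_mult_pow_zero by (rule koszul_exact_zero) simp
    next
      case 2
      then show ?thesis using r K_le[of d] by (intro K) auto
    next
      case 3
      then obtain q where q: "d = D + int q" by (metis less_imp_le zle_iff_zadd)
      have *: "(vars_mult ^^ s) (?A d) = (vars_mult ^^ (s + q)) (?A D)" for s
        unfolding q D' by (simp add: funpow_add)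
      show ?thesis unfolding * using K[of D "r + q" i] r K_le[of D] by simp
    qed
  qed
  have "componentwise_linear e (power_mult k M)"
    unfolding componentwise_linear_iff[OF graded_power_mult[OF M]]
  proof (intro allI)
    fix d i r
    have *: "(vars_mult ^^ s) (piece e (power_mult k M) d) = (vars_mult ^^ (s + k)) (?A (d - int k))" for s
      unfolding piece_power_mult[OF M] by (simp add: funpow_add)
    show "koszul_exact_at i ((vars_mult ^^ r) (piece e (power_mult k M) d)) ((vars_mult ^^ Suc r) (piece e (power_mult k M) d))"
      unfolding * using exact[of "r + k"] by simp
  qed
  then show ?thesis ..
qed

lemma componentwise_linear_Suc:
  fixes e :: "'f::finite \<Rightarrow> int" and M :: "('f \<Rightarrow> ('x::finite, 'k::field_char_0) mpoly) set"
  assumes M: "graded_submodule e M" and cl: "componentwise_linear e (power_mult k M)"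
  shows "componentwise_linear e (power_mult (Suc k) M)"
  using cl unfolding componentwise_linear_iff[OF graded_power_mult[OF M]] piece_power_mult_Suc[OF M] vars_mult_pow_Suc[symmetric]
  by blast

theorem componentwise_linear_power_mult:
  fixes e :: "'f::finite \<Rightarrow> int" and M :: "('f \<Rightarrow> ('x::finite, 'k::field_char_0) mpoly) set"
  assumes M: "graded_submodule e M" and k: "k \<ge> cl_index e M"
  shows "componentwise_linear e (power_mult k M)"
  using k
proof (induction k rule: dec_induct)
  case base
  show ?case unfolding cl_index_def using ex_componentwise_linear[OF M] by (rule LeastI_ex)
qed (rule componentwise_linear_Suc[OF M])

section \<open>Depth of the associated graded module\<close>

lemma power_mult_add: "power_mult (i + m) M = (vars_mult ^^ i) (power_mult m M)"
  by (induction i) (simp_all add: power_mult_Suc)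

lemma homogeneous_fscale_power_mult:
  assumes M: "graded_submodule e M" and p: "homogeneous (int i) p" and u: "u \<in> power_mult m M"
  shows "fscale p u \<in> power_mult (i + m) M"
  unfolding power_mult_add using ksubspace_graded_submodule[OF graded_power_mult[OF M]] p u by (rule homogeneous_fscale_in_pow)

text \<open>
The common form of \<open>gr_num\<close> (\<open>j = 0\<close>) and \<open>gr_den\<close> (\<open>j = 1\<close>).
\<close>

definition gr_filtration :: "nat \<Rightarrow> ('f \<Rightarrow> ('x, 'k::field) mpoly) set \<Rightarrow> (nat \<Rightarrow> 'f \<Rightarrow> ('x, 'k) mpoly) set" where
  "gr_filtration j M = {u. finite {k. u k \<noteq> 0} \<and> (\<forall>k. u k \<in> power_mult (k + j) M)}"

lemma finite_hcomp: "finite {i. hcomp (int i) p \<noteq> 0}"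
proof (rule finite_subset)
  show "{i. hcomp (int i) p \<noteq> 0} \<subseteq> nat ` mdeg ` keys p"
  proof
    fix i assume "i \<in> {i. hcomp (int i) p \<noteq> 0}"
    then obtain t where "lookup (hcomp (int i) p) t \<noteq> 0"
      by (metis (mono_tags) lookup_zero mem_Collect_eq poly_mapping_eqI)
    then have "t \<in> keys p" "mdeg t = int i"
      by (auto simp: lookup_hcomp when_def in_keys_iff split: if_splits)
    then show "i \<in> nat ` mdeg ` keys p" by (metis image_eqI nat_int)
  qed
qed simp

lemma gr_scale_closed:
  assumes M: "graded_submodule e M" and u: "u \<in> gr_filtration j M"
  shows "gr_scale a u \<in> gr_filtration j M"
proof -
  have "fscale (hcomp (int i) a) (u (k - i)) \<in> power_mult (k + j) M" if "i \<le> k" for i k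
  proof -
    have "u (k - i) \<in> power_mult (k - i + j) M" using u by (simp add: gr_filtration_def)
    from homogeneous_fscale_power_mult[OF M homogeneous_hcomp this]
    have "fscale (hcomp (int i) a) (u (k - i)) \<in> power_mult (i + (k - i + j)) M" .
    moreover have "i + (k - i + j) = k + j" using that by simp
    ultimately show ?thesis by simp
  qed
  then have "gr_scale a u k \<in> power_mult (k + j) M" for k
    unfolding gr_scale_def by (intro graded_submoduleD(5)[OF graded_power_mult[OF M]]) auto
  moreover have "{k. gr_scale a u k \<noteq> 0} \<subseteq> (\<lambda>(i, l). i + l) ` ({i. hcomp (int i) a \<noteq> 0} \<times> {l. u l \<noteq> 0})"
  proof
    fix k assume "k \<in> {k. gr_scale a u k \<noteq> 0}"
    then obtain i where i: "i \<le> k" "fscale (hcomp (int i) a) (u (k - i)) \<noteq> 0"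
      unfolding gr_scale_def by (auto elim: sum.not_neutral_contains_not_neutral)
    then have "hcomp (int i) a \<noteq> 0" "u (k - i) \<noteq> 0" by (metis fscale_zero(2), metis fscale_zero(1))
    then show "k \<in> (\<lambda>(i, l). i + l) ` ({i. hcomp (int i) a \<noteq> 0} \<times> {l. u l \<noteq> 0})"
      using i(1) by (intro image_eqI[of _ _ "(i, k - i)"]) auto
  qed
  then have "finite {k. gr_scale a u k \<noteq> 0}"
    by (rule finite_subset) (use u finite_hcomp[of a] in \<open>simp add: gr_filtration_def\<close>)
  ultimately show ?thesis by (simp add: gr_filtration_def)
qed

lemma subspace_gr_filtration:
  assumes M: "graded_submodule e M" shows "module.subspace gr_scale (gr_filtration j M)"
proof (rule module.subspaceI[OF module_gr_scale])
  note g = graded_submoduleD[OF graded_power_mult[OF M]]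
  show "0 \<in> gr_filtration j M" using g(1) by (simp add: gr_filtration_def)
  show "u + v \<in> gr_filtration j M" if "u \<in> gr_filtration j M" "v \<in> gr_filtration j M" for u v
  proof -
    have "finite {k. (u + v) k \<noteq> 0}"
      by (rule finite_subset[of _ "{k. u k \<noteq> 0} \<union> {k. v k \<noteq> 0}"])
         (use that in \<open>auto simp: gr_filtration_def\<close>)
    then show ?thesis using that g(2) by (simp add: gr_filtration_def)
  qed
qed (rule gr_scale_closed[OF M])

lemma gr_num_den: "gr_num M = gr_filtration 0 M" "gr_den M = gr_filtration 1 M"
  by (simp_all add: gr_num_def gr_den_def gr_filtration_def)

lemma hcomp_power_low:
  assumes "f \<in> max_ideal" "i < k" shows "hcomp (int i) (f ^ k) = 0"
  using assms(2)
proof (induction k arbitrary: i)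
  case (Suc k)
  have "hcomp (int j) f * hcomp (int (i - j)) (f ^ k) = 0" if "j \<le> i" for j
  proof (cases "j = 0")
    case True
    have "hcomp 0 f = 0"
      using assms(1) by (intro poly_mapping_eqI) (auto simp: max_ideal_iff lookup_hcomp when_def mdeg_eq_0_iff)
    then show ?thesis using True by simp
  next
    case False
    then have "i - j < k" using Suc.prems that by linarith
    then show ?thesis using Suc.IH by simp
  qed
  then show ?case by (simp add: hcomp_mult)
qed simp

lemma gr_depth_pos_regular:
  assumes M: "graded_submodule e M" and depth: "gr_depth M > 0" and ne: "gr_num M \<noteq> gr_den M"
  obtains f where "f \<in> max_ideal" "\<And>u. u \<in> gr_num M \<Longrightarrow> gr_scale f u \<in> gr_den M \<Longrightarrow> u \<in> gr_den M"
proof -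
  have "0 < Sup {enat (length fs) |fs. set fs \<subseteq> max_ideal \<and> regular_sequence gr_scale (gr_num M) (gr_den M) fs}"
    using depth ne by (simp add: gr_depth_def quotient_depth_def)
  then obtain fs where fs: "set fs \<subseteq> max_ideal" "regular_sequence gr_scale (gr_num M) (gr_den M) fs" "0 < enat (length fs)"
    unfolding less_Sup_iff by blast
  have len: "0 < length fs" using fs(3) by (simp add: zero_enat_def)
  have "seq_submodule gr_scale (take 0 fs) (gr_num M) (gr_den M) = gr_den M"
    using module.span_eq_iff[OF module_gr_scale, of "gr_den M"] subspace_gr_filtration[OF M, of 1]
    by (simp add: seq_submodule_def gr_num_den)
  then have "\<forall>u\<in>gr_num M. gr_scale (fs ! 0) u \<in> gr_den M \<longrightarrow> u \<in> gr_den M"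
    using fs(2) len unfolding regular_sequence_def by metis
  moreover have "fs ! 0 \<in> max_ideal" using fs(1) len nth_mem by blast
  ultimately show ?thesis using that by blast
qed

text \<open>
An element \<open>u\<close> of \<open>M\<^sub>d\<close> has a class in the summand \<open>M/\<mm>M\<close> of the associated graded module, represented by
\<open>u0\<close>. The hypothesis makes \<open>f\<^sup>k\<close> annihilate this class, where \<open>f\<close> is a regular element, so the class is zero.
\<close>

lemma no_generators_descend:
  fixes e :: "'f::finite \<Rightarrow> int" and M :: "('f \<Rightarrow> ('x::finite, 'k::field_char_0) mpoly) set"
  assumes M: "graded_submodule e M" and depth: "gr_depth M > 0"
    and sub: "(vars_mult ^^ k) (piece e M d) \<subseteq> (vars_mult ^^ Suc k) (piece e M (d - 1))"
  shows "piece e M d \<subseteq> vars_mult (piece e M (d - 1))"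
proof
  fix u assume u: "u \<in> piece e M d"
  define u0 where "u0 = (\<lambda>n::nat. if n = 0 then u else 0)"
  have "{n. u0 n \<noteq> 0} \<subseteq> {0}" by (auto simp: u0_def)
  then have fin: "finite {n. u0 n \<noteq> 0}" by (rule finite_subset) simp
  have u0: "u0 \<in> gr_num M"
    using u fin graded_submoduleD(1)[OF graded_power_mult[OF M]] by (simp add: gr_num_def u0_def power_mult_0[OF M])
  have "u0 \<in> gr_den M"
  \<comment> \<open>there is no regular sequence to use when the associated graded module is zero, whose depth is infinite\<close>
  proof (cases "gr_num M = gr_den M")
    case True
    then show ?thesis using u0 by simp
  next
    case False
    then obtain f where f: "f \<in> max_ideal"
      and reg: "\<And>u. u \<in> gr_num M \<Longrightarrow> gr_scale f u \<in> gr_den M \<Longrightarrow> u \<in> gr_den M"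
      using gr_depth_pos_regular[OF M depth] by blast
    have desc: "gr_scale (f ^ j) u0 \<in> gr_den M \<Longrightarrow> u0 \<in> gr_den M" for j
    proof (induction j)
      case 0
      then show ?case using module.scale_one[OF module_gr_scale, of u0] by simp
    next
      case (Suc j)
      have "gr_scale (f ^ j) u0 \<in> gr_num M"
        using gr_scale_closed[OF M, of u0 0] u0 by (simp add: gr_num_den)
      moreover have "gr_scale f (gr_scale (f ^ j) u0) \<in> gr_den M"
        using Suc.prems by (simp add: module.scale_scale[OF module_gr_scale])
      ultimately show ?case using reg Suc.IH by blast
    qed
    have comp: "gr_scale (f ^ k) u0 i = fscale (hcomp (int i) (f ^ k)) u" for i
    proof -
      have "gr_scale (f ^ k) u0 i = (\<Sum>j\<le>i. if j = i then fscale (hcomp (int i) (f ^ k)) u else 0)"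
        unfolding gr_scale_def u0_def by (intro sum.cong) auto
      then show ?thesis by simp
    qed
    have "fscale (hcomp (int i) (f ^ k)) u \<in> power_mult (Suc i) M" for i
    proof (cases "i < k")
      case True
      then show ?thesis using hcomp_power_low[OF f True] graded_submoduleD(1)[OF graded_power_mult[OF M]] by simp
    next
      case False
      then obtain q where q: "i = q + k" by (metis add.commute le_Suc_ex not_less)
      have "fscale (hcomp (int i) (f ^ k)) u \<in> (vars_mult ^^ i) (piece e M d)"
        using ksubspace_piece[OF M] homogeneous_hcomp u by (rule homogeneous_fscale_in_pow)
      also have "\<dots> = (vars_mult ^^ q) ((vars_mult ^^ k) (piece e M d))"
        by (simp add: q funpow_add)
      also have "\<dots> \<subseteq> (vars_mult ^^ q) ((vars_mult ^^ Suc k) (piece e M (d - 1)))"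
        using sub by (rule vars_mult_pow_mono)
      also have "\<dots> = (vars_mult ^^ Suc i) (piece e M (d - 1))"
        unfolding q by (metis add_Suc_right comp_apply funpow_add)
      also have "\<dots> = piece e (power_mult (Suc i) M) (d + int i)"
        unfolding piece_power_mult[OF M] by (simp add: algebra_simps)
      finally show ?thesis by blast
    qed
    then have "gr_scale (f ^ k) u0 \<in> gr_den M"
      using gr_scale_closed[OF M, of u0 0 "f ^ k"] u0 unfolding gr_num_den
      by (simp add: gr_filtration_def comp)
    then show ?thesis by (rule desc)
  qed
  then have "u0 0 \<in> power_mult (Suc 0) M" unfolding gr_den_def by blast
  then have "u \<in> piece e (power_mult (Suc 0) M) d" using u by (simp add: u0_def)
  then show "u \<in> vars_mult (piece e M (d - 1))"
    by (simp add: piece_power_mult_Suc[OF M] power_mult_0[OF M])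
qed

section \<open>Strands of power multiples\<close>

lemma betti_0_eq_0_iff:
  fixes e :: "'f::finite \<Rightarrow> int" and N :: "('f \<Rightarrow> ('x::finite, 'k::field_char_0) mpoly) set"
  assumes N: "graded_submodule e N"
  shows "betti e 0 l N = 0 \<longleftrightarrow> piece e N l \<subseteq> vars_mult (piece e N (l - 1))"
  using betti_eq_0_iff[OF N, of 0 l] koszul_exact_0_iff[OF ksubspace_piece[OF N], of "piece e N l" "l - 1"]
    ksubspaceD(1)[OF ksubspace_piece[OF N, of l]] by simp

text \<open>
If there are no new generators in degree \<open>l\<close>, the \<open>l\<close>th strand only sees the module generated by \<open>N\<^bsub>l-1\<^esub>\<close>,
which has a linear resolution.
\<close>

lemma strand_nonzero_iff_generators:
  fixes e :: "'f::finite \<Rightarrow> int" and N :: "('f \<Rightarrow> ('x::finite, 'k::field_char_0) mpoly) set"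
  assumes N: "graded_submodule e N" and cl: "componentwise_linear e N"
  shows "strand_nonzero e l N \<longleftrightarrow> \<not> piece e N l \<subseteq> vars_mult (piece e N (l - 1))"
proof
  assume s: "strand_nonzero e l N"
  show "\<not> piece e N l \<subseteq> vars_mult (piece e N (l - 1))"
  proof
    assume "piece e N l \<subseteq> vars_mult (piece e N (l - 1))"
    then have eq: "piece e N l = vars_mult (piece e N (l - 1))" using vars_mult_piece_subset[OF N] by blast
    have "koszul_exact_at i ((vars_mult ^^ 0) (piece e N (l - 1))) ((vars_mult ^^ Suc 0) (piece e N (l - 1)))" for i
      using cl unfolding componentwise_linear_iff[OF N] by blast
    then have "betti e i (int i + l) N = 0" for i by (simp add: betti_eq_0_iff[OF N] eq)
    then show False using s by (simp add: strand_nonzero_def)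
  qed
next
  assume "\<not> piece e N l \<subseteq> vars_mult (piece e N (l - 1))"
  then have "betti e 0 (int 0 + l) N \<noteq> 0" by (simp add: betti_0_eq_0_iff[OF N])
  then show "strand_nonzero e l N" unfolding strand_nonzero_def by blast
qed

lemma betti_eq_0_beyond_variables:
  fixes e :: "'f::finite \<Rightarrow> int" and N :: "('f \<Rightarrow> ('x::finite, 'k::field_char_0) mpoly) set"
  assumes N: "graded_submodule e N" and i: "i \<ge> CARD('x)"
  shows "betti e i (int i + l) N = 0"
  unfolding betti_eq_0_iff[OF N] using ksubspaceD(1)[OF ksubspace_piece[OF N]] i by (rule koszul_exact_top)

text \<open>
A power multiple loses its new generators in degree \<open>l\<close> under multiplication by \<open>\<mm>\<close> only if it had
none, by \<open>vars_mult_cancel\<close>.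
\<close>

lemma strand_shift:
  fixes e :: "'f::finite \<Rightarrow> int" and M :: "('f \<Rightarrow> ('x::finite, 'k::field_char_0) mpoly) set"
  assumes M: "graded_submodule e M" and k: "k \<ge> cl_index e M"
  shows "strand_nonzero e l (power_mult k M) \<longleftrightarrow> strand_nonzero e (l + 1) (power_mult (Suc k) M)"
proof -
  let ?N = "power_mult k M"
  have N: "graded_submodule e ?N" by (rule graded_power_mult[OF M])
  have cl: "componentwise_linear e ?N" by (rule componentwise_linear_power_mult[OF M k])
  have cl': "componentwise_linear e (power_mult (Suc k) M)" by (rule componentwise_linear_Suc[OF M cl])
  have "koszul_exact_at (CARD('x) - 1) ((vars_mult ^^ Suc 0) (piece e ?N (l - 1))) ((vars_mult ^^ Suc (Suc 0)) (piece e ?N (l - 1)))"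
    using cl unfolding componentwise_linear_iff[OF N] by blast
  then have "piece e ?N l \<subseteq> vars_mult (piece e ?N (l - 1)) \<longleftrightarrow>
      vars_mult (piece e ?N l) \<subseteq> vars_mult (vars_mult (piece e ?N (l - 1)))"
    using vars_mult_cancel[OF ksubspace_piece[OF N, of l], of "vars_mult (piece e ?N (l - 1))"] vars_mult_mono by auto
  then show ?thesis
    unfolding strand_nonzero_iff_generators[OF N cl] strand_nonzero_iff_generators[OF graded_power_mult[OF M] cl']
      piece_power_mult_Suc[OF M] by simp
qed

lemma strands_full:
  fixes e :: "'f::finite \<Rightarrow> int" and M :: "('f \<Rightarrow> ('x::finite, 'k::field_char_0) mpoly) set"
  assumes M: "graded_submodule e M" and k: "k \<ge> cl_index e M + 1"
    and strand: "strand_nonzero e l (power_mult k M)" and i: "i < CARD('x)"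
  shows "betti e i (int i + l) (power_mult k M) \<noteq> 0"
proof
  assume 0: "betti e i (int i + l) (power_mult k M) = 0"
  obtain k' where k': "k = Suc k'" "k' \<ge> cl_index e M" using k by (cases k) auto
  note N = graded_power_mult[OF M, of k] and N' = graded_power_mult[OF M, of k']
  have eq: "piece e (power_mult k M) l = vars_mult (piece e (power_mult k' M) (l - 1))"
    unfolding k'(1) by (rule piece_power_mult_Suc[OF M])
  have "vars_mult (piece e (power_mult k' M) (l - 1)) \<subseteq> vars_mult (piece e (power_mult k M) (l - 1))"
    using 0 unfolding betti_eq_0_iff[OF N] eq
    by (rule vars_mult_subset_of_exact[OF ksubspace_piece[OF N] ksubspace_piece[OF N'] i])
  moreover have "componentwise_linear e (power_mult k M)" using k by (intro componentwise_linear_power_mult[OF M]) simp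
  ultimately show False using strand strand_nonzero_iff_generators[OF N] eq by simp
qed

lemma generator_degrees_iff:
  fixes e :: "'f::finite \<Rightarrow> int" and M :: "('f \<Rightarrow> ('x::finite, 'k::field_char_0) mpoly) set"
  assumes M: "graded_submodule e M"
  shows "j \<in> generator_degrees e M \<longleftrightarrow> \<not> piece e M j \<subseteq> vars_mult (piece e M (j - 1))"
  by (simp add: generator_degrees_def betti_0_eq_0_iff[OF M])

lemma strand_nonzero_iff_power:
  fixes e :: "'f::finite \<Rightarrow> int" and M :: "('f \<Rightarrow> ('x::finite, 'k::field_char_0) mpoly) set"
  assumes M: "graded_submodule e M" and k: "k \<ge> cl_index e M"
  shows "strand_nonzero e l (power_mult k M) \<longleftrightarrow>
     \<not> (vars_mult ^^ k) (piece e M (l - int k)) \<subseteq> (vars_mult ^^ Suc k) (piece e M (l - int k - 1))"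
  unfolding strand_nonzero_iff_generators[OF graded_power_mult[OF M] componentwise_linear_power_mult[OF M k]]
    piece_power_mult[OF M] by (simp add: algebra_simps)

theorem theorem1p2:
  fixes e :: "'f::finite \<Rightarrow> int"
    and M :: "('f \<Rightarrow> ('x::finite, 'k::field_char_0) mpoly) set"
  assumes "graded_submodule e M"
  shows "(\<forall>k \<ge> cl_index e M + 1. \<forall>l. strand_nonzero e l (power_mult k M) \<longrightarrow>
           (\<forall>i < CARD('x). betti e i (int i + l) (power_mult k M) \<noteq> 0)) \<and>
         (\<forall>k \<ge> cl_index e M. \<forall>l. strand_nonzero e l (power_mult k M) \<longleftrightarrow>
           strand_nonzero e (l + 1) (power_mult (k + 1) M)) \<and>
         same_shape_from e (cl_index e M + 1) M \<and>
         (\<forall>m (d :: nat \<Rightarrow> int). d ` {1..m} = generator_degrees e M \<longrightarrow>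
           (\<forall>k \<ge> cl_index e M. \<forall>l. strand_nonzero e l (power_mult k M) \<longrightarrow>
              (\<exists>i\<in>{1..m}. l - int k = d i)) \<and>
           (gr_depth M > 0 \<longrightarrow>
              (\<forall>k \<ge> cl_index e M. \<forall>l. strand_nonzero e l (power_mult k M) \<longleftrightarrow>
                 (\<exists>i\<in>{1..m}. l - int k = d i))))"
proof (intro conjI allI impI)
  note M = assms
  note full = strands_full[OF M] and shift = strand_shift[OF M]
  show "betti e i (int i + l) (power_mult k M) \<noteq> 0"
    if "cl_index e M + 1 \<le> k" "strand_nonzero e l (power_mult k M)" "i < CARD('x)" for k l i
    using full that by blast
  show "strand_nonzero e l (power_mult k M) = strand_nonzero e (l + 1) (power_mult (k + 1) M)"
    if "cl_index e M \<le> k" for k l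
    using shift[OF that, of l] by simp
  show "same_shape_from e (cl_index e M + 1) M"
  proof -
    have nonzero: "betti e i (int i + l) (power_mult k M) \<noteq> 0 \<longleftrightarrow> i < CARD('x) \<and> strand_nonzero e l (power_mult k M)"
      if "k \<ge> cl_index e M + 1" for k i l
    proof
      assume b: "betti e i (int i + l) (power_mult k M) \<noteq> 0"
      then have "i < CARD('x)" using betti_eq_0_beyond_variables[OF graded_power_mult[OF M], of i] by (meson not_less)
      then show "i < CARD('x) \<and> strand_nonzero e l (power_mult k M)" using b unfolding strand_nonzero_def by blast
    qed (use full[OF that] in blast)
    show ?thesis
      unfolding same_shape_from_def
    proof (intro allI impI)
      fix k i l assume k: "k \<ge> cl_index e M + 1"
      show "(betti e i (int i + l) (power_mult k M) \<noteq> 0) = (betti e i (int i + l + 1) (power_mult (Suc k) M) \<noteq> 0)"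
        using nonzero[OF k, of i l] nonzero[of "Suc k" i "l + 1"] shift[of k l] k by (simp add: add.assoc)
    qed
  qed
  fix m and d :: "nat \<Rightarrow> int" assume d: "d ` {1..m} = generator_degrees e M"
  have gen: "(\<exists>i\<in>{1..m}. j = d i) \<longleftrightarrow> \<not> piece e M j \<subseteq> vars_mult (piece e M (j - 1))" for j
    using generator_degrees_iff[OF M, of j] unfolding d[symmetric] by blast
  show strand_gen: "\<exists>i\<in>{1..m}. l - int k = d i" if "cl_index e M \<le> k" "strand_nonzero e l (power_mult k M)" for k l
    unfolding gen using that(2) vars_mult_pow_mono[of "piece e M (l - int k)" _ k]
    unfolding strand_nonzero_iff_power[OF M that(1)] vars_mult_pow_Suc by blast
  show "strand_nonzero e l (power_mult k M) = (\<exists>i\<in>{1..m}. l - int k = d i)"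
    if "0 < gr_depth M" "cl_index e M \<le> k" for k l
    using strand_gen[OF that(2), of l] no_generators_descend[OF M that(1), of k "l - int k"]
    unfolding gen strand_nonzero_iff_power[OF M that(2)] by blast
qed

end
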